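(* Let $\alpha,\delta\in\mathbb R$, let $(L(t))_{t\in\mathbb R}$ be a two-sided Lévy process and let $(Y_t)_{t\in\mathbb R}=\big(L(\tfrac{e^{\delta t}-1}{e^{\delta}-1})\big)_{t\in\mathbb R}$ be the time-changed Lévy process. Suppose that one of the following conditions is fulfilled: (a) $\delta>0$ and $\alpha>\delta/2$; (b) $\delta<0$, $\alpha>-\delta/2$ and $$\sup_{\frac1\delta\log 2\le s\le 0}\mathbb E\left[\Big|\int_s^0e^{t(\alpha-\delta/2)}\,dY_t\Big|^{\gamma}\right]<\infty\quad\text{for some }\gamma>\frac{-\delta}{\alpha+\delta/2}.$$ Then the process $(X_t)_{t\ge0}$ given by $$X_t:=\int_{-\infty}^{\log t}e^{u(\alpha-\delta/2)}\,dY_u$$ (with $X_0=0$) is well-defined (i.e. the integrals exist as almost sure limits) and is an additive $(\alpha,\delta)$-dilatively stable process.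
   Context: All processes are real-valued. Two-sided Lévy process generated by the law of an infinitely divisible random variable: $L(t)=L^{(1)}(t)$ for $t\ge0$ and $L(t)=-L^{(2)}((-t)-)$ for $t<0$ (left limit at $-t$), where $L^{(1)},L^{(2)}$ are independent copies of the (càdlàg) Lévy process whose value at time $1$ has that law. Additive process $(X_t)_{t\ge0}$: (i) for any $0\le t_0<t_1<\dots<t_n$ the random variables $X_{t_0},X_{t_1}-X_{t_0},\dots,X_{t_n}-X_{t_{n-1}}$ are independent; (ii) it is stochastically continuous; (iii) almost surely its paths are right-continuous with left limits (càdlàg); (iv) $X_0=0$ almost surely. A process is infinitely divisible if all its finite-dimensional distributions are. For an infinitely divisible process $X$, $\Psi^X_{t_1,\dots,t_k}:\mathbb R^k\to\mathbb C$ denotes the log-characteristic function (Lévy exponent) of $(X_{t_1},\dots,X_{t_k})$, i.e. the unique continuous function with $\Psi^X_{t_1,\dots,t_k}(0,\dots,0)=0$ and $\mathbb E[\exp(i\sum_j\theta_jX_{t_j})]=\exp(\Psi^X_{t_1,\dots,t_k}(\theta_1,\dots,\theta_k))$. An infinitely divisible process $(X_t)_{t\ge0}$ is $(\alpha,\delta)$-dilatively stable if $\Psi^X_{Tt_1,\dots,Tt_k}(\theta_1,\dots,\theta_k)=T^{\delta}\,\Psi^X_{t_1,\dots,t_k}(T^{\alpha-\delta/2}\theta_1,\dots,T^{\alpha-\delta/2}\theta_k)$ for all $T>0$, $k\in\mathbb N$, $t_1,\dots,t_k\ge0$, $\theta_1,\dots,\theta_k\in\mathbb R$. Random integral: for a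 process $Y$ with càdlàg paths, a continuously differentiable function $A$ and $a<b$, $\int_a^bA(t)\,dY_t:=A(b)Y_b-A(a)Y_a-\int_a^bA'(t)Y_t\,dt$ (pathwise Riemann integral). $\int_{-\infty}^{b}A(t)\,dY_t$ denotes the almost sure limit of $\int_a^bA(t)\,dY_t$ as $a\downarrow-\infty$; for $t=0$ the integral $\int_{-\infty}^{\log 0}$ is read as $0$. *)

theory Defs
  imports "HOL-Probability.Probability"
begin

section \<open>Infinite divisibility and Levy exponents\<close>

text \<open>A vector of \<open>\<real>\<^sup>k\<close> is a function on \<open>{..<k}\<close>, extended by \<^term>\<open>undefined\<close>; this is
  the space underlying the product \<open>\<sigma>\<close>-algebra, and as a subspace of \<^typ>\<open>nat \<Rightarrow> real\<close> with the
  product topology it carries the usual topology.\<close>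

abbreviation Rn :: "nat \<Rightarrow> (nat \<Rightarrow> real) set" where
  "Rn k \<equiv> {..<k} \<rightarrow>\<^sub>E UNIV"

abbreviation borel_Rn :: "nat \<Rightarrow> (nat \<Rightarrow> real) measure" where
  "borel_Rn k \<equiv> \<Pi>\<^sub>M j\<in>{..<k}. borel"

text \<open>A law is infinitely divisible if, for every \<open>n \<ge> 1\<close>, it is the law of a sum of \<open>n\<close>
  independent random variables with a common law \<open>\<nu>\<close>.\<close>

definition infinitely_divisible :: "real measure \<Rightarrow> bool" where
  "infinitely_divisible \<mu> \<longleftrightarrow>
     (\<forall>n::nat\<ge>1. \<exists>\<nu>. prob_space \<nu> \<and> sets \<nu> = sets borel \<and>
        \<mu> = distr (\<Pi>\<^sub>M i\<in>{..<n}. \<nu>) borel (\<lambda>x. \<Sum>i<n. x i))"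

definition infinitely_divisible_Rn :: "nat \<Rightarrow> (nat \<Rightarrow> real) measure \<Rightarrow> bool" where
  "infinitely_divisible_Rn k \<mu> \<longleftrightarrow>
     (\<forall>n::nat\<ge>1. \<exists>\<nu>. prob_space \<nu> \<and> sets \<nu> = sets (borel_Rn k) \<and>
        \<mu> = distr (\<Pi>\<^sub>M i\<in>{..<n}. \<nu>) (borel_Rn k) (\<lambda>x. \<lambda>j\<in>{..<k}. \<Sum>i<n. x i j))"

text \<open>Processes are families \<open>X t \<omega>\<close>; those indexed by \<open>[0,\<infinity>)\<close> are only looked at for \<open>t \<ge> 0\<close>.\<close>

definition infinitely_divisible_process :: "'w measure \<Rightarrow> (real \<Rightarrow> 'w \<Rightarrow> real) \<Rightarrow> bool" where
  "infinitely_divisible_process M X \<longleftrightarrow>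
     (\<forall>t\<ge>0. X t \<in> borel_measurable M) \<and>
     (\<forall>k t. (\<forall>j<k. 0 \<le> t j) \<longrightarrow>
        infinitely_divisible_Rn k (distr M (borel_Rn k) (\<lambda>\<omega>. \<lambda>j\<in>{..<k}. X (t j) \<omega>)))"

text \<open>The requirement \<open>\<psi> \<in> extensional (Rn k)\<close> only fixes the junk values of \<open>\<psi>\<close> outside \<open>\<real>\<^sup>k\<close>, so
  that the defining properties determine \<open>\<psi>\<close> as a HOL function.\<close>

definition levy_exponent ::
  "'w measure \<Rightarrow> (real \<Rightarrow> 'w \<Rightarrow> real) \<Rightarrow> nat \<Rightarrow> (nat \<Rightarrow> real) \<Rightarrow> (nat \<Rightarrow> real) \<Rightarrow> complex" where
  "levy_exponent M X k t =
     (THE \<psi>. \<psi> \<in> extensional (Rn k) \<and> continuous_on (Rn k) \<psi> \<and> \<psi> (\<lambda>j\<in>{..<k}. 0) = 0 \<and>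
        (\<forall>\<theta>\<in>Rn k. (CLINT \<omega>|M. exp (\<i> * complex_of_real (\<Sum>j<k. \<theta> j * X (t j) \<omega>))) = exp (\<psi> \<theta>)))"

definition dilatively_stable ::
  "'w measure \<Rightarrow> real \<Rightarrow> real \<Rightarrow> (real \<Rightarrow> 'w \<Rightarrow> real) \<Rightarrow> bool" where
  "dilatively_stable M \<alpha> \<delta> X \<longleftrightarrow>
     infinitely_divisible_process M X \<and>
     (\<forall>T>0. \<forall>k t. (\<forall>j<k. 0 \<le> t j) \<longrightarrow> (\<forall>\<theta>\<in>Rn k.
        levy_exponent M X k (\<lambda>j. T * t j) \<theta> =
        complex_of_real (T powr \<delta>) *
          levy_exponent M X k t (\<lambda>j\<in>{..<k}. T powr (\<alpha> - \<delta>/2) * \<theta> j)))"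

section \<open>Additive and Levy processes\<close>

definition cadlag :: "(real \<Rightarrow> real) \<Rightarrow> bool" where
  "cadlag f \<longleftrightarrow> (\<forall>t\<ge>0. continuous (at_right t) f) \<and> (\<forall>t>0. \<exists>l. (f \<longlongrightarrow> l) (at_left t))"

definition stochastically_continuous :: "'w measure \<Rightarrow> (real \<Rightarrow> 'w \<Rightarrow> real) \<Rightarrow> bool" where
  "stochastically_continuous M X \<longleftrightarrow>
     (\<forall>t\<ge>0. \<forall>\<epsilon>>0.
        ((\<lambda>s. measure M {\<omega>\<in>space M. \<bar>X s \<omega> - X t \<omega>\<bar> > \<epsilon>}) \<longlongrightarrow> 0) (at t within {0..}))"

definition additive_process :: "'w measure \<Rightarrow> (real \<Rightarrow> 'w \<Rightarrow> real) \<Rightarrow> bool" where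
  "additive_process M X \<longleftrightarrow>
     (\<forall>t\<ge>0. X t \<in> borel_measurable M) \<and>
     (\<forall>n t. 0 \<le> t 0 \<and> (\<forall>i<n. t i < t (Suc i)) \<longrightarrow>
        prob_space.indep_vars M (\<lambda>_. borel)
          (\<lambda>i \<omega>. if i = 0 then X (t 0) \<omega> else X (t i) \<omega> - X (t (i - 1)) \<omega>) {..n::nat}) \<and>
     stochastically_continuous M X \<and>
     (AE \<omega> in M. cadlag (\<lambda>t. X t \<omega>)) \<and>
     (AE \<omega> in M. X 0 \<omega> = 0)"

definition levy_process :: "'w measure \<Rightarrow> (real \<Rightarrow> 'w \<Rightarrow> real) \<Rightarrow> bool" where
  "levy_process M X \<longleftrightarrow>
     additive_process M X \<and>
     (\<forall>s\<ge>0. \<forall>h\<ge>0. distr M borel (\<lambda>\<omega>. X (s + h) \<omega> - X s \<omega>) = distr M borel (X h))"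

text \<open>The law of a Levy process is determined by its law at time 1, so \<open>L1\<close> and \<open>L2\<close> below are
  copies of each other. Their independence is that of the \<open>\<sigma>\<close>-algebras generated by the whole
  processes. \<^term>\<open>Lim (at_left (-t)) (\<lambda>s. L2 s \<omega>)\<close> is the left limit \<open>L2((-t)-)\<close>.\<close>

definition two_sided_levy_process ::
  "'w measure \<Rightarrow> real measure \<Rightarrow> (real \<Rightarrow> 'w \<Rightarrow> real) \<Rightarrow> bool" where
  "two_sided_levy_process M \<mu> L \<longleftrightarrow>
     infinitely_divisible \<mu> \<and>
     (\<exists>L1 L2. levy_process M L1 \<and> distr M borel (L1 1) = \<mu> \<and>
        levy_process M L2 \<and> distr M borel (L2 1) = \<mu> \<and>
        prob_space.indep_var M
          (\<Pi>\<^sub>M t\<in>{0..}. borel) (\<lambda>\<omega>. \<lambda>t\<in>{0..}. L1 t \<omega>)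
          (\<Pi>\<^sub>M t\<in>{0..}. borel) (\<lambda>\<omega>. \<lambda>t\<in>{0..}. L2 t \<omega>) \<and>
        (\<forall>\<omega>\<in>space M. \<forall>t.
           L t \<omega> = (if 0 \<le> t then L1 t \<omega> else - Lim (at_left (- t)) (\<lambda>s. L2 s \<omega>))))"

definition time_changed :: "real \<Rightarrow> (real \<Rightarrow> 'w \<Rightarrow> real) \<Rightarrow> real \<Rightarrow> 'w \<Rightarrow> real" where
  "time_changed \<delta> L t = L ((exp (\<delta> * t) - 1) / (exp \<delta> - 1))"

section \<open>Random integrals\<close>

text \<open>For continuously differentiable \<open>A\<close> and a cadlag path the integrand is Riemann integrable, and
  the gauge integral used here agrees with the Riemann integral.\<close>

definition random_integral ::
  "(real \<Rightarrow> real) \<Rightarrow> (real \<Rightarrow> 'w \<Rightarrow> real) \<Rightarrow> real \<Rightarrow> real \<Rightarrow> 'w \<Rightarrow> real" where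
  "random_integral A Y a b \<omega> =
     A b * Y b \<omega> - A a * Y a \<omega> - integral {a..b} (\<lambda>t. deriv A t * Y t \<omega>)"

text \<open>\<open>X t\<close> is the almost sure limit of \<open>\<integral>\<^sub>a\<^bsup>log t\<^esup> A dY\<close> as \<open>a \<down> -\<infinity>\<close>. Since the integrals are
  defined path by path, the exceptional null set does not depend on \<open>t\<close>; hence \<open>X\<close> is determined up
  to indistinguishability, and its path properties are meaningful.\<close>

definition is_log_integral_process ::
  "'w measure \<Rightarrow> (real \<Rightarrow> real) \<Rightarrow> (real \<Rightarrow> 'w \<Rightarrow> real) \<Rightarrow> (real \<Rightarrow> 'w \<Rightarrow> real) \<Rightarrow> bool" where
  "is_log_integral_process M A Y X \<longleftrightarrow>
     (\<forall>t\<ge>0. X t \<in> borel_measurable M) \<and>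
     (\<forall>\<omega>\<in>space M. X 0 \<omega> = 0) \<and>
     (AE \<omega> in M. \<forall>t>0. ((\<lambda>a. random_integral A Y a (ln t) \<omega>) \<longlongrightarrow> X t \<omega>) at_bot)"

end

theory Submission
  imports Defs
begin

text \<open>Write \<open>\<kappa> = \<alpha> - \<delta>/2\<close>, which is positive under either condition, and
  \<open>\<tau> u = (exp (\<delta> * u) - 1) / (exp \<delta> - 1)\<close> for the clock of the time change. For \<open>a < b\<close> the random
  integral \<open>I a b\<close> of \<open>exp (\<kappa> * u)\<close> is, path by path, the limit of Riemann--Stieltjes sums of increments
  of the Levy process over the clock. Therefore integrals over consecutive intervals are independent
  (\<open>I_indep\<close>), and the characteristic function of \<open>I a b\<close> is \<open>exp (\<Psi> a b \<theta>)\<close>, where \<open>\<Psi> a b \<theta>\<close> is the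
  integral of \<open>\<psi> (\<theta> * exp (\<kappa> * t))\<close> against the clock and \<open>\<psi>\<close> is the exponent of the Levy process
  (\<open>char_I\<close>). Translation by \<open>c\<close> multiplies the increments of the clock by \<open>exp (\<delta> * c)\<close> and the
  integrand by \<open>exp (\<kappa> * c)\<close>, so \<open>\<Psi> (a + c) (b + c) \<theta> = exp (\<delta> * c) * \<Psi> a b (exp (\<kappa> * c) * \<theta>)\<close>
  (\<open>\<Psi>_shift\<close>). This identity is behind everything that follows.

  Existence of the limit at \<open>-\<infinity>\<close>. For \<open>\<delta> > 0\<close> the clock stays bounded on the negative half-line, hence
  so does the path, and the decay of the integrand suffices. For \<open>\<delta> < 0\<close> the clock runs to \<open>-\<infinity>\<close>. Cut the
  half-line at the points \<open>s k\<close> with \<open>exp (\<delta> * s k) = 2 ^ k\<close>. By the translation identity the integrals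
  in the \<open>k\<close>-th block are distributed like scaled sums of \<open>2 ^ k\<close> independent copies of integrals in the
  block that ends at 0; a sum of \<open>n\<close> terms exceeds a level only if some term exceeds an \<open>n\<close>-th
  of it, and with Markov's inequality the moment condition makes the resulting probabilities a
  geometric series. Etemadi's inequality extends this to the supremum over a block, and the
  Borel--Cantelli lemma gives a Cauchy criterion (\<open>AE_limit_of_block_moments\<close>).

  Properties of the limit. Independent increments and path regularity pass to the limit, and a fixed
  time is almost surely no jump time, which yields stochastic continuity. Since the
  integrals converge, \<open>exp (\<Psi> a a')\<close> tends to 1 locally uniformly, and then \<open>\<Psi> a a'\<close>, a continuous
  logarithm that vanishes at 0, tends to 0. So \<open>\<Psi> a (ln t)\<close> has a limit \<open>G t\<close> as \<open>a\<close> tends to \<open>-\<infinity>\<close>,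
  and the translation identity becomes
  \<open>G (T * t) \<theta> = T powr \<delta> * G t (T powr \<kappa> * \<theta>)\<close> (\<open>G_scaling\<close>).
  Finite-dimensional distributions of the process are linear images of independent increments
  whose exponents are differences of \<open>G\<close>. Choosing \<open>T powr \<delta> = 1 / n\<close> exhibits an \<open>n\<close>-th
  convolution root of each increment, hence of the vector, and the joint exponents inherit the scaling of
  \<open>G\<close> (locale \<open>scaling_exponent\<close>).

  The two-sided process is first replaced by a version whose paths are all regular and whose
  increments over the whole real line are described at once (\<open>two_sided_levy_imp_bilateral\<close>).\<close>

section \<open>Riemann--Stieltjes sums along right-continuous paths\<close>

text \<open>The paths to be integrated run over the whole real line, hence the limits at every real time.\<close>

definition rcll :: "(real \<Rightarrow> real) \<Rightarrow> bool" where
  "rcll y \<longleftrightarrow> (\<forall>t. continuous (at_right t) y \<and> (\<exists>l. (y \<longlongrightarrow> l) (at_left t)))"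

text \<open>To the left of a point the path is near its left limit, to the right near its value; compactness
  does the rest.\<close>

lemma rcll_locally_bounded:
  assumes "rcll y"
  shows "\<exists>B. \<forall>t\<in>{a..b}. \<bar>y t\<bar> \<le> B"
proof (cases "a \<le> b")
  case True
  then show ?thesis
  proof (induction rule: Bolzano)
    case (trans a b c)
    then obtain B C where "\<forall>t\<in>{a..b}. \<bar>y t\<bar> \<le> B" "\<forall>t\<in>{b..c}. \<bar>y t\<bar> \<le> C" by auto
    then have "\<forall>t\<in>{a..c}. \<bar>y t\<bar> \<le> max B C"
      by (metis atLeastAtMost_iff le_max_iff_disj linear)
    then show ?case by blast
  next
    case (local x)
    obtain l where l: "(y \<longlongrightarrow> l) (at_left x)" using assms unfolding rcll_def by blast
    have r: "(y \<longlongrightarrow> y x) (at_right x)" using assms unfolding rcll_def continuous_within by blast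
    have "eventually (\<lambda>s. dist (y s) l < 1) (at_left x)" using tendstoD[OF l] by auto
    then obtain b1 where b1: "b1 < x" "\<And>s. b1 < s \<Longrightarrow> s < x \<Longrightarrow> dist (y s) l < 1"
      unfolding eventually_at_left_field by auto
    have "eventually (\<lambda>s. dist (y s) (y x) < 1) (at_right x)" using tendstoD[OF r] by auto
    then obtain b2 where b2: "b2 > x" "\<And>s. x < s \<Longrightarrow> s < b2 \<Longrightarrow> dist (y s) (y x) < 1"
      unfolding eventually_at_right_field by auto
    define d where "d = min (x - b1) (b2 - x)"
    have "d > 0" using b1 b2 by (auto simp: d_def)
    moreover have "\<bar>y t\<bar> \<le> \<bar>l\<bar> + \<bar>y x\<bar> + 1" if "u \<le> x" "x \<le> v" "v - u < d" "t \<in> {u..v}" for u v t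
    proof -
      consider "t < x" | "t = x" | "t > x" by linarith
      then show ?thesis
      proof cases
        case 1
        then have "dist (y t) l < 1" using b1(2)[of t] that unfolding d_def by auto
        then show ?thesis by (auto simp: dist_real_def)
      next
        case 3
        then have "dist (y t) (y x) < 1" using b2(2)[of t] that unfolding d_def by auto
        then show ?thesis by (auto simp: dist_real_def)
      qed auto
    qed
    ultimately show ?case by blast
  qed
qed auto

lemma chain_start_le:
  fixes t :: "nat \<Rightarrow> real"
  assumes "\<forall>i<n. t i \<le> t (Suc i)" "i \<le> n"
  shows "t 0 \<le> t i"
  using assms(2)
proof (induction i)
  case (Suc i)
  then have "t 0 \<le> t i" "t i \<le> t (Suc i)" using assms(1) by auto
  then show ?case by linarith
qed simp

definition grid :: "real \<Rightarrow> real \<Rightarrow> nat \<Rightarrow> nat \<Rightarrow> real" where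
  "grid a b n m = a + (b - a) * (real m / real n)"

lemma grid_0 [simp]: "grid a b n 0 = a"
  by (simp add: grid_def)

lemma grid_last [simp]: "n > 0 \<Longrightarrow> grid a b n n = b"
  by (simp add: grid_def)

lemma grid_less_Suc: "a < b \<Longrightarrow> n > 0 \<Longrightarrow> grid a b n m < grid a b n (Suc m)"
  by (simp add: grid_def divide_strict_right_mono)

lemma has_integral_sum_cells:
  fixes h :: "real \<Rightarrow> 'b::euclidean_space" and p :: "nat \<Rightarrow> real"
  assumes "\<And>m. m < n \<Longrightarrow> (h has_integral c m) {p m..p (Suc m)}"
    and "\<And>m. m < n \<Longrightarrow> p m \<le> p (Suc m)"
  shows "p 0 \<le> p n \<and> (h has_integral (\<Sum>m<n. c m)) {p 0..p n}"
  using assms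
proof (induction n)
  case 0
  show ?case using has_integral_refl(2)[of h "p 0"] by simp
next
  case (Suc n)
  then have "p 0 \<le> p n" "(h has_integral (\<Sum>m<n. c m)) {p 0..p n}" by auto
  then show ?case
    using Suc.prems(1)[of n] Suc.prems(2)[of n] has_integral_combine[of "p 0" "p n" "p (Suc n)" h]
    by simp
qed

text \<open>A tagged Riemann--Stieltjes sum is the integral of a step function: \<open>q n t\<close> is the tag of the cell
  that contains \<open>t\<close>. Dominated convergence for the gauge integral turns bounded pointwise convergence of
  the step functions into convergence of the sums, and gives integrability of the limit as well.\<close>

lemma tagged_sums_tendsto_integral:
  fixes y :: "real \<Rightarrow> 'b::euclidean_space" and g g' :: "real \<Rightarrow> real"
  assumes ab: "a < b"
    and g: "\<And>t. (g has_real_derivative g' t) (at t)"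
    and g': "continuous_on {a..b} g'"
    and bound: "\<And>t. t \<in> {a..b} \<Longrightarrow> norm (y t) \<le> B"
    and q: "\<And>n t. n > 0 \<Longrightarrow> t \<in> {a..b} \<Longrightarrow> q n t \<in> {a..b}"
    and cell: "\<And>n m t. n > 0 \<Longrightarrow> m < n \<Longrightarrow> grid a b n m < t \<Longrightarrow> t < grid a b n (Suc m) \<Longrightarrow> q n t = \<xi> n m"
    and conv: "\<And>t. t \<in> {a..b} \<Longrightarrow> (\<lambda>n. y (q n t)) \<longlonglongrightarrow> y t"
  shows "(\<lambda>t. g' t *\<^sub>R y t) integrable_on {a..b}"
    and "(\<lambda>n. \<Sum>m<n. (g (grid a b n (Suc m)) - g (grid a b n m)) *\<^sub>R y (\<xi> n m))
           \<longlonglongrightarrow> integral {a..b} (\<lambda>t. g' t *\<^sub>R y t)"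
proof -
  define f where "f k t = g' t *\<^sub>R y (q (Suc k) t)" for k t
  define S where "S n = (\<Sum>m<n. (g (grid a b n (Suc m)) - g (grid a b n m)) *\<^sub>R y (\<xi> n m))" for n
  have fint: "(f k has_integral S (Suc k)) {a..b}" for k
  proof -
    let ?p = "grid a b (Suc k)"
    have "(f k has_integral (g (?p (Suc m)) - g (?p m)) *\<^sub>R y (\<xi> (Suc k) m)) {?p m..?p (Suc m)}"
      if "m < Suc k" for m
    proof -
      have "(g' has_integral g (?p (Suc m)) - g (?p m)) {?p m..?p (Suc m)}"
        using ab grid_less_Suc[of a b "Suc k" m] g
        by (intro fundamental_theorem_of_calculus)
           (auto simp: has_real_derivative_iff_has_vector_derivative[symmetric] intro: has_field_derivative_at_within)
      then have "((\<lambda>t. g' t *\<^sub>R y (\<xi> (Suc k) m)) has_integral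
          (g (?p (Suc m)) - g (?p m)) *\<^sub>R y (\<xi> (Suc k) m)) {?p m..?p (Suc m)}"
        using has_integral_linear[OF _ bounded_linear_scaleR_left[of "y (\<xi> (Suc k) m)"]]
        by (auto simp: o_def)
      then show ?thesis
        by (rule has_integral_spike_finite[of "{?p m, ?p (Suc m)}", rotated 2])
           (use cell[of "Suc k" m] that in \<open>auto simp: f_def\<close>)
    qed
    from has_integral_sum_cells[where n="Suc k" and p="?p", OF this] show ?thesis
      using ab grid_less_Suc[of a b "Suc k"] unfolding S_def by (auto intro: less_imp_le)
  qed
  obtain C where C: "\<And>t. t \<in> {a..b} \<Longrightarrow> \<bar>g' t\<bar> \<le> C"
    using compact_imp_bounded[OF compact_continuous_image[OF g' compact_Icc]]
    unfolding bounded_iff by (metis imageI real_norm_def)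
  have nb: "norm (f k t) \<le> C * B" if "t \<in> {a..b}" for k t
    unfolding f_def using C[OF that] bound[OF q[of "Suc k" t]] that
    by (auto intro!: mult_mono intro: order_trans[OF abs_ge_zero])
  have lim: "(\<lambda>k. f k t) \<longlonglongrightarrow> g' t *\<^sub>R y t" if "t \<in> {a..b}" for t
    unfolding f_def using filterlim_compose[OF conv[OF that] filterlim_Suc] by (intro tendsto_intros)
  have i: "f k integrable_on {a..b}" for k using fint by blast
  note dc = dominated_convergence[where f=f and h="\<lambda>_. C * B" and S="{a..b}" and g="\<lambda>t. g' t *\<^sub>R y t",
      OF i integrable_const_ivl nb lim]
  show "(\<lambda>t. g' t *\<^sub>R y t) integrable_on {a..b}" using dc(1) by simp
  have "(\<lambda>k. S (Suc k)) \<longlonglongrightarrow> integral {a..b} (\<lambda>t. g' t *\<^sub>R y t)"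
    using dc(2) integral_unique[OF fint] by simp
  then show "(\<lambda>n. \<Sum>m<n. (g (grid a b n (Suc m)) - g (grid a b n m)) *\<^sub>R y (\<xi> n m))
           \<longlonglongrightarrow> integral {a..b} (\<lambda>t. g' t *\<^sub>R y t)"
    unfolding S_def[symmetric] by (rule filterlim_sequentially_Suc[THEN iffD1])
qed

lemma ceiling_in_cell: "real m < x \<Longrightarrow> x < real (Suc m) \<Longrightarrow> \<lceil>x\<rceil> = int (Suc m)"
  by (intro ceiling_unique) auto

lemma floor_in_cell: "real m < x \<Longrightarrow> x < real (Suc m) \<Longrightarrow> \<lfloor>x\<rfloor> = int m"
  by (intro floor_unique) auto

lemma in_cell_iff:
  assumes "a < b" "n > 0"
  shows "grid a b n m < t \<longleftrightarrow> real m < real n * (t - a) / (b - a)"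
    and "t < grid a b n m \<longleftrightarrow> real n * (t - a) / (b - a) < real m"
  using assms by (auto simp: grid_def field_simps)

lemma grid_index_tendsto:
  fixes r :: "real \<Rightarrow> int"
  assumes ab: "a < b" and r: "\<And>x. \<bar>real_of_int (r x) - x\<bar> \<le> 1"
  shows "(\<lambda>n. a + (b - a) * (real_of_int (r (real n * (t - a) / (b - a))) / real n)) \<longlonglongrightarrow> t"
proof (rule LIM_zero_cancel, rule Lim_null_comparison[where g="\<lambda>n. (b - a) / real n"])
  show "\<forall>\<^sub>F n in sequentially. norm (a + (b - a) * (real_of_int (r (real n * (t - a) / (b - a))) / real n) - t)
          \<le> (b - a) / real n"
    using eventually_gt_at_top[of 0]
  proof eventually_elim
    case (elim n)
    define x where "x = real n * (t - a) / (b - a)"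
    have t: "t = a + (b - a) * (x / n)" using ab elim by (simp add: x_def)
    have "a + (b - a) * (real_of_int (r x) / real n) - t = (b - a) / n * (real_of_int (r x) - x)"
      by (subst t) (simp add: field_simps diff_divide_distrib)
    also have "norm \<dots> \<le> (b - a) / n * 1"
      unfolding norm_mult using ab r[of x] by (intro mult_mono) auto
    finally show ?case by (simp add: x_def)
  qed
qed real_asymp

text \<open>Right end points as tags approach \<open>t\<close> from the right, where the path is continuous.\<close>

lemma right_tag_sums_tendsto_integral:
  fixes y g g' :: "real \<Rightarrow> real"
  assumes ab: "a < b" and y: "rcll y"
    and g: "\<And>t. (g has_real_derivative g' t) (at t)" and g': "continuous_on {a..b} g'"
  shows "(\<lambda>t. g' t * y t) integrable_on {a..b}"
    and "(\<lambda>n. \<Sum>m<n. (g (grid a b n (Suc m)) - g (grid a b n m)) * y (grid a b n (Suc m)))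
           \<longlonglongrightarrow> integral {a..b} (\<lambda>t. g' t * y t)"
proof -
  define q where "q n t = a + (b - a) * (real_of_int \<lceil>real n * (t - a) / (b - a)\<rceil> / real n)" for n t
  obtain B where B: "\<And>t. t \<in> {a..b} \<Longrightarrow> norm (y t) \<le> B"
    using rcll_locally_bounded[OF y, of a b] by (metis real_norm_def)
  have qge: "t \<le> q n t" if "n > 0" for n t
  proof -
    have "t = a + (b - a) * ((real n * (t - a) / (b - a)) / real n)" using ab that by simp
    also have "\<dots> \<le> q n t" unfolding q_def using ab
      by (intro add_left_mono mult_left_mono divide_right_mono) auto
    finally show ?thesis .
  qed
  have qle: "q n t \<le> b" if "n > 0" "t \<le> b" for n t
  proof -
    have "real n * (t - a) / (b - a) \<le> real n" using that ab by (simp add: field_simps)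
    then have "real_of_int \<lceil>real n * (t - a) / (b - a)\<rceil> \<le> real n"
      by (metis ceiling_le_iff of_int_le_iff of_int_of_nat_eq)
    then have "(b - a) * (real_of_int \<lceil>real n * (t - a) / (b - a)\<rceil> / real n) \<le> (b - a) * 1"
      using ab that by (intro mult_left_mono) auto
    then show ?thesis unfolding q_def by simp
  qed
  have conv: "(\<lambda>n. y (q n t)) \<longlonglongrightarrow> y t" for t
  proof -
    have lim: "(\<lambda>n. q n t) \<longlonglongrightarrow> t" unfolding q_def
      by (rule grid_index_tendsto[OF ab]) (auto simp: abs_le_iff; linarith)
    have "continuous (at t within {t..}) y"
      using y unfolding rcll_def by (metis at_within_Ici_at_right)
    then have "(y \<longlongrightarrow> y t) (at t within {t..})" by (simp add: continuous_within)
    then have *: "((\<lambda>n. y (q (Suc n) t)) \<longlonglongrightarrow> y t)"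
    proof -
      have "\<forall>x. (\<forall>n. x n \<in> {t..}) \<and> x \<longlonglongrightarrow> t \<longrightarrow> (y \<circ> x) \<longlonglongrightarrow> y t"
        using continuous_within_sequentially[of t "{t..}" y] \<open>continuous (at t within {t..}) y\<close> by simp
      from this[rule_format, of "\<lambda>n. q (Suc n) t"] show ?thesis
        using qge filterlim_sequentially_Suc[THEN iffD2, OF lim] by (simp add: o_def)
    qed
    then show ?thesis by (rule filterlim_sequentially_Suc[THEN iffD1])
  qed
  have cell: "q n t = grid a b n (Suc m)"
    if "n > 0" "m < n" "grid a b n m < t" "t < grid a b n (Suc m)" for n m t
  proof -
    have "\<lceil>real n * (t - a) / (b - a)\<rceil> = int (Suc m)"
      using that in_cell_iff[OF ab that(1)] by (intro ceiling_in_cell) auto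
    then show ?thesis by (simp add: q_def grid_def)
  qed
  have qin: "q n t \<in> {a..b}" if "n > 0" "t \<in> {a..b}" for n t
    using qge[OF that(1), of t] qle[OF that(1), of t] that(2) by auto
  note R = tagged_sums_tendsto_integral[OF ab g g' B qin cell conv]
  show "(\<lambda>t. g' t * y t) integrable_on {a..b}"
    and "(\<lambda>n. \<Sum>m<n. (g (grid a b n (Suc m)) - g (grid a b n m)) * y (grid a b n (Suc m)))
           \<longlonglongrightarrow> integral {a..b} (\<lambda>t. g' t * y t)"
    using R by simp_all
qed

lemma left_tag_sums_tendsto_integral:
  fixes y :: "real \<Rightarrow> 'b::euclidean_space" and g g' :: "real \<Rightarrow> real"
  assumes ab: "a < b" and y: "continuous_on {a..b} y"
    and g: "\<And>t. (g has_real_derivative g' t) (at t)" and g': "continuous_on {a..b} g'"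
  shows "(\<lambda>n. \<Sum>m<n. (g (grid a b n (Suc m)) - g (grid a b n m)) *\<^sub>R y (grid a b n m))
           \<longlonglongrightarrow> integral {a..b} (\<lambda>t. g' t *\<^sub>R y t)"
proof -
  define q where "q n t = a + (b - a) * (real_of_int \<lfloor>real n * (t - a) / (b - a)\<rfloor> / real n)" for n t
  obtain B where B: "\<And>t. t \<in> {a..b} \<Longrightarrow> norm (y t) \<le> B"
    using compact_imp_bounded[OF compact_continuous_image[OF y compact_Icc]]
    unfolding bounded_iff by blast
  have qle: "q n t \<le> t" if "n > 0" for n t
  proof -
    have "q n t \<le> a + (b - a) * ((real n * (t - a) / (b - a)) / real n)" unfolding q_def using ab
      by (intro add_left_mono mult_left_mono divide_right_mono) auto
    also have "\<dots> = t" using ab that by simp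
    finally show ?thesis .
  qed
  have qge: "a \<le> q n t" if "n > 0" "a \<le> t" for n t
    using that ab by (auto simp: q_def)
  have qin: "q n t \<in> {a..b}" if "n > 0" "t \<in> {a..b}" for n t
    using qge[OF that(1), of t] qle[OF that(1), of t] that(2) by auto
  have conv: "(\<lambda>n. y (q n t)) \<longlonglongrightarrow> y t" if "t \<in> {a..b}" for t
  proof -
    have lim: "(\<lambda>n. q n t) \<longlonglongrightarrow> t" unfolding q_def
      by (rule grid_index_tendsto[OF ab]) (auto simp: abs_le_iff; linarith)
    have "\<forall>x. (\<forall>n. x n \<in> {a..b}) \<and> x \<longlonglongrightarrow> t \<longrightarrow> (y \<circ> x) \<longlonglongrightarrow> y t"
      using y that continuous_on_eq_continuous_within continuous_within_sequentially[of t "{a..b}" y] by blast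
    from this[rule_format, of "\<lambda>n. q (Suc n) t"] have "((\<lambda>n. y (q (Suc n) t)) \<longlonglongrightarrow> y t)"
      using qin that filterlim_sequentially_Suc[THEN iffD2, OF lim] by (simp add: o_def)
    then show ?thesis by (rule filterlim_sequentially_Suc[THEN iffD1])
  qed
  have cell: "q n t = grid a b n m"
    if "n > 0" "m < n" "grid a b n m < t" "t < grid a b n (Suc m)" for n m t
  proof -
    have "\<lfloor>real n * (t - a) / (b - a)\<rfloor> = int (m)"
      using that in_cell_iff[OF ab that(1)] by (intro floor_in_cell) auto
    then show ?thesis by (simp add: q_def grid_def)
  qed
  show ?thesis
    using tagged_sums_tendsto_integral(2)[OF ab g g' B qin cell conv] by simp
qed

lemma summation_by_parts:
  fixes f h :: "nat \<Rightarrow> real"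
  shows "(\<Sum>m<n. f m * (h (Suc m) - h m)) = f n * h n - f 0 * h 0 - (\<Sum>m<n. (f (Suc m) - f m) * h (Suc m))"
  by (induction n) (auto simp: algebra_simps)

text \<open>Summation by parts moves the increments to the smooth integrand and evaluates the path at right end
  points, so the limit is the integral defined by parts.\<close>

lemma left_sums_tendsto_by_parts:
  fixes y A A' :: "real \<Rightarrow> real"
  assumes ab: "a < b" and y: "rcll y"
    and A: "\<And>t. (A has_real_derivative A' t) (at t)" and A': "continuous_on {a..b} A'"
  shows "(\<lambda>n. \<Sum>m<n. A (grid a b n m) * (y (grid a b n (Suc m)) - y (grid a b n m)))
           \<longlonglongrightarrow> A b * y b - A a * y a - integral {a..b} (\<lambda>t. A' t * y t)"
proof -
  have "(\<lambda>n. A b * y b - A a * y a -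
      (\<Sum>m<n. (A (grid a b n (Suc m)) - A (grid a b n m)) * y (grid a b n (Suc m))))
      \<longlonglongrightarrow> A b * y b - A a * y a - integral {a..b} (\<lambda>t. A' t * y t)"
    by (intro tendsto_intros right_tag_sums_tendsto_integral[OF ab y A A'])
  moreover have "\<forall>\<^sub>F n in sequentially. A b * y b - A a * y a -
      (\<Sum>m<n. (A (grid a b n (Suc m)) - A (grid a b n m)) * y (grid a b n (Suc m)))
      = (\<Sum>m<n. A (grid a b n m) * (y (grid a b n (Suc m)) - y (grid a b n m)))"
    using eventually_gt_at_top[of 0]
    by eventually_elim
      (simp add: summation_by_parts[where f="\<lambda>m. A (grid a b _ m)" and h="\<lambda>m. y (grid a b _ m)"])
  ultimately show ?thesis by (rule Lim_transform_eventually)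
qed

text \<open>Two logarithms of the same function differ by an integer multiple of \<open>2 * pi * \<i>\<close>, which is constant
  along a path.\<close>

lemma continuous_log_unique:
  fixes f g :: "real \<Rightarrow> complex"
  assumes f: "continuous_on {0..1} f" and g: "continuous_on {0..1} g"
    and eq: "\<And>r. r \<in> {0..1} \<Longrightarrow> exp (f r) = exp (g r)" and 0: "f 0 = g 0"
  shows "f 1 = g 1"
proof -
  have "(\<lambda>r. f r - g r) constant_on {0..1}"
  proof (rule continuous_discrete_range_constant)
    fix x :: real assume x: "x \<in> {0..1}"
    show "\<exists>e>0. \<forall>y. y \<in> {0..1} \<and> f y - g y \<noteq> f x - g x \<longrightarrow> e \<le> norm (f y - g y - (f x - g x))"
    proof (intro exI[of _ "2 * pi"] conjI allI impI)
      fix y assume y: "y \<in> {0..1} \<and> f y - g y \<noteq> f x - g x"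
      have "exp (f y - g y) = exp (f x - g x)"
        using eq[OF x] eq[of y] y by (simp add: exp_diff)
      then obtain n :: int where n: "f y - g y = (f x - g x) + (of_int (2 * n) * pi) * \<i>"
        unfolding exp_eq by auto
      then have "n \<noteq> 0" using y by auto
      then have "1 \<le> \<bar>real_of_int n\<bar>" by linarith
      moreover have "norm (f y - g y - (f x - g x)) = 2 * pi * \<bar>real_of_int n\<bar>"
        by (simp add: n norm_mult)
      ultimately show "2 * pi \<le> norm (f y - g y - (f x - g x))"
        by simp
    qed auto
  qed (auto intro!: continuous_intros f g)
  then have "f 1 - g 1 = f 0 - g 0" unfolding constant_on_def by force
  then show ?thesis using 0 by simp
qed

section \<open>Independence: limits, maxima and convolution powers\<close>

text \<open>The half-lines form an intersection-stable generator of the Borel sets.\<close>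

lemma (in prob_space) indep_varsI_cdf:
  assumes rv: "\<And>i. i \<in> I \<Longrightarrow> Y i \<in> borel_measurable M"
    and cdf: "\<And>J c. J \<subseteq> I \<Longrightarrow> finite J \<Longrightarrow> J \<noteq> {} \<Longrightarrow>
      prob {\<omega>\<in>space M. \<forall>j\<in>J. Y j \<omega> \<le> (c j :: real)} = (\<Prod>j\<in>J. prob {\<omega>\<in>space M. Y j \<omega> \<le> c j})"
  shows "indep_vars (\<lambda>_. borel) Y I"
proof -
  let ?G = "\<lambda>i. {Y i -` A \<inter> space M |A. A \<in> range (\<lambda>a. {..a})}"
  have "indep_sets ?G I"
  proof (rule indep_setsI)
    fix i assume "i \<in> I"
    then show "?G i \<subseteq> events" using measurable_sets[OF rv] by auto
  next
    fix A J assume J: "J \<noteq> {}" "J \<subseteq> I" "finite J" and A: "\<forall>j\<in>J. A j \<in> ?G j"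
    have "\<exists>c. A j = Y j -` {..c} \<inter> space M" if "j \<in> J" for j
      using A[rule_format, OF that] by blast
    then have "\<forall>j\<in>J. \<exists>c. A j = Y j -` {..c} \<inter> space M" by blast
    then obtain c where c: "\<And>j. j \<in> J \<Longrightarrow> A j = Y j -` {..c j} \<inter> space M"
      using bchoice by metis
    have "(\<Inter>j\<in>J. A j) = {\<omega>\<in>space M. \<forall>j\<in>J. Y j \<omega> \<le> c j}"
      using c J(1) by auto
    moreover have "A j = {\<omega>\<in>space M. Y j \<omega> \<le> c j}" if "j \<in> J" for j
      using c[OF that] by auto
    ultimately show "prob (\<Inter>j\<in>J. A j) = (\<Prod>j\<in>J. prob (A j))"
      using cdf[OF J(2,3,1)] by simp
  qed
  moreover have "Int_stable (?G i)" for i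
  proof (rule Int_stableI)
    fix U V assume "U \<in> ?G i" "V \<in> ?G i"
    then obtain a b where "U = Y i -` {..a} \<inter> space M" "V = Y i -` {..b} \<inter> space M" by auto
    then have "U \<inter> V = Y i -` {..min a b} \<inter> space M" by auto
    then show "U \<inter> V \<in> ?G i" by blast
  qed
  ultimately have "indep_sets (\<lambda>i. sigma_sets (space M) (?G i)) I"
    by (rule indep_sets_sigma)
  moreover have "sigma_sets (space M) (?G i) = {Y i -` A \<inter> space M |A. A \<in> sets borel}" for i
  proof -
    have "sets borel = sigma_sets UNIV (range (\<lambda>a::real. {..a}))"
      by (subst borel_eq_atMost) simp
    then show ?thesis
      using sigma_sets_vimage_commute[of "Y i" "space M" UNIV "range (\<lambda>a. {..a})"] by simp
  qed
  ultimately show ?thesis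
    unfolding indep_vars_def2 using rv by simp
qed

text \<open>A continuous function that decreases to the indicator of \<open>{..c}\<close> as \<open>k\<close> grows.\<close>

definition ramp :: "real \<Rightarrow> nat \<Rightarrow> real \<Rightarrow> real" where
  "ramp c k x = max 0 (min 1 (1 - real k * (x - c)))"

lemma ramp_bounds: "0 \<le> ramp c k x" "ramp c k x \<le> 1"
  by (auto simp: ramp_def)

lemma continuous_ramp: "continuous_on UNIV (ramp c k)"
  unfolding ramp_def by (intro continuous_intros)

lemma ramp_measurable [measurable]: "ramp c k \<in> borel_measurable borel"
  by (intro borel_measurable_continuous_onI continuous_ramp)

lemma ramp_tendsto_indicator: "(\<lambda>k. ramp c k x) \<longlonglongrightarrow> indicator {..c} x"
proof (cases "x \<le> c")
  case True
  then have "ramp c k x = 1" for k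
    by (auto simp: ramp_def mult_nonneg_nonpos min_def max_def)
  then show ?thesis using True by simp
next
  case False
  then obtain N :: nat where N: "1 < real N * (x - c)"
    using reals_Archimedean3[of "x - c"] by auto
  have "eventually (\<lambda>k. ramp c k x = 0) sequentially"
    using eventually_ge_at_top[of N]
  proof eventually_elim
    case (elim k)
    then have "real N * (x - c) \<le> real k * (x - c)" using False by (intro mult_right_mono) auto
    then show ?case using N by (auto simp: ramp_def)
  qed
  then have "(\<lambda>k. ramp c k x) \<longlonglongrightarrow> 0" by (rule tendsto_eventually)
  then show ?thesis using False by simp
qed

text \<open>Joint distribution functions are limits of expectations of products of bounded continuous
  functions, and these pass to almost sure limits.\<close>

lemma (in prob_space) indep_vars_AE_limit:
  fixes X :: "nat \<Rightarrow> 'i \<Rightarrow> 'a \<Rightarrow> real"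
  assumes indep: "\<And>n. indep_vars (\<lambda>_. borel) (X n) I"
    and rv: "\<And>i. i \<in> I \<Longrightarrow> Y i \<in> borel_measurable M"
    and lim: "\<And>i. i \<in> I \<Longrightarrow> AE \<omega> in M. (\<lambda>n. X n i \<omega>) \<longlonglongrightarrow> Y i \<omega>"
  shows "indep_vars (\<lambda>_. borel) Y I"
proof (rule indep_varsI_cdf[OF rv])
  fix J and c :: "'i \<Rightarrow> real" assume J: "J \<subseteq> I" "finite J" "J \<noteq> {}"
  have Xrv: "X n i \<in> borel_measurable M" if "i \<in> I" for n i
    using indep[of n] that unfolding indep_vars_def by auto
  have prod_le1: "norm (\<Prod>j\<in>J. ramp (c j) k (Z j)) \<le> 1" for k and Z :: "'i \<Rightarrow> real"
    unfolding prod_norm[symmetric] using ramp_bounds by (intro prod_le_1) (auto simp: abs_of_nonneg)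
  have nr: "norm (ramp c k x) \<le> 1" for c k x
    using ramp_bounds[of c k x] by (simp add: abs_of_nonneg)
  have E: "(\<integral>\<omega>. (\<Prod>j\<in>J. ramp (c j) k (Y j \<omega>)) \<partial>M) = (\<Prod>j\<in>J. \<integral>\<omega>. ramp (c j) k (Y j \<omega>) \<partial>M)" for k
  proof -
    have En: "(\<integral>\<omega>. (\<Prod>j\<in>J. ramp (c j) k (X n j \<omega>)) \<partial>M) = (\<Prod>j\<in>J. \<integral>\<omega>. ramp (c j) k (X n j \<omega>) \<partial>M)" for n
    proof (rule indep_vars_lebesgue_integral[OF J(2)])
      show "indep_vars (\<lambda>_. borel) (\<lambda>j \<omega>. ramp (c j) k (X n j \<omega>)) J"
        using indep_vars_compose2[OF indep_vars_subset[OF indep J(1)], of "\<lambda>j. ramp (c j) k"] by simp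
      fix j assume "j \<in> J"
      then have [measurable]: "X n j \<in> borel_measurable M" using Xrv J by auto
      show "integrable M (\<lambda>\<omega>. ramp (c j) k (X n j \<omega>))"
        by (rule integrable_const_bound[where B=1]) (use nr in \<open>auto intro!: always_eventually\<close>)
    qed
    have rampc: "(\<lambda>n. ramp d k (f n)) \<longlonglongrightarrow> ramp d k l" if "f \<longlonglongrightarrow> l" for f :: "nat \<Rightarrow> real" and l d
      using continuous_on_tendsto_compose[OF continuous_ramp that] by auto
    have L: "(\<lambda>n. \<integral>\<omega>. (\<Prod>j\<in>J. ramp (c j) k (X n j \<omega>)) \<partial>M) \<longlonglongrightarrow> (\<integral>\<omega>. (\<Prod>j\<in>J. ramp (c j) k (Y j \<omega>)) \<partial>M)"
    proof (rule integral_dominated_convergence[where w="\<lambda>_. 1"])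
      have "AE \<omega> in M. \<forall>j\<in>J. (\<lambda>n. X n j \<omega>) \<longlonglongrightarrow> Y j \<omega>"
        using J lim by (intro AE_finite_allI) auto
      then show "AE \<omega> in M. (\<lambda>n. \<Prod>j\<in>J. ramp (c j) k (X n j \<omega>)) \<longlonglongrightarrow> (\<Prod>j\<in>J. ramp (c j) k (Y j \<omega>))"
        by eventually_elim (auto intro!: tendsto_prod rampc)
    qed (use J Xrv rv prod_le1 in \<open>auto intro!: borel_measurable_prod measurable_compose[OF _ ramp_measurable]\<close>)
    have R: "(\<lambda>n. \<integral>\<omega>. ramp (c j) k (X n j \<omega>) \<partial>M) \<longlonglongrightarrow> (\<integral>\<omega>. ramp (c j) k (Y j \<omega>) \<partial>M)" if "j \<in> J" for j
    proof (rule integral_dominated_convergence[where w="\<lambda>_. 1"])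
      have "j \<in> I" using that J by auto
      from lim[OF this] show "AE \<omega> in M. (\<lambda>n. ramp (c j) k (X n j \<omega>)) \<longlonglongrightarrow> ramp (c j) k (Y j \<omega>)"
        by eventually_elim (auto intro!: rampc)
    qed (use that J Xrv rv nr in \<open>auto intro!: measurable_compose[OF _ ramp_measurable]\<close>)
    have "(\<lambda>n. \<Prod>j\<in>J. \<integral>\<omega>. ramp (c j) k (X n j \<omega>) \<partial>M) \<longlonglongrightarrow> (\<Prod>j\<in>J. \<integral>\<omega>. ramp (c j) k (Y j \<omega>) \<partial>M)"
      by (intro tendsto_prod R)
    with L show ?thesis unfolding En by (rule LIMSEQ_unique)
  qed
  have L: "(\<lambda>k. \<integral>\<omega>. (\<Prod>j\<in>J. ramp (c j) k (Y j \<omega>)) \<partial>M) \<longlonglongrightarrow> (\<integral>\<omega>. (\<Prod>j\<in>J. indicator {..c j} (Y j \<omega>)) \<partial>M)"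
    by (rule integral_dominated_convergence[where w="\<lambda>_. 1"])
       (use J rv prod_le1 in \<open>auto intro!: borel_measurable_prod measurable_compose[OF _ ramp_measurable]
         tendsto_prod ramp_tendsto_indicator always_eventually\<close>)
  have R: "(\<lambda>k. \<integral>\<omega>. ramp (c j) k (Y j \<omega>) \<partial>M) \<longlonglongrightarrow> (\<integral>\<omega>. indicator {..c j} (Y j \<omega>) \<partial>M)" if "j \<in> J" for j
  proof -
    have "j \<in> I" using that J by auto
    then have [measurable]: "Y j \<in> borel_measurable M" by (rule rv)
    show ?thesis
      by (rule integral_dominated_convergence[where w="\<lambda>_. 1"])
         (use nr in \<open>auto intro!: ramp_tendsto_indicator always_eventually\<close>)
  qed
  have "(\<lambda>k. \<Prod>j\<in>J. \<integral>\<omega>. ramp (c j) k (Y j \<omega>) \<partial>M) \<longlonglongrightarrow> (\<Prod>j\<in>J. \<integral>\<omega>. indicator {..c j} (Y j \<omega>) \<partial>M)"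
    by (intro tendsto_prod R)
  then have eq: "(\<integral>\<omega>. (\<Prod>j\<in>J. indicator {..c j} (Y j \<omega>)) \<partial>M) = (\<Prod>j\<in>J. \<integral>\<omega>. (indicator {..c j} (Y j \<omega>) :: real) \<partial>M)"
    using L unfolding E by (rule LIMSEQ_unique[symmetric])
  have Jm: "{\<omega>\<in>space M. \<forall>j\<in>J. Y j \<omega> \<le> c j} \<in> events"
    using J rv by (intro sets.sets_Collect_finite_All) (auto intro!: borel_measurable_le)
  have "(\<integral>\<omega>. (\<Prod>j\<in>J. indicator {..c j} (Y j \<omega>)) \<partial>M) =
      (\<integral>\<omega>. (indicator {\<omega>\<in>space M. \<forall>j\<in>J. Y j \<omega> \<le> c j} \<omega> :: real) \<partial>M)"
    using J(2) by (intro Bochner_Integration.integral_cong) (auto simp: indicator_def)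
  also have "\<dots> = prob {\<omega>\<in>space M. \<forall>j\<in>J. Y j \<omega> \<le> c j}" using Jm by simp
  finally have 1: "(\<integral>\<omega>. (\<Prod>j\<in>J. indicator {..c j} (Y j \<omega>)) \<partial>M) = prob {\<omega>\<in>space M. \<forall>j\<in>J. Y j \<omega> \<le> c j}" .
  have 2: "(\<integral>\<omega>. (indicator {..c j} (Y j \<omega>) :: real) \<partial>M) = prob {\<omega>\<in>space M. Y j \<omega> \<le> c j}" if "j \<in> J" for j
  proof -
    have "j \<in> I" using that J by auto
    then have [measurable]: "Y j \<in> borel_measurable M" by (rule rv)
    have "(\<integral>\<omega>. (indicator {..c j} (Y j \<omega>) :: real) \<partial>M) = (\<integral>\<omega>. indicator {\<omega>\<in>space M. Y j \<omega> \<le> c j} \<omega> \<partial>M)"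
      by (intro Bochner_Integration.integral_cong) (auto simp: indicator_def)
    then show ?thesis by simp
  qed
  show "prob {\<omega>\<in>space M. \<forall>j\<in>J. Y j \<omega> \<le> c j} = (\<Prod>j\<in>J. prob {\<omega>\<in>space M. Y j \<omega> \<le> c j})"
    using eq unfolding 1 by (simp add: 2)
qed

text \<open>Etemadi's inequality. Let \<open>j\<close> be the first index at which the partial sum exceeds \<open>3 * l\<close>. Either the total
  sum exceeds \<open>l\<close>, or the sum of the remaining terms exceeds \<open>2 * l\<close>. The latter event is independent
  of the first passage, and it forces the total sum or the \<open>j\<close>-th partial sum above \<open>l\<close>.\<close>

lemma (in prob_space) etemadi_inequality:
  fixes D :: "nat \<Rightarrow> 'a \<Rightarrow> real"
  assumes indep: "indep_vars (\<lambda>_. borel) D {..<n}"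
    and le: "\<And>j. j \<le> n \<Longrightarrow> prob {\<omega>\<in>space M. \<bar>\<Sum>i<j. D i \<omega>\<bar> > l} \<le> p"
  shows "prob {\<omega>\<in>space M. \<exists>j\<le>n. \<bar>\<Sum>i<j. D i \<omega>\<bar> > 3 * l} \<le> 3 * p"
proof -
  define S where "S j \<omega> = (\<Sum>i<j. D i \<omega>)" for j \<omega>
  have Drv [measurable]: "D i \<in> borel_measurable M" if "i < n" for i
    using indep that unfolding indep_vars_def by auto
  have Srv [measurable]: "S j \<in> borel_measurable M" if "j \<le> n" for j
    unfolding S_def using Drv that by (intro borel_measurable_sum) auto
  define E where "E j = {\<omega>\<in>space M. \<bar>S j \<omega>\<bar> > 3 * l \<and> (\<forall>i\<in>{..<j}. \<bar>S i \<omega>\<bar> \<le> 3 * l)}" for j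
  define F where "F = {\<omega>\<in>space M. \<bar>S n \<omega>\<bar> > l}"
  define T where "T j = {\<omega>\<in>space M. \<bar>S n \<omega> - S j \<omega>\<bar> > 2 * l}" for j
  have Em: "E j \<in> events" if "j \<le> n" for j
  proof -
    have "{\<omega>\<in>space M. \<forall>i\<in>{..<j}. \<bar>S i \<omega>\<bar> \<le> 3 * l} \<in> events"
      using that by (intro sets.sets_Collect_finite_All) (auto intro!: borel_measurable_le borel_measurable_abs Srv)
    moreover have "{\<omega>\<in>space M. \<bar>S j \<omega>\<bar> > 3 * l} \<in> events" using Srv[OF that] by measurable
    moreover have "E j = {\<omega>\<in>space M. \<bar>S j \<omega>\<bar> > 3 * l} \<inter> {\<omega>\<in>space M. \<forall>i\<in>{..<j}. \<bar>S i \<omega>\<bar> \<le> 3 * l}"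
      by (auto simp: E_def)
    ultimately show ?thesis by auto
  qed
  have Fm: "F \<in> events" unfolding F_def using Srv[of n] by measurable
  have Tm: "T j \<in> events" if "j \<le> n" for j
    unfolding T_def using Srv[OF that] Srv[of n] by measurable
  have disj: "disjoint_family_on E {..n}"
  proof (clarsimp simp: disjoint_family_on_def)
    fix i j :: nat assume "i \<noteq> j"
    then show "E i \<inter> E j = {}"
      by (cases i j rule: linorder_cases) (force simp: E_def)+
  qed
  have ind: "prob (E j \<inter> T j) = prob (E j) * prob (T j)" if j: "j \<le> n" for j
  proof -
    let ?L = "Pi\<^sub>M {..<j} (\<lambda>_. borel :: real measure)" and ?R = "Pi\<^sub>M {j..<n} (\<lambda>_. borel :: real measure)"
    have iv: "indep_var ?L (\<lambda>\<omega>. restrict (\<lambda>i. D i \<omega>) {..<j}) ?R (\<lambda>\<omega>. restrict (\<lambda>i. D i \<omega>) {j..<n})"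
      using j by (intro indep_var_restrict[OF indep]) auto
    let ?s = "\<lambda>k x. \<Sum>i<k. (x i :: real)"
    let ?P = "{x\<in>space ?L. \<bar>?s j x\<bar> > 3 * l \<and> (\<forall>k\<in>{..<j}. \<bar>?s k x\<bar> \<le> 3 * l)}"
    have sm: "?s k \<in> borel_measurable ?L" if "k \<le> j" for k
      using that by (intro borel_measurable_sum measurable_component_singleton) auto
    have P: "?P \<in> sets ?L"
    proof -
      have "{x\<in>space ?L. \<forall>k\<in>{..<j}. \<bar>?s k x\<bar> \<le> 3 * l} \<in> sets ?L"
        by (intro sets.sets_Collect_finite_All) (auto intro!: borel_measurable_le borel_measurable_abs sm)
      moreover have "{x\<in>space ?L. \<bar>?s j x\<bar> > 3 * l} \<in> sets ?L" using sm[of j] by measurable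
      moreover have "?P = {x\<in>space ?L. \<bar>?s j x\<bar> > 3 * l} \<inter> {x\<in>space ?L. \<forall>k\<in>{..<j}. \<bar>?s k x\<bar> \<le> 3 * l}"
        by auto
      ultimately show ?thesis by auto
    qed
    let ?Q = "{x\<in>space ?R. \<bar>\<Sum>i\<in>{j..<n}. x i\<bar> > 2 * l}"
    have Q: "?Q \<in> sets ?R"
    proof -
      have "(\<lambda>x. \<Sum>i\<in>{j..<n}. x i :: real) \<in> borel_measurable ?R"
        by (intro borel_measurable_sum measurable_component_singleton) auto
      then show ?thesis by measurable
    qed
    have EP: "E j = (\<lambda>\<omega>. restrict (\<lambda>i. D i \<omega>) {..<j}) -` ?P \<inter> space M"
    proof -
      have "(\<Sum>i<k. restrict (\<lambda>i. D i \<omega>) {..<j} i) = S k \<omega>" if "k \<le> j" for k \<omega>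
        unfolding S_def using that by (intro sum.cong) auto
      then show ?thesis by (auto simp: E_def space_PiM)
    qed
    have TQ: "T j = (\<lambda>\<omega>. restrict (\<lambda>i. D i \<omega>) {j..<n}) -` ?Q \<inter> space M"
    proof -
      have "S n \<omega> - S j \<omega> = (\<Sum>i\<in>{j..<n}. D i \<omega>)" for \<omega>
        unfolding S_def using sum_diff_nat_ivl[of 0 j n "\<lambda>i. D i \<omega>"] j by (simp add: lessThan_atLeast0)
      then show ?thesis by (auto simp: T_def space_PiM)
    qed
    have "E j \<inter> T j = (\<lambda>\<omega>. (restrict (\<lambda>i. D i \<omega>) {..<j}, restrict (\<lambda>i. D i \<omega>) {j..<n})) -` (?P \<times> ?Q) \<inter> space M"
      unfolding EP TQ by auto
    then show ?thesis using indep_varD[OF iv P Q] EP TQ by simp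
  qed
  have Tp: "prob (T j) \<le> 2 * p" if "j \<le> n" for j
  proof -
    have m: "{\<omega>\<in>space M. \<bar>S j \<omega>\<bar> > l} \<in> events" using Srv[OF that] by measurable
    have "prob (T j) \<le> prob (F \<union> {\<omega>\<in>space M. \<bar>S j \<omega>\<bar> > l})"
      using m Fm by (intro finite_measure_mono) (auto simp: T_def F_def)
    also have "\<dots> \<le> prob F + prob {\<omega>\<in>space M. \<bar>S j \<omega>\<bar> > l}"
      using m Fm by (intro measure_Un_le) auto
    also have "\<dots> \<le> 2 * p" using le[of n] le[OF that] by (simp add: F_def S_def)
    finally show ?thesis .
  qed
  have p0: "0 \<le> p" using le[of 0] measure_nonneg order_trans by blast
  have UE: "{\<omega>\<in>space M. \<exists>j\<le>n. \<bar>S j \<omega>\<bar> > 3 * l} = (\<Union>j\<in>{..n}. E j)"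
  proof safe
    fix \<omega> j assume w: "\<omega> \<in> space M" and j: "j \<le> n" "\<bar>S j \<omega>\<bar> > 3 * l"
    define k where "k = (LEAST j. \<bar>S j \<omega>\<bar> > 3 * l)"
    have "\<bar>S k \<omega>\<bar> > 3 * l" unfolding k_def by (rule LeastI[of _ j]) (rule j)
    moreover have "k \<le> n" unfolding k_def using j Least_le[of "\<lambda>j. \<bar>S j \<omega>\<bar> > 3 * l" j] by linarith
    moreover have "\<bar>S i \<omega>\<bar> \<le> 3 * l" if "i < k" for i
      using not_less_Least[of i "\<lambda>j. \<bar>S j \<omega>\<bar> > 3 * l"] that unfolding k_def by auto
    ultimately show "\<omega> \<in> (\<Union>j\<in>{..n}. E j)" using w by (auto simp: E_def)
  qed (auto simp: E_def)
  have sub: "(\<Union>j\<in>{..n}. E j) \<subseteq> F \<union> (\<Union>j\<in>{..n}. E j \<inter> T j)"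
    by (auto simp: E_def F_def T_def)
  have "prob (\<Union>j\<in>{..n}. E j) \<le> prob (F \<union> (\<Union>j\<in>{..n}. E j \<inter> T j))"
    using Em Tm Fm by (intro finite_measure_mono[OF sub]) auto
  also have "\<dots> \<le> prob F + prob (\<Union>j\<in>{..n}. E j \<inter> T j)"
    using Em Tm Fm by (intro measure_Un_le) auto
  also have "prob (\<Union>j\<in>{..n}. E j \<inter> T j) = (\<Sum>j\<le>n. prob (E j \<inter> T j))"
    using Em Tm disj by (intro finite_measure_finite_Union) (auto simp: disjoint_family_on_def, blast)
  also have "\<dots> \<le> (\<Sum>j\<le>n. prob (E j) * (2 * p))"
    using Tp by (intro sum_mono) (auto simp: ind intro!: mult_left_mono)
  also have "\<dots> = prob (\<Union>j\<in>{..n}. E j) * (2 * p)"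
    using Em disj by (subst finite_measure_finite_Union) (auto simp: sum_distrib_right)
  also have "\<dots> \<le> 1 * (2 * p)" using p0 by (intro mult_right_mono) auto
  finally have "prob (\<Union>j\<in>{..n}. E j) \<le> prob F + 1 * (2 * p)" by simp
  moreover have "prob F \<le> p" using le[of n] by (simp add: F_def S_def)
  ultimately show ?thesis using UE unfolding S_def by simp
qed

lemma indep_vars_PiM_coordinates:
  fixes N :: "'i \<Rightarrow> real measure"
  assumes N: "\<And>i. i \<in> I \<Longrightarrow> prob_space (N i)" and sN: "\<And>i. i \<in> I \<Longrightarrow> sets (N i) = sets borel"
  shows "prob_space.indep_vars (PiM I N) (\<lambda>_. borel) (\<lambda>i x. x i) I"
proof (cases "I = {}")
  case True
  interpret prob_space "PiM I N" by (rule prob_space_PiM[OF N])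
  show ?thesis using True unfolding indep_vars_def indep_sets_def by simp
next
  case False
  interpret prob_space "PiM I N" by (rule prob_space_PiM[OF N])
  have s: "sets (PiM I N) = sets (PiM I (\<lambda>_. borel))" by (intro sets_PiM_cong sN) auto
  have m: "(\<lambda>x. x i) \<in> borel_measurable (PiM I N)" if "i \<in> I" for i
    using measurable_component_singleton[OF that, of N] measurable_cong_sets[OF refl sN[OF that]] by blast
  have d: "distr (PiM I N) borel (\<lambda>x. x i) = N i" if "i \<in> I" for i
  proof -
    have "distr (PiM I N) borel (\<lambda>x. x i) = distr (PiM I N) (N i) (\<lambda>x. x i)"
      by (rule distr_cong) (auto simp: sN that)
    also have "\<dots> = N i" by (rule distr_PiM_component[OF N that])
    finally show ?thesis .
  qed
  have "distr (PiM I N) (PiM I (\<lambda>_. borel)) (\<lambda>x. \<lambda>i\<in>I. x i) = distr (PiM I N) (PiM I N) (\<lambda>x. x)"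
    by (rule distr_cong) (auto simp: s space_PiM)
  also have "\<dots> = PiM I N" by (rule distr_id)
  also have "\<dots> = PiM I (\<lambda>i. distr (PiM I N) borel (\<lambda>x. x i))"
    using d by (intro PiM_cong) auto
  finally show ?thesis
    using indep_vars_iff_distr_eq_PiM'[OF False, where M'="\<lambda>_. borel" and X="\<lambda>i x. x i"] m by simp
qed

lemma real_distribution_of_sets_eq: "prob_space N \<Longrightarrow> sets N = sets borel \<Longrightarrow> real_distribution N"
  using sets_eq_imp_space_eq[of N borel]
  by (simp add: real_distribution_def real_distribution_axioms_def)

lemma (in prob_space) real_distribution_law:
  "X \<in> borel_measurable M \<Longrightarrow> real_distribution (distr M borel X)"
  by (rule real_distribution_of_sets_eq[OF prob_space_distr]) auto

lemma char_power_eq_convolution_power: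
  assumes mu: "real_distribution \<mu>" and nu: "real_distribution \<nu>"
    and ch: "\<And>\<theta>. char \<mu> \<theta> = char \<nu> \<theta> ^ n"
  shows "\<mu> = distr (\<Pi>\<^sub>M i\<in>{..<n}. \<nu>) borel (\<lambda>x. \<Sum>i<n. x i)"
proof (rule Levy_uniqueness[OF mu])
  interpret nu: real_distribution \<nu> by fact
  have p: "prob_space \<nu>" by unfold_locales
  interpret P: prob_space "\<Pi>\<^sub>M i\<in>{..<n}. \<nu>" by (rule prob_space_PiM[OF p])
  have iv: "P.indep_vars (\<lambda>_. borel) (\<lambda>i x. x i) {..<n}"
    by (rule indep_vars_PiM_coordinates[OF p]) simp
  have m: "(\<lambda>x. x i) \<in> borel_measurable (\<Pi>\<^sub>M i\<in>{..<n}. \<nu>)" if "i < n" for i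
    using iv that unfolding P.indep_vars_def by auto
  show "real_distribution (distr (\<Pi>\<^sub>M i\<in>{..<n}. \<nu>) borel (\<lambda>x. \<Sum>i<n. x i))"
    using m by (intro P.real_distribution_law borel_measurable_sum) auto
  have d: "distr (\<Pi>\<^sub>M i\<in>{..<n}. \<nu>) borel (\<lambda>x. x i) = \<nu>" if "i < n" for i
  proof -
    have "distr (\<Pi>\<^sub>M i\<in>{..<n}. \<nu>) borel (\<lambda>x. x i) = distr (\<Pi>\<^sub>M i\<in>{..<n}. \<nu>) \<nu> (\<lambda>x. x i)"
      by (rule distr_cong) auto
    also have "\<dots> = \<nu>" by (rule distr_PiM_component[OF p]) (use that in auto)
    finally show ?thesis .
  qed
  show "char \<mu> = char (distr (\<Pi>\<^sub>M i\<in>{..<n}. \<nu>) borel (\<lambda>x. \<Sum>i<n. x i))"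
    by (rule ext) (simp add: P.char_distr_sum[OF iv] ch d)
qed

text \<open>If a sum of \<open>n\<close> terms exceeds \<open>l\<close>, then some term exceeds \<open>l / n\<close>.\<close>

lemma char_power_tail_bound:
  assumes mu: "real_distribution \<mu>" and nu: "real_distribution \<nu>"
    and ch: "\<And>\<theta>. char \<mu> \<theta> = char \<nu> \<theta> ^ n" and n: "n > 0"
  shows "measure \<mu> {x. \<bar>x\<bar> > l} \<le> real n * measure \<nu> {x. \<bar>x\<bar> > l / real n}"
proof -
  interpret nu: real_distribution \<nu> by fact
  have p: "prob_space \<nu>" by unfold_locales
  let ?P = "\<Pi>\<^sub>M i\<in>{..<n}. \<nu>"
  interpret P: prob_space "?P" by (rule prob_space_PiM[OF p])
  have m: "(\<lambda>x. x i) \<in> measurable ?P \<nu>" if "i < n" for i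
    using that by (intro measurable_component_singleton) auto
  have mb: "(\<lambda>x. x i) \<in> borel_measurable ?P" if "i < n" for i
    using m[OF that] by (simp add: measurable_cong_sets[OF refl nu.events_eq_borel])
  have sm: "(\<lambda>x. \<Sum>i<n. x i) \<in> borel_measurable ?P" using mb by (intro borel_measurable_sum) auto
  let ?B = "\<lambda>i. {x\<in>space ?P. \<bar>x i\<bar> > l / n}"
  have Bm: "?B i \<in> sets ?P" if "i < n" for i using mb[OF that] by measurable
  have Bp: "measure ?P (?B i) = measure \<nu> {x. \<bar>x\<bar> > l / n}" if "i < n" for i
  proof -
    have s: "{x. \<bar>x\<bar> > l / n} \<in> sets \<nu>" by (simp add: nu.events_eq_borel)
    have "measure \<nu> {x. \<bar>x\<bar> > l / n} = measure (distr ?P \<nu> (\<lambda>x. x i)) {x. \<bar>x\<bar> > l / n}"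
      using distr_PiM_component[of "{..<n}" "\<lambda>_. \<nu>" i] p that by simp
    also have "\<dots> = measure ?P ((\<lambda>x. x i) -` {x. \<bar>x\<bar> > l / n} \<inter> space ?P)"
      by (rule measure_distr[OF m[OF that] s])
    also have "(\<lambda>x. x i) -` {x. \<bar>x\<bar> > l / n} \<inter> space ?P = ?B i" by auto
    finally show ?thesis by simp
  qed
  have "measure \<mu> {x. \<bar>x\<bar> > l} = measure ?P ((\<lambda>x. \<Sum>i<n. x i) -` {x. \<bar>x\<bar> > l} \<inter> space ?P)"
    by (subst char_power_eq_convolution_power[OF mu nu ch], subst measure_distr) (use sm in auto)
  also have "\<dots> \<le> measure ?P (\<Union>i<n. ?B i)"
  proof (rule P.finite_measure_mono)
    show "(\<lambda>x. \<Sum>i<n. x i) -` {x. \<bar>x\<bar> > l} \<inter> space ?P \<subseteq> (\<Union>i<n. ?B i)"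
    proof
      fix x assume x: "x \<in> (\<lambda>x. \<Sum>i<n. x i) -` {x. \<bar>x\<bar> > l} \<inter> space ?P"
      show "x \<in> (\<Union>i<n. ?B i)"
      proof (rule ccontr)
        assume "x \<notin> (\<Union>i<n. ?B i)"
        then have "\<bar>x i\<bar> \<le> l / n" if "i < n" for i using x that by force
        then have "(\<Sum>i<n. \<bar>x i\<bar>) \<le> real (card {..<n}) * (l / n)"
          by (intro sum_bounded_above) auto
        then have "\<bar>\<Sum>i<n. x i\<bar> \<le> l" using order_trans[OF sum_abs[of x "{..<n}"]] n by simp
        then show False using x by simp
      qed
    qed
  qed (use Bm in auto)
  also have "\<dots> \<le> (\<Sum>i<n. measure ?P (?B i))"
    using Bm by (intro P.finite_measure_subadditive_finite) auto
  also have "\<dots> = real n * measure \<nu> {x. \<bar>x\<bar> > l / real n}" by (simp add: Bp)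
  finally show ?thesis .
qed

lemma (in prob_space) char_distr:
  "X \<in> borel_measurable M \<Longrightarrow> char (distr M borel X) \<theta> = (CLINT \<omega>|M. iexp (\<theta> * X \<omega>))"
  by (simp add: char_def integral_distr)

lemma norm_iexp_diff_le: "norm (iexp x - iexp y) \<le> \<bar>x - y\<bar>" "norm (iexp x - iexp y) \<le> 2"
proof -
  have "iexp x - iexp y = iexp y * (iexp (x - y) - 1)"
    by (simp add: algebra_simps exp_add[symmetric])
  then have e: "norm (iexp x - iexp y) = 2 * \<bar>sin ((x - y) / 2)\<bar>"
    by (simp add: norm_mult dist_exp_i_1 del: of_real_diff)
  show "norm (iexp x - iexp y) \<le> \<bar>x - y\<bar>"
    unfolding e using abs_sin_x_le_abs_x[of "(x - y) / 2"] by (simp add: abs_divide)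
  show "norm (iexp x - iexp y) \<le> 2"
    unfolding e using abs_sin_le_one[of "(x - y) / 2"] by linarith
qed

text \<open>The integrands differ by at most \<open>R * \<epsilon>\<close> where \<open>X\<close> and \<open>Y\<close> are \<open>\<epsilon>\<close>-close, and by at most 2 elsewhere.
  Convergence in probability thus gives convergence of characteristic functions uniformly on
  bounded sets.\<close>

lemma (in prob_space) char_diff_bound:
  assumes [measurable]: "X \<in> borel_measurable M" "Y \<in> borel_measurable M"
    and \<theta>: "\<bar>\<theta>\<bar> \<le> R" and \<epsilon>: "0 \<le> \<epsilon>"
  shows "norm (char (distr M borel X) \<theta> - char (distr M borel Y) \<theta>)
         \<le> R * \<epsilon> + 2 * prob {\<omega>\<in>space M. \<bar>X \<omega> - Y \<omega>\<bar> > \<epsilon>}"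
proof -
  let ?E = "{\<omega>\<in>space M. \<bar>X \<omega> - Y \<omega>\<bar> > \<epsilon>}"
  have E: "?E \<in> events" by measurable
  have i: "integrable M (\<lambda>\<omega>. iexp (\<theta> * X \<omega>))" "integrable M (\<lambda>\<omega>. iexp (\<theta> * Y \<omega>))"
    by (auto intro!: integrable_iexp)
  have "char (distr M borel X) \<theta> - char (distr M borel Y) \<theta> = (CLINT \<omega>|M. iexp (\<theta> * X \<omega>) - iexp (\<theta> * Y \<omega>))"
    using i by (simp add: char_distr)
  also have "norm \<dots> \<le> (\<integral>\<omega>. norm (iexp (\<theta> * X \<omega>) - iexp (\<theta> * Y \<omega>)) \<partial>M)"
    by (rule integral_norm_bound)
  also have "\<dots> \<le> (\<integral>\<omega>. R * \<epsilon> + 2 * indicator ?E \<omega> \<partial>M)"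
  proof (rule integral_mono)
    show "integrable M (\<lambda>\<omega>. norm (iexp (\<theta> * X \<omega>) - iexp (\<theta> * Y \<omega>)))" using i by auto
    show "integrable M (\<lambda>\<omega>. R * \<epsilon> + 2 * indicator ?E \<omega>)"
      using E by (intro Bochner_Integration.integrable_add integrable_mult_right integrable_real_indicator) (auto simp: less_top[symmetric])
    fix \<omega> assume w: "\<omega> \<in> space M"
    have R: "0 \<le> R * \<epsilon>" using \<theta> \<epsilon> by (intro mult_nonneg_nonneg) auto
    show "norm (iexp (\<theta> * X \<omega>) - iexp (\<theta> * Y \<omega>)) \<le> R * \<epsilon> + 2 * indicator ?E \<omega>"
    proof (cases "\<omega> \<in> ?E")
      case True
      then show ?thesis using norm_iexp_diff_le(2)[of "\<theta> * X \<omega>" "\<theta> * Y \<omega>"] R by simp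
    next
      case False
      then have "\<bar>X \<omega> - Y \<omega>\<bar> \<le> \<epsilon>" using w by auto
      then have "\<bar>\<theta> * X \<omega> - \<theta> * Y \<omega>\<bar> \<le> R * \<epsilon>"
        unfolding right_diff_distrib[symmetric] abs_mult using \<theta> by (intro mult_mono) auto
      then show ?thesis using norm_iexp_diff_le(1)[of "\<theta> * X \<omega>" "\<theta> * Y \<omega>"] False by simp
    qed
  qed
  also have "\<dots> = R * \<epsilon> + 2 * prob ?E"
    using E by (subst Bochner_Integration.integral_add) (auto simp: prob_space less_top[symmetric])
  finally show ?thesis .
qed

lemma char_const_zero: "prob_space M \<Longrightarrow> char (distr M borel (\<lambda>_. 0)) \<theta> = 1"
  by (simp add: prob_space.char_distr prob_space.prob_space)

section \<open>The exponent of a Levy process\<close>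

text \<open>Within distance 1 of 1 the principal logarithm is continuous, and along the path it agrees with
  the logarithm that starts at 0.\<close>

lemma log_of_path_near_one:
  fixes f :: "real \<Rightarrow> complex"
  assumes f: "continuous_on {0..1} f" and 0: "f 0 = 0"
    and near: "\<And>r. r \<in> {0..1} \<Longrightarrow> norm (exp (f r) - 1) < 1"
  shows "f 1 = Ln (exp (f 1))"
proof (rule continuous_log_unique[OF f, where g="\<lambda>r. Ln (exp (f r))"])
  have pos: "exp (f r) \<notin> \<real>\<^sub>\<le>\<^sub>0" if "r \<in> {0..1}" for r
  proof -
    have "\<bar>Re (exp (f r) - 1)\<bar> < 1" using near[OF that] abs_Re_le_cmod le_less_trans by blast
    then have "Re (exp (f r)) > 0" by simp
    then show ?thesis by (auto simp: complex_nonpos_Reals_iff)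
  qed
  show "continuous_on {0..1} (\<lambda>r. Ln (exp (f r)))"
    using pos by (intro continuous_on_Ln' continuous_intros f) auto
qed (auto simp: 0)

text \<open>The mean of \<open>\<phi>\<close> over a short interval is nonzero, and \<open>\<phi> t\<close> times it is the mean over the translated
  interval; hence \<open>\<phi>\<close> is differentiable and solves a linear differential equation.\<close>

lemma multiplicative_imp_exp:
  fixes \<phi> :: "real \<Rightarrow> complex"
  assumes cont: "continuous_on {0..} \<phi>" and 0: "\<phi> 0 = 1"
    and mult: "\<And>s t. 0 \<le> s \<Longrightarrow> 0 \<le> t \<Longrightarrow> \<phi> (s + t) = \<phi> s * \<phi> t"
  shows "\<exists>z. \<forall>t\<ge>0. \<phi> t = exp (of_real t * z)"
proof -
  have "(\<phi> \<longlongrightarrow> 1) (at 0 within {0..})"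
    using cont 0 unfolding continuous_on_def by force
  then have "eventually (\<lambda>u. dist (\<phi> u) 1 < 1/2) (at 0 within {0..})"
    by (rule tendstoD) simp
  then obtain d where d: "d > 0" "\<And>u. u \<in> {0..} \<Longrightarrow> u \<noteq> 0 \<Longrightarrow> dist u 0 < d \<Longrightarrow> dist (\<phi> u) 1 < 1/2"
    unfolding eventually_at by auto
  define h where "h = d / 2"
  have h: "h > 0" using d by (simp add: h_def)
  have near: "norm (\<phi> u - 1) \<le> 1/2" if "u \<in> {0..h}" for u
    using d(2)[of u] that h 0 by (cases "u = 0") (auto simp: dist_norm h_def less_imp_le)
  have ci: "continuous_on {a..b} \<phi>" if "0 \<le> a" for a b
    using that by (intro continuous_on_subset[OF cont]) auto
  have int: "\<phi> integrable_on {a..b}" if "0 \<le> a" for a b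
    using ci[OF that] by (rule integrable_continuous_real)
  define c where "c = integral {0..h} \<phi>"
  have "norm (integral {0..h} (\<lambda>u. \<phi> u - 1)) \<le> 1/2 * (h - 0)"
    using h near by (intro integral_bound continuous_intros ci) auto
  moreover have "integral {0..h} (\<lambda>u. \<phi> u - 1) = c - of_real h"
    unfolding c_def using int h by (subst integral_diff) (auto simp: scaleR_conv_of_real)
  ultimately have cn: "norm (c - of_real h) \<le> h / 2" by simp
  have c0: "c \<noteq> 0" using cn h by auto
  define z where "z = (\<phi> h - 1) / c"
  have "\<phi> T = exp (of_real T * z)" if T: "T \<ge> 0" for T
  proof -
    define \<Phi> where "\<Phi> t = integral {0..t} \<phi>" for t
    have d\<Phi>: "(\<Phi> has_vector_derivative \<phi> t) (at t within {0..T + h})" if "t \<in> {0..T + h}" for t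
      unfolding \<Phi>_def using that by (intro integral_has_vector_derivative ci) auto
    have shift: "\<phi> t * c = \<Phi> (t + h) - \<Phi> t" if "0 \<le> t" for t
    proof -
      have "\<phi> t * c = integral {0..h} (\<lambda>u. \<phi> t * \<phi> u)"
        unfolding c_def by simp
      also have "\<dots> = integral {0..h} (\<lambda>u. \<phi> (u + t))"
        using that by (intro integral_cong) (auto simp: mult add.commute)
      also have "\<dots> = integral {t..t + h} \<phi>"
        using integral_shift_Icc_real[of 0 h \<phi> t] by (simp add: o_def add.commute)
      also have "\<dots> = \<Phi> (t + h) - \<Phi> t"
        unfolding \<Phi>_def using that h Henstock_Kurzweil_Integration.integral_combine[of 0 t "t + h" \<phi>] int
        by (simp add: algebra_simps)
      finally show ?thesis .
    qed
    have "\<exists>k. \<forall>t\<in>{0..T}. \<phi> t * exp (- of_real t * z) = k"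
    proof (rule has_derivative_zero_constant)
      fix t assume t: "t \<in> {0..T}"
      have 1: "((\<lambda>t. \<Phi> (t + h)) has_vector_derivative \<phi> (t + h)) (at t within {0..T})"
      proof -
        have a: "((\<lambda>t. t + h) has_vector_derivative 1) (at t within {0..T})"
          by (auto intro!: derivative_eq_intros)
        have b: "(\<Phi> has_vector_derivative \<phi> (t + h)) (at (t + h) within (\<lambda>t. t + h) ` {0..T})"
          using t h by (intro has_vector_derivative_within_subset[OF d\<Phi>]) auto
        show ?thesis using vector_diff_chain_within[OF a b] by (simp add: o_def)
      qed
      have 2: "(\<Phi> has_vector_derivative \<phi> t) (at t within {0..T})"
        using t h by (intro has_vector_derivative_within_subset[OF d\<Phi>]) auto
      have "((\<lambda>t. (\<Phi> (t + h) - \<Phi> t) / c) has_vector_derivative (\<phi> (t + h) - \<phi> t) / c) (at t within {0..T})"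
        by (intro has_vector_derivative_divide has_vector_derivative_diff 1 2)
      moreover have "(\<Phi> (s + h) - \<Phi> s) / c = \<phi> s" if "s \<in> {0..T}" for s
        using shift[of s] that c0 by (simp add: field_simps)
      ultimately have "(\<phi> has_vector_derivative (\<phi> (t + h) - \<phi> t) / c) (at t within {0..T})"
        using t by (elim has_vector_derivative_transform[rotated 2]) auto
      moreover have "(\<phi> (t + h) - \<phi> t) / c = \<phi> t * z"
        using t h by (simp add: z_def mult algebra_simps diff_divide_distrib)
      ultimately have 3: "(\<phi> has_vector_derivative \<phi> t * z) (at t within {0..T})" by simp
      have 4: "((\<lambda>t. exp (- of_real t * z)) has_vector_derivative (- z) * exp (- of_real t * z)) (at t within {0..T})"
        using exp_scaleR_has_vector_derivative_right[of "-z" t "{0..T}"]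
        by (simp add: scaleR_conv_of_real mult.commute)
      have "((\<lambda>t. \<phi> t * exp (- of_real t * z)) has_vector_derivative 0) (at t within {0..T})"
        using has_vector_derivative_mult[OF 3 4] by (simp add: algebra_simps)
      then show "((\<lambda>t. \<phi> t * exp (- of_real t * z)) has_derivative (\<lambda>_. 0)) (at t within {0..T})"
        by (simp add: has_vector_derivative_def)
    qed auto
    then have "\<phi> T * exp (- of_real T * z) = 1" using T 0 by force
    then show ?thesis by (simp add: exp_minus field_simps)
  qed
  then show ?thesis by blast
qed

text \<open>For fixed \<open>\<theta>\<close> the characteristic function at time \<open>t\<close> is multiplicative in \<open>t\<close>, hence exponential.
  For bounded \<open>\<theta>\<close> and a small time \<open>h\<close> it is near 1, so the exponent is there a multiple of a principal
  logarithm and therefore continuous.\<close>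

lemma (in prob_space) levy_process_exponent:
  assumes X: "levy_process M X"
  shows "\<exists>\<psi>. continuous_on UNIV \<psi> \<and> \<psi> 0 = 0 \<and>
    (\<forall>t\<ge>0. \<forall>\<theta>. char (distr M borel (X t)) \<theta> = exp (of_real t * \<psi> \<theta>))"
proof -
  have add: "additive_process M X"
    and stat: "\<And>s h. 0 \<le> s \<Longrightarrow> 0 \<le> h \<Longrightarrow> distr M borel (\<lambda>\<omega>. X (s + h) \<omega> - X s \<omega>) = distr M borel (X h)"
    using X unfolding levy_process_def by auto
  have rv [measurable]: "X t \<in> borel_measurable M" if "0 \<le> t" for t
    using add that unfolding additive_process_def by auto
  have X0: "AE \<omega> in M. X 0 \<omega> = 0" using add unfolding additive_process_def by auto
  have sc: "stochastically_continuous M X" using add unfolding additive_process_def by auto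
  define \<phi> where "\<phi> t \<theta> = char (distr M borel (X t)) \<theta>" for t \<theta>
  have \<phi>0: "\<phi> 0 \<theta> = 1" for \<theta>
  proof -
    have "distr M borel (X 0) = distr M borel (\<lambda>_. 0)"
      using X0 by (intro distr_cong_AE) auto
    then show ?thesis unfolding \<phi>_def using char_const_zero[OF prob_space_axioms] by simp
  qed
  have mult: "\<phi> (s + t) \<theta> = \<phi> s \<theta> * \<phi> t \<theta>" if "0 \<le> s" "0 \<le> t" for s t \<theta>
  proof (cases "t = 0")
    case True then show ?thesis using \<phi>0 by simp
  next
    case False
    define u where "u i = (if i = (0::nat) then s else s + t)" for i
    have "indep_vars (\<lambda>_. borel) (\<lambda>i \<omega>. if i = 0 then X (u 0) \<omega> else X (u i) \<omega> - X (u (i - 1)) \<omega>) {..1::nat}"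
      using add that False unfolding additive_process_def by (auto simp: u_def)
    then have iv: "indep_vars (\<lambda>_. borel) (\<lambda>i \<omega>. if i = 0 then X s \<omega> else X (s + t) \<omega> - X s \<omega>) {..1::nat}"
      by (rule indep_vars_cong[THEN iffD1, rotated 3]) (auto simp: u_def fun_eq_iff le_Suc_eq)
    have "char (distr M borel (\<lambda>\<omega>. \<Sum>i\<in>{..1::nat}. if i = 0 then X s \<omega> else X (s + t) \<omega> - X s \<omega>)) \<theta>
       = (\<Prod>i\<in>{..1::nat}. char (distr M borel (\<lambda>\<omega>. if i = 0 then X s \<omega> else X (s + t) \<omega> - X s \<omega>)) \<theta>)"
      by (rule char_distr_sum[OF iv])
    then show ?thesis
      by (simp add: \<phi>_def stat[OF that, unfolded add.commute[of s t]] stat[OF that] atMost_Suc)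
  qed
  have small: "\<exists>d>0. \<forall>t\<ge>0. \<bar>t - t0\<bar> < d \<longrightarrow> (\<forall>\<theta>. \<bar>\<theta>\<bar> \<le> R \<longrightarrow> norm (\<phi> t \<theta> - \<phi> t0 \<theta>) < e)"
    if "e > 0" "R > 0" "t0 \<ge> 0" for e R t0
  proof -
    define \<epsilon> where "\<epsilon> = e / (2 * R)"
    have \<epsilon>: "\<epsilon> > 0" using that by (simp add: \<epsilon>_def)
    have "((\<lambda>s. prob {\<omega>\<in>space M. \<bar>X s \<omega> - X t0 \<omega>\<bar> > \<epsilon>}) \<longlongrightarrow> 0) (at t0 within {0..})"
      using sc that \<epsilon> unfolding stochastically_continuous_def by blast
    then have "eventually (\<lambda>s. dist (prob {\<omega>\<in>space M. \<bar>X s \<omega> - X t0 \<omega>\<bar> > \<epsilon>}) 0 < e/4) (at t0 within {0..})"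
      using that by (intro tendstoD) auto
    then obtain d where d: "d > 0"
      "\<And>s. s \<in> {0..} \<Longrightarrow> s \<noteq> t0 \<Longrightarrow> dist s t0 < d \<Longrightarrow> prob {\<omega>\<in>space M. \<bar>X s \<omega> - X t0 \<omega>\<bar> > \<epsilon>} < e/4"
      unfolding eventually_at by auto
    have "norm (\<phi> t \<theta> - \<phi> t0 \<theta>) < e" if t: "t \<ge> 0" "\<bar>t - t0\<bar> < d" "\<bar>\<theta>\<bar> \<le> R" for t \<theta>
    proof (cases "t = t0")
      case False
      have "norm (\<phi> t \<theta> - \<phi> t0 \<theta>) \<le> R * \<epsilon> + 2 * prob {\<omega>\<in>space M. \<bar>X t \<omega> - X t0 \<omega>\<bar> > \<epsilon>}"
        unfolding \<phi>_def using t \<epsilon> \<open>t0 \<ge> 0\<close> by (intro char_diff_bound rv) auto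
      also have "\<dots> < R * \<epsilon> + 2 * (e / 4)" using d(2)[of t] t False by (auto simp: dist_real_def)
      also have "\<dots> = e" using \<open>R > 0\<close> by (simp add: \<epsilon>_def)
      finally show ?thesis .
    qed (use \<open>e > 0\<close> in auto)
    then show ?thesis using d(1) by blast
  qed
  have cont: "continuous_on {0..} (\<lambda>t. \<phi> t \<theta>)" for \<theta>
    unfolding continuous_on_iff
  proof (intro ballI allI impI)
    fix t0 :: real and e :: real assume "t0 \<in> {0..}" "e > 0"
    then obtain d where d: "d > 0" "\<forall>t\<ge>0. \<bar>t - t0\<bar> < d \<longrightarrow> (\<forall>\<theta>'. \<bar>\<theta>'\<bar> \<le> \<bar>\<theta>\<bar> + 1 \<longrightarrow> norm (\<phi> t \<theta>' - \<phi> t0 \<theta>') < e)"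
      using small[of e "\<bar>\<theta>\<bar> + 1" t0] by (metis abs_ge_zero add_nonneg_pos atLeast_iff zero_less_one)
    show "\<exists>d>0. \<forall>x'\<in>{0..}. dist x' t0 < d \<longrightarrow> dist (\<phi> x' \<theta>) (\<phi> t0 \<theta>) < e"
      using d by (intro exI[of _ d]) (auto simp: dist_real_def dist_norm)
  qed
  have "\<exists>z. \<forall>t\<ge>0. \<phi> t \<theta> = exp (of_real t * z)" for \<theta>
    by (rule multiplicative_imp_exp[OF cont \<phi>0 mult])
  then obtain \<psi>' where \<psi>': "\<And>\<theta> t. 0 \<le> t \<Longrightarrow> \<phi> t \<theta> = exp (of_real t * \<psi>' \<theta>)" by metis
  have loc: "\<exists>h>0. \<forall>\<theta>. \<bar>\<theta>\<bar> \<le> R \<longrightarrow> \<psi>' \<theta> = Ln (\<phi> h \<theta>) / of_real h \<and> \<phi> h \<theta> \<notin> \<real>\<^sub>\<le>\<^sub>0" if "R > 0" for R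
  proof -
    obtain d where d: "d > 0" "\<forall>t\<ge>0. \<bar>t - 0\<bar> < d \<longrightarrow> (\<forall>\<theta>. \<bar>\<theta>\<bar> \<le> R \<longrightarrow> norm (\<phi> t \<theta> - \<phi> 0 \<theta>) < 1)"
      using small[OF zero_less_one \<open>R > 0\<close> order_refl] by blast
    define h where "h = d / 2"
    have h: "h > 0" using d by (simp add: h_def)
    have "\<psi>' \<theta> = Ln (\<phi> h \<theta>) / of_real h \<and> \<phi> h \<theta> \<notin> \<real>\<^sub>\<le>\<^sub>0" if \<theta>: "\<bar>\<theta>\<bar> \<le> R" for \<theta>
    proof
      have "norm (exp (of_real (r * h) * \<psi>' \<theta>) - 1) < 1" if "r \<in> {0..1}" for r
      proof -
        have "r * h \<le> 1 * h" using that h by (intro mult_right_mono) auto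
        then have "r * h < d" using h by (simp add: h_def)
        then show ?thesis using d(2)[rule_format, of "r * h" \<theta>] \<psi>'[of "r * h" \<theta>] that h \<theta> \<phi>0 by simp
      qed
      then have "of_real (1 * h) * \<psi>' \<theta> = Ln (exp (of_real (1 * h) * \<psi>' \<theta>))"
        by (intro log_of_path_near_one[where f="\<lambda>r. of_real (r * h) * \<psi>' \<theta>"] continuous_intros) auto
      then show "\<psi>' \<theta> = Ln (\<phi> h \<theta>) / of_real h" using \<psi>'[of h \<theta>] h by (simp add: field_simps)
      have "norm (\<phi> h \<theta> - 1) < 1" using d h \<theta> \<phi>0 by (simp add: h_def)
      then have "\<bar>Re (\<phi> h \<theta> - 1)\<bar> < 1" using abs_Re_le_cmod le_less_trans by blast
      then have "Re (\<phi> h \<theta>) > 0" by simp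
      then show "\<phi> h \<theta> \<notin> \<real>\<^sub>\<le>\<^sub>0" by (auto simp: complex_nonpos_Reals_iff)
    qed
    then show ?thesis using h by blast
  qed
  have "continuous_on UNIV \<psi>'"
  proof (rule continuous_at_imp_continuous_on, rule ballI)
    fix \<theta>0 :: real
    obtain h where h: "h > 0" "\<And>\<theta>. \<bar>\<theta>\<bar> \<le> \<bar>\<theta>0\<bar> + 1 \<Longrightarrow> \<psi>' \<theta> = Ln (\<phi> h \<theta>) / of_real h \<and> \<phi> h \<theta> \<notin> \<real>\<^sub>\<le>\<^sub>0"
      using loc[OF add_nonneg_pos[OF abs_ge_zero[of \<theta>0] zero_less_one]] by blast
    interpret H: real_distribution "distr M borel (X h)" using h by (intro real_distribution_law rv) auto
    have "isCont (\<lambda>\<theta>. Ln (\<phi> h \<theta>) / of_real h) \<theta>0"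
      unfolding \<phi>_def using h(2)[of \<theta>0] H.isCont_char h(1)
      by (intro continuous_intros isCont_Ln') (auto simp: \<phi>_def)
    moreover have "eventually (\<lambda>\<theta>. \<bar>\<theta>\<bar> \<le> \<bar>\<theta>0\<bar> + 1) (nhds \<theta>0)"
      unfolding eventually_nhds_metric dist_real_def by (intro exI[of _ 1]) auto
    then have "eventually (\<lambda>\<theta>. \<psi>' \<theta> = Ln (\<phi> h \<theta>) / of_real h) (nhds \<theta>0)"
      by eventually_elim (use h(2) in auto)
    then have "isCont \<psi>' \<theta>0 \<longleftrightarrow> isCont (\<lambda>\<theta>. Ln (\<phi> h \<theta>) / of_real h) \<theta>0"
      by (rule isCont_cong)
    ultimately show "isCont \<psi>' \<theta>0" by simp
  qed
  moreover have "\<psi>' 0 = 0"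
  proof -
    obtain h where h: "h > 0" "\<psi>' 0 = Ln (\<phi> h 0) / of_real h" using loc[of 1] by auto
    interpret H: real_distribution "distr M borel (X h)" using h by (intro real_distribution_law rv) auto
    show ?thesis using h H.char_zero by (simp add: \<phi>_def)
  qed
  ultimately show ?thesis using \<psi>' unfolding \<phi>_def by blast
qed

section \<open>Two-sided Levy processes\<close>

text \<open>The two-sided process seen through its increments over the whole line: every path is regular, and a
  fixed time is almost surely no jump time.\<close>

locale bilateral_levy = prob_space M for M :: "'w measure" +
  fixes L :: "real \<Rightarrow> 'w \<Rightarrow> real" and \<psi> :: "real \<Rightarrow> complex"
  assumes L_meas [measurable]: "\<And>t. L t \<in> borel_measurable M"
    and L_rcll: "\<And>\<omega>. \<omega> \<in> space M \<Longrightarrow> rcll (\<lambda>t. L t \<omega>)"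
    and L_indep: "\<And>n s. (\<forall>i<n. s i < s (Suc i)) \<Longrightarrow>
      indep_vars (\<lambda>_. borel) (\<lambda>i \<omega>. L (s (Suc i)) \<omega> - L (s i) \<omega>) {..<n::nat}"
    and L_char: "\<And>s t \<theta>. s \<le> t \<Longrightarrow>
      char (distr M borel (\<lambda>\<omega>. L t \<omega> - L s \<omega>)) \<theta> = exp (of_real (t - s) * \<psi> \<theta>)"
    and \<psi>_cont: "continuous_on UNIV \<psi>" and \<psi>_0: "\<psi> 0 = 0"
    and L_cont: "\<And>t. AE \<omega> in M. isCont (\<lambda>s. L s \<omega>) t"

text \<open>Passing to left limits preserves the one-sided limits of a function. The reflected half of a
  two-sided process is built from left limits, and these two lemmas transfer the regularity of the
  original half to it.\<close>

lemma tendsto_left_limit_at_left: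
  fixes f g :: "real \<Rightarrow> real"
  assumes g: "\<And>u. u > 0 \<Longrightarrow> (f \<longlongrightarrow> g u) (at_left u)" and u: "u > 0"
  shows "(g \<longlongrightarrow> g u) (at_left u)"
proof (rule tendstoI)
  fix e :: real assume "e > 0"
  then have "eventually (\<lambda>s. dist (f s) (g u) < e/2) (at_left u)" using g[OF u] by (intro tendstoD) auto
  then obtain b where b: "b < u" "\<And>s. b < s \<Longrightarrow> s < u \<Longrightarrow> dist (f s) (g u) < e/2"
    unfolding eventually_at_left_field by auto
  have "dist (g v) (g u) < e" if v: "max b 0 < v" "v < u" for v
  proof -
    have "((\<lambda>s. dist (f s) (g u)) \<longlongrightarrow> dist (g v) (g u)) (at_left v)"
      using v by (intro tendsto_intros g) auto
    moreover have "eventually (\<lambda>s. dist (f s) (g u) \<le> e/2) (at_left v)"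
      unfolding eventually_at_left_field using v b by (intro exI[of _ b]) (auto intro!: less_imp_le)
    ultimately have "dist (g v) (g u) \<le> e/2" by (rule tendsto_upperbound) auto
    then show ?thesis using \<open>e > 0\<close> by simp
  qed
  then show "eventually (\<lambda>v. dist (g v) (g u) < e) (at_left u)"
    unfolding eventually_at_left_field using u b by (intro exI[of _ "max b 0"]) auto
qed

lemma tendsto_left_limit_at_right:
  fixes f g :: "real \<Rightarrow> real"
  assumes g: "\<And>u. u > 0 \<Longrightarrow> (f \<longlongrightarrow> g u) (at_left u)" and u: "u \<ge> 0"
    and f: "(f \<longlongrightarrow> f u) (at_right u)"
  shows "(g \<longlongrightarrow> f u) (at_right u)"
proof (rule tendstoI)
  fix e :: real assume "e > 0"
  then have "eventually (\<lambda>s. dist (f s) (f u) < e/2) (at_right u)" using f by (intro tendstoD) auto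
  then obtain b where b: "b > u" "\<And>s. u < s \<Longrightarrow> s < b \<Longrightarrow> dist (f s) (f u) < e/2"
    unfolding eventually_at_right_field by auto
  have "dist (g v) (f u) < e" if v: "u < v" "v < b" for v
  proof -
    have "((\<lambda>s. dist (f s) (f u)) \<longlongrightarrow> dist (g v) (f u)) (at_left v)"
      using v u by (intro tendsto_intros g) auto
    moreover have "eventually (\<lambda>s. dist (f s) (f u) \<le> e/2) (at_left v)"
      unfolding eventually_at_left_field using v b by (intro exI[of _ u]) (auto intro!: less_imp_le)
    ultimately have "dist (g v) (f u) \<le> e/2" by (rule tendsto_upperbound) auto
    then show ?thesis using \<open>e > 0\<close> by simp
  qed
  then show "eventually (\<lambda>v. dist (g v) (f u) < e) (at_right u)"
    unfolding eventually_at_right_field using b by (intro exI[of _ b]) auto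
qed

lemma filterlim_uminus_at_right: "filterlim uminus (at_left (- t)) (at_right (t::real))"
  by (simp add: filterlim_def at_left_minus)

lemma filterlim_uminus_at_left: "filterlim uminus (at_right (- t)) (at_left (t::real))"
  by (simp add: filterlim_def at_right_minus)

text \<open>Reflection exchanges left and right, so the left-continuous function of left limits of \<open>f2\<close> becomes
  right-continuous.\<close>

lemma rcll_two_sided_path:
  fixes f1 f2 :: "real \<Rightarrow> real"
  assumes f1: "cadlag f1" "f1 0 = 0" and f2: "cadlag f2" "f2 0 = 0"
  defines "y \<equiv> \<lambda>t. if 0 \<le> t then f1 t else - Lim (at_left (- t)) f2"
  shows "rcll y"
    and "(t > 0 \<Longrightarrow> (f1 \<longlongrightarrow> f1 t) (at_left t)) \<Longrightarrow> (t < 0 \<Longrightarrow> (f2 \<longlongrightarrow> f2 (- t)) (at_left (- t)))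
      \<Longrightarrow> isCont y t"
proof -
  define g where "g u = Lim (at_left u) f2" for u
  have g: "(f2 \<longlongrightarrow> g u) (at_left u)" if u: "u > 0" for u
  proof -
    obtain l where l: "(f2 \<longlongrightarrow> l) (at_left u)" using f2 u unfolding cadlag_def by blast
    then have "g u = l" unfolding g_def by (intro tendsto_Lim) auto
    then show ?thesis using l by simp
  qed
  have r1: "(f1 \<longlongrightarrow> f1 t) (at_right t)" if "t \<ge> 0" for t
    using f1 that unfolding cadlag_def continuous_within by blast
  have r2: "(f2 \<longlongrightarrow> f2 t) (at_right t)" if "t \<ge> 0" for t
    using f2 that unfolding cadlag_def continuous_within by blast
  have right: "(y \<longlongrightarrow> y t) (at_right t)" for t
  proof (cases "t \<ge> 0")
    case True
    then have "eventually (\<lambda>s. f1 s = y s) (at_right t)"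
      unfolding eventually_at_right_field y_def by (intro exI[of _ "t + 1"]) auto
    then show ?thesis using Lim_transform_eventually[OF r1[OF True]] True by (simp add: y_def)
  next
    case False
    have "((\<lambda>s. - g (- s)) \<longlongrightarrow> - g (- t)) (at_right t)"
      using False by (intro tendsto_minus filterlim_compose[OF tendsto_left_limit_at_left[OF g] filterlim_uminus_at_right]) auto
    moreover have "eventually (\<lambda>s. - g (- s) = y s) (at_right t)"
      unfolding eventually_at_right_field y_def g_def using False by (intro exI[of _ 0]) auto
    ultimately show ?thesis using Lim_transform_eventually False by (force simp: y_def g_def)
  qed
  have leftneg: "(y \<longlongrightarrow> - f2 (- t)) (at_left t)" if "t \<le> 0" for t
  proof -
    have "((\<lambda>s. - g (- s)) \<longlongrightarrow> - f2 (- t)) (at_left t)"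
      using that by (intro tendsto_minus filterlim_compose[OF tendsto_left_limit_at_right[OF g] filterlim_uminus_at_left] r2) auto
    moreover have "eventually (\<lambda>s. - g (- s) = y s) (at_left t)"
      unfolding eventually_at_left_field y_def g_def using that by (intro exI[of _ "t - 1"]) auto
    ultimately show ?thesis using Lim_transform_eventually by force
  qed
  have leftpos: "(y \<longlongrightarrow> l) (at_left t)" if "t > 0" "(f1 \<longlongrightarrow> l) (at_left t)" for t l
  proof -
    have "eventually (\<lambda>s. f1 s = y s) (at_left t)"
      unfolding eventually_at_left_field y_def using that by (intro exI[of _ 0]) auto
    then show ?thesis using Lim_transform_eventually[OF that(2)] by blast
  qed
  have left: "\<exists>l. (y \<longlongrightarrow> l) (at_left t)" for t
    using leftneg[of t] leftpos[of t] f1 unfolding cadlag_def by (metis not_less)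
  show "rcll y" unfolding rcll_def continuous_within using right left by blast
  show "isCont y t" if "t > 0 \<Longrightarrow> (f1 \<longlongrightarrow> f1 t) (at_left t)" "t < 0 \<Longrightarrow> (f2 \<longlongrightarrow> f2 (- t)) (at_left (- t))"
  proof -
    have "(y \<longlongrightarrow> y t) (at_left t)"
    proof -
      consider "t > 0" | "t = 0" | "t < 0" by linarith
      then show ?thesis
      proof cases
        case 1
        then show ?thesis using leftpos[OF 1 that(1)[OF 1]] by (simp add: y_def)
      next
        case 2
        then show ?thesis using leftneg[of 0] f1 f2 by (simp add: y_def)
      next
        case 3
        have "g (- t) = f2 (- t)"
          by (rule tendsto_unique[OF _ g that(2)]) (use 3 in auto)
        then show ?thesis using leftneg[of t] 3 by (simp add: y_def g_def)
      qed
    qed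
    then show ?thesis unfolding isCont_def using right filterlim_split_at by blast
  qed
qed

text \<open>Left limits exist along almost every path; by stochastic continuity they agree with the
  value in probability.\<close>

lemma (in prob_space) additive_process_no_fixed_jump:
  assumes X: "additive_process M X" and t: "t > 0"
  shows "AE \<omega> in M. ((\<lambda>s. X s \<omega>) \<longlongrightarrow> X t \<omega>) (at_left t)"
proof -
  have rv [measurable]: "X s \<in> borel_measurable M" if "0 \<le> s" for s
    using X that unfolding additive_process_def by auto
  have cad: "AE \<omega> in M. cadlag (\<lambda>t. X t \<omega>)" using X unfolding additive_process_def by auto
  then obtain N where N: "{\<omega>\<in>space M. \<not> cadlag (\<lambda>t. X t \<omega>)} \<subseteq> N" "N \<in> null_sets M"
    by (auto simp: eventually_ae_filter)
  have Nm [measurable]: "N \<in> events" using N by auto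
  define s where "s n = t - t / (real n + 2)" for n
  have s: "0 \<le> s n" "s n < t" for n using t by (auto simp: s_def field_simps)
  have slim: "filterlim s (at_left t) sequentially"
  proof -
    have "s \<longlonglongrightarrow> t" unfolding s_def by real_asymp
    then show ?thesis
      using s by (auto simp: filterlim_at intro!: always_eventually order.strict_implies_not_eq)
  qed
  define l where "l \<omega> = (if \<omega> \<in> N then 0 else Lim (at_left t) (\<lambda>s. X s \<omega>))" for \<omega>
  have l: "((\<lambda>s. X s \<omega>) \<longlongrightarrow> l \<omega>) (at_left t)" if "\<omega> \<in> space M" "\<omega> \<notin> N" for \<omega>
  proof -
    have "cadlag (\<lambda>t. X t \<omega>)" using that N by blast
    then obtain k where k: "((\<lambda>s. X s \<omega>) \<longlongrightarrow> k) (at_left t)"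
      using t unfolding cadlag_def by blast
    then have "l \<omega> = k" unfolding l_def using that(2) by (simp add: tendsto_Lim)
    then show ?thesis using k by simp
  qed
  have [measurable]: "l \<in> borel_measurable M"
  proof (rule borel_measurable_LIMSEQ_real)
    show "(\<lambda>n. if \<omega> \<in> N then 0 else X (s n) \<omega>) \<longlonglongrightarrow> l \<omega>" if "\<omega> \<in> space M" for \<omega>
      using filterlim_compose[OF l slim] that by (cases "\<omega> \<in> N") (auto simp: l_def)
    have [measurable]: "X (s n) \<in> borel_measurable M" for n using s by (intro rv)
    show "(\<lambda>\<omega>. if \<omega> \<in> N then 0 else X (s n) \<omega>) \<in> borel_measurable M" for n
      by measurable
  qed
  have [measurable]: "X t \<in> borel_measurable M" "X (s n) \<in> borel_measurable M" for n using t s by (auto intro!: rv)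
  have AEN: "AE \<omega> in M. \<omega> \<notin> N" using N(2) by (rule AE_not_in)
  have lim1: "(\<lambda>n. \<integral>\<omega>. min 1 \<bar>X (s n) \<omega> - X t \<omega>\<bar> \<partial>M) \<longlonglongrightarrow> (\<integral>\<omega>. min 1 \<bar>l \<omega> - X t \<omega>\<bar> \<partial>M)"
  proof (rule integral_dominated_convergence[where w="\<lambda>_. 1"])
    show "AE \<omega> in M. (\<lambda>n. min 1 \<bar>X (s n) \<omega> - X t \<omega>\<bar>) \<longlonglongrightarrow> min 1 \<bar>l \<omega> - X t \<omega>\<bar>"
      using AEN AE_space
    proof eventually_elim
      case (elim \<omega>)
      then show ?case by (intro tendsto_intros filterlim_compose[OF l slim]) auto
    qed
  qed auto
  have lim0: "(\<lambda>n. \<integral>\<omega>. min 1 \<bar>X (s n) \<omega> - X t \<omega>\<bar> \<partial>M) \<longlonglongrightarrow> 0"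
  proof (rule LIMSEQ_I)
    fix e :: real assume e: "e > 0"
    have "stochastically_continuous M X" using X unfolding additive_process_def by auto
    then have "((\<lambda>s. prob {\<omega>\<in>space M. \<bar>X s \<omega> - X t \<omega>\<bar> > e/2}) \<longlongrightarrow> 0) (at t within {0..})"
      using t half_gt_zero[OF e] less_imp_le[OF t] unfolding stochastically_continuous_def by blast
    moreover have "filterlim s (at t within {0..}) sequentially"
      using slim s by (auto simp: filterlim_at elim: eventually_mono)
    ultimately have "(\<lambda>n. prob {\<omega>\<in>space M. \<bar>X (s n) \<omega> - X t \<omega>\<bar> > e/2}) \<longlonglongrightarrow> 0"
      by (rule filterlim_compose)
    then obtain n0 where n0: "\<And>n. n \<ge> n0 \<Longrightarrow> prob {\<omega>\<in>space M. \<bar>X (s n) \<omega> - X t \<omega>\<bar> > e/2} < e/2"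
      using LIMSEQ_D[of _ 0 "e/2"] e by fastforce
    have "norm ((\<integral>\<omega>. min 1 \<bar>X (s n) \<omega> - X t \<omega>\<bar> \<partial>M) - 0) < e" if "n \<ge> n0" for n
    proof -
      have "(\<integral>\<omega>. min 1 \<bar>X (s n) \<omega> - X t \<omega>\<bar> \<partial>M) \<le>
          (\<integral>\<omega>. e/2 + indicator {\<omega>\<in>space M. \<bar>X (s n) \<omega> - X t \<omega>\<bar> > e/2} \<omega> \<partial>M)"
      proof (rule integral_mono)
        show "integrable M (\<lambda>\<omega>. min 1 \<bar>X (s n) \<omega> - X t \<omega>\<bar>)"
          by (rule integrable_const_bound[where B=1]) auto
        show "integrable M (\<lambda>\<omega>. e/2 + indicator {\<omega>\<in>space M. \<bar>X (s n) \<omega> - X t \<omega>\<bar> > e/2} \<omega>)"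
          by (intro Bochner_Integration.integrable_add integrable_real_indicator) (auto simp: less_top[symmetric])
      qed (use e in \<open>auto simp: indicator_def min_def\<close>)
      also have "\<dots> = e/2 + prob {\<omega>\<in>space M. \<bar>X (s n) \<omega> - X t \<omega>\<bar> > e/2}"
        by (subst Bochner_Integration.integral_add) (auto simp: prob_space less_top[symmetric])
      also have "\<dots> < e" using n0[OF that] by simp
      finally show ?thesis by (simp add: abs_of_nonneg)
    qed
    then show "\<exists>n0. \<forall>n\<ge>n0. norm ((\<integral>\<omega>. min 1 \<bar>X (s n) \<omega> - X t \<omega>\<bar> \<partial>M) - 0) < e" by blast
  qed
  have "(\<integral>\<omega>. min 1 \<bar>l \<omega> - X t \<omega>\<bar> \<partial>M) = 0" using LIMSEQ_unique[OF lim1 lim0] .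
  then have "AE \<omega> in M. min 1 \<bar>l \<omega> - X t \<omega>\<bar> = 0"
    by (subst (asm) integral_nonneg_eq_0_iff_AE) (auto intro!: integrable_const_bound[where B=1])
  then show ?thesis using AEN AE_space
  proof eventually_elim
    case (elim \<omega>)
    then have "l \<omega> = X t \<omega>" by (auto simp: min_def split: if_splits)
    then show ?case using l[of \<omega>] elim by simp
  qed
qed

lemma (in prob_space) indep_vars_reindex:
  assumes "indep_vars (\<lambda>_. borel) (X :: 'i \<Rightarrow> 'a \<Rightarrow> real) I" and f: "inj_on f J" "f ` J \<subseteq> I"
  shows "indep_vars (\<lambda>_. borel) (\<lambda>j. X (f j)) J"
proof -
  have "indep_vars (\<lambda>j. PiM {f j} (\<lambda>_. borel)) (\<lambda>j \<omega>. restrict (\<lambda>i. X i \<omega>) {f j}) J"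
    using f by (intro indep_vars_restrict[OF assms(1)]) (auto simp: disjoint_family_on_def inj_on_def)
  then have "indep_vars (\<lambda>_. borel) (\<lambda>j \<omega>. (\<lambda>x. x (f j)) (restrict (\<lambda>i. X i \<omega>) {f j})) J"
    by (rule indep_vars_compose2) (auto intro!: measurable_component_singleton)
  then show ?thesis by simp
qed

text \<open>For increments over degenerate intervals, pass to the limit from a strictly increasing perturbation
  of the times, by right-continuity.\<close>

lemma (in prob_space) additive_process_weak_increments:
  assumes X: "additive_process M X" and t0: "0 \<le> t 0" and t: "\<forall>i<n. t i \<le> t (Suc i)"
  shows "indep_vars (\<lambda>_. borel) (\<lambda>i \<omega>. X (t (Suc i)) \<omega> - X (t i) \<omega>) {..<n::nat}"
proof -
  define u where "u k i = t i + real i / (real k + 1)" for k :: nat and i :: nat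
  have ti: "0 \<le> t i" if "i \<le> n" for i
    using chain_start_le[OF t that] t0 by linarith
  show ?thesis
  proof (rule indep_vars_AE_limit[where X="\<lambda>k i \<omega>. X (u k (Suc i)) \<omega> - X (u k i) \<omega>"])
    fix k
    have "u k i < u k (Suc i)" if "i < n" for i
    proof -
      have "real i / (real k + 1) < real (Suc i) / (real k + 1)" by (intro divide_strict_right_mono) auto
      then show ?thesis using t that unfolding u_def by (intro add_le_less_mono) auto
    qed
    moreover have "0 \<le> u k 0" using t0 by (simp add: u_def)
    ultimately have "indep_vars (\<lambda>_. borel)
        (\<lambda>i \<omega>. if i = 0 then X (u k 0) \<omega> else X (u k i) \<omega> - X (u k (i - 1)) \<omega>) {..n}"
      using X unfolding additive_process_def by auto
    from indep_vars_reindex[OF this, of Suc "{..<n}"]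
    show "indep_vars (\<lambda>_. borel) (\<lambda>i \<omega>. X (u k (Suc i)) \<omega> - X (u k i) \<omega>) {..<n}"
      by (simp add: image_subset_iff)
  next
    fix i assume "i \<in> {..<n}"
    then have i: "0 \<le> t i" "0 \<le> t (Suc i)" using ti[of i] ti[of "Suc i"] by auto
    then show "(\<lambda>\<omega>. X (t (Suc i)) \<omega> - X (t i) \<omega>) \<in> borel_measurable M"
      using X unfolding additive_process_def by (intro borel_measurable_diff) blast+
    have "AE \<omega> in M. cadlag (\<lambda>t. X t \<omega>)" using X unfolding additive_process_def by auto
    then show "AE \<omega> in M. (\<lambda>k. X (u k (Suc i)) \<omega> - X (u k i) \<omega>) \<longlonglongrightarrow> X (t (Suc i)) \<omega> - X (t i) \<omega>"
    proof eventually_elim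
      case (elim \<omega>)
      have "(\<lambda>k. X (u k j) \<omega>) \<longlonglongrightarrow> X (t j) \<omega>" if "0 \<le> t j" for j
      proof -
        have "continuous (at (t j) within {t j..}) (\<lambda>s. X s \<omega>)"
          using elim that unfolding cadlag_def by (metis at_within_Ici_at_right)
        then have "\<forall>x. (\<forall>n. x n \<in> {t j..}) \<and> x \<longlonglongrightarrow> t j \<longrightarrow> ((\<lambda>s. X s \<omega>) \<circ> x) \<longlonglongrightarrow> X (t j) \<omega>"
          using continuous_within_sequentially[of "t j" "{t j..}" "\<lambda>s. X s \<omega>"] by simp
        from this[rule_format, of "\<lambda>k. u k j"] show ?thesis
        proof (simp add: o_def, elim meta_mp)
          have "(\<lambda>k. t j + real j / (real k + 1)) \<longlonglongrightarrow> t j" by real_asymp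
          then show "(\<forall>k. t j \<le> u k j) \<and> (\<lambda>k. u k j) \<longlonglongrightarrow> t j"
            by (auto simp: u_def)
        qed
      qed
      then show ?case using i by (intro tendsto_diff) auto
    qed
  qed
qed

text \<open>All the variables \<open>U i\<close> and \<open>V i\<close> together are independent: a cylinder event splits into one for each
  family, and each of these into its factors.\<close>

lemma (in prob_space) indep_vars_add_of_indep_families:
  fixes U V :: "'i \<Rightarrow> 'a \<Rightarrow> real"
  assumes I: "finite I" and U: "indep_vars (\<lambda>_. borel) U I" and V: "indep_vars (\<lambda>_. borel) V I"
    and UV: "indep_var (PiM I (\<lambda>_. borel)) (\<lambda>\<omega>. \<lambda>i\<in>I. U i \<omega>) (PiM I (\<lambda>_. borel)) (\<lambda>\<omega>. \<lambda>i\<in>I. V i \<omega>)"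
  shows "indep_vars (\<lambda>_. borel) (\<lambda>i \<omega>. U i \<omega> + V i \<omega>) I"
proof (cases "I = {}")
  case True
  then show ?thesis unfolding indep_vars_def indep_sets_def by simp
next
  case False
  define K where "K = (UNIV :: bool set) \<times> I"
  define W where "W = (\<lambda>(b, i). if b then U i else V i)"
  have Urv [measurable]: "U i \<in> borel_measurable M" if "i \<in> I" for i using U that unfolding indep_vars_def by auto
  have Vrv [measurable]: "V i \<in> borel_measurable M" if "i \<in> I" for i using V that unfolding indep_vars_def by auto
  have ind: "indep_vars (\<lambda>_. borel) W K"
  proof (subst indep_vars_finite[where E="\<lambda>_. sets borel"])
    show "K \<noteq> {}" "finite K" using I False by (auto simp: K_def)
    show "W k \<in> borel_measurable M" if "k \<in> K" for k using that Urv Vrv by (auto simp: K_def W_def)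
    show "\<forall>A\<in>(\<Pi> k\<in>K. sets borel). prob (\<Inter>j\<in>K. W j -` A j \<inter> space M) = (\<Prod>j\<in>K. prob (W j -` A j \<inter> space M))"
    proof
      fix A :: "bool \<times> 'i \<Rightarrow> real set" assume A: "A \<in> (\<Pi> k\<in>K. sets borel)"
      then have Ab: "A (b, i) \<in> sets borel" if "i \<in> I" for b i using that by (auto simp: K_def)
      define P where "P b = (\<Pi>\<^sub>E i\<in>I. A (b, i))" for b
      have P: "P b \<in> sets (PiM I (\<lambda>_. borel))" for b
        unfolding P_def using I Ab by (intro sets_PiM_I_finite) auto
      have PU: "(\<lambda>\<omega>. \<lambda>i\<in>I. U i \<omega>) -` P True \<inter> space M = (\<Inter>i\<in>I. U i -` A (True, i) \<inter> space M)"
        using False by (auto simp: P_def PiE_iff)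
      have PV: "(\<lambda>\<omega>. \<lambda>i\<in>I. V i \<omega>) -` P False \<inter> space M = (\<Inter>i\<in>I. V i -` A (False, i) \<inter> space M)"
        using False by (auto simp: P_def PiE_iff)
      have "(\<Inter>j\<in>K. W j -` A j \<inter> space M) =
          (\<Inter>i\<in>I. U i -` A (True, i) \<inter> space M) \<inter> (\<Inter>i\<in>I. V i -` A (False, i) \<inter> space M)"
        using False unfolding K_def W_def by (auto split: if_splits) (metis (full_types))
      also have "\<dots> = (\<lambda>\<omega>. (\<lambda>i\<in>I. U i \<omega>, \<lambda>i\<in>I. V i \<omega>)) -` (P True \<times> P False) \<inter> space M"
        unfolding PU[symmetric] PV[symmetric] by auto
      finally have "prob (\<Inter>j\<in>K. W j -` A j \<inter> space M) =
          prob (\<Inter>i\<in>I. U i -` A (True, i) \<inter> space M) * prob (\<Inter>i\<in>I. V i -` A (False, i) \<inter> space M)"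
        using indep_varD[OF UV P P] PU PV by simp
      also have "\<dots> = (\<Prod>i\<in>I. prob (U i -` A (True, i) \<inter> space M)) * (\<Prod>i\<in>I. prob (V i -` A (False, i) \<inter> space M))"
        using indep_varsD_finite[OF U False I, of "\<lambda>i. A (True, i)"]
          indep_varsD_finite[OF V False I, of "\<lambda>i. A (False, i)"] Ab by simp
      also have "\<dots> = (\<Prod>b\<in>UNIV. \<Prod>i\<in>I. prob (W (b, i) -` A (b, i) \<inter> space M))"
        by (simp add: UNIV_bool W_def mult.commute)
      also have "\<dots> = (\<Prod>j\<in>K. prob (W j -` A j \<inter> space M))"
        unfolding K_def by (simp add: prod.cartesian_product)
      finally show "prob (\<Inter>j\<in>K. W j -` A j \<inter> space M) = (\<Prod>j\<in>K. prob (W j -` A j \<inter> space M))" .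
    qed
    show "sets borel = sigma_sets (space borel) (sets (borel :: real measure))"
      by (rule sets.sigma_sets_eq[symmetric])
  qed (auto simp: Int_stable_def)
  have "indep_vars (\<lambda>i. PiM (UNIV \<times> {i}) (\<lambda>_. borel)) (\<lambda>i \<omega>. restrict (\<lambda>k. W k \<omega>) (UNIV \<times> {i})) I"
    by (intro indep_vars_restrict[OF ind]) (auto simp: K_def disjoint_family_on_def)
  then have "indep_vars (\<lambda>_. borel) (\<lambda>i \<omega>. (\<lambda>x. x (True, i) + x (False, i)) (restrict (\<lambda>k. W k \<omega>) (UNIV \<times> {i}))) I"
    by (rule indep_vars_compose2) (auto intro!: borel_measurable_add measurable_component_singleton)
  then show ?thesis by (simp add: W_def)
qed


lemma continuous_log_unique_real:
  fixes f g :: "real \<Rightarrow> complex"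
  assumes f: "continuous_on UNIV f" and g: "continuous_on UNIV g"
    and eq: "\<And>\<theta>. exp (f \<theta>) = exp (g \<theta>)" and 0: "f 0 = g 0"
  shows "f \<theta> = g \<theta>"
proof -
  have "f (1 * \<theta>) = g (1 * \<theta>)"
    by (rule continuous_log_unique[of "\<lambda>r. f (r * \<theta>)" "\<lambda>r. g (r * \<theta>)"])
       (auto intro!: continuous_on_compose2[OF f] continuous_on_compose2[OF g] continuous_intros simp: eq 0)
  then show ?thesis by simp
qed

text \<open>The version is set to 0 on the null set of irregular paths. For each fixed \<open>t < 0\<close> the left limit in
  the definition is almost surely the value \<open>L2 (- t)\<close>. Clamping the times at 0 then writes any increment as one
  of \<open>L1\<close> plus one of \<open>L2\<close>, whether or not the interval contains 0; both halves have the same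
  exponent because their laws at time 1 agree.\<close>

lemma (in prob_space) two_sided_levy_imp_bilateral:
  assumes "two_sided_levy_process M \<mu> L"
  shows "\<exists>L' \<psi>. bilateral_levy M L' \<psi> \<and> (AE \<omega> in M. \<forall>t. L' t \<omega> = L t \<omega>)"
proof -
  obtain L1 L2 where L1: "levy_process M L1" "distr M borel (L1 1) = \<mu>"
    and L2: "levy_process M L2" "distr M borel (L2 1) = \<mu>"
    and ind: "indep_var (\<Pi>\<^sub>M t\<in>{0..}. borel) (\<lambda>\<omega>. \<lambda>t\<in>{0..}. L1 t \<omega>) (\<Pi>\<^sub>M t\<in>{0..}. borel) (\<lambda>\<omega>. \<lambda>t\<in>{0..}. L2 t \<omega>)"
    and L: "\<And>\<omega> t. \<omega> \<in> space M \<Longrightarrow> L t \<omega> = (if 0 \<le> t then L1 t \<omega> else - Lim (at_left (- t)) (\<lambda>s. L2 s \<omega>))"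
    using assms unfolding two_sided_levy_process_def by blast
  have add1: "additive_process M L1" and add2: "additive_process M L2"
    using L1 L2 unfolding levy_process_def by auto
  have rv1: "L1 t \<in> borel_measurable M" and rv2: "L2 t \<in> borel_measurable M" if "0 \<le> t" for t
    using add1 add2 that unfolding additive_process_def by blast+
  have stat1: "distr M borel (\<lambda>\<omega>. L1 (s + h) \<omega> - L1 s \<omega>) = distr M borel (L1 h)"
    and stat2: "distr M borel (\<lambda>\<omega>. L2 (s + h) \<omega> - L2 s \<omega>) = distr M borel (L2 h)" if "0 \<le> s" "0 \<le> h" for s h
    using L1 L2 that unfolding levy_process_def by auto
  obtain \<psi> where \<psi>: "continuous_on UNIV \<psi>" "\<psi> 0 = 0"
    "\<And>t \<theta>. 0 \<le> t \<Longrightarrow> char (distr M borel (L1 t)) \<theta> = exp (of_real t * \<psi> \<theta>)"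
    using levy_process_exponent[OF L1(1)] by blast
  obtain \<psi>2 where \<psi>2: "continuous_on UNIV \<psi>2" "\<psi>2 0 = 0"
    "\<And>t \<theta>. 0 \<le> t \<Longrightarrow> char (distr M borel (L2 t)) \<theta> = exp (of_real t * \<psi>2 \<theta>)"
    using levy_process_exponent[OF L2(1)] by blast
  have "\<psi>2 \<theta> = \<psi> \<theta>" for \<theta>
  proof (rule continuous_log_unique_real[OF \<psi>2(1) \<psi>(1)])
    fix \<theta> show "exp (\<psi>2 \<theta>) = exp (\<psi> \<theta>)"
      using \<psi>(3)[of 1 \<theta>] \<psi>2(3)[of 1 \<theta>] L1(2) L2(2) by simp
  qed (simp add: \<psi> \<psi>2)
  then have \<psi>2': "char (distr M borel (L2 t)) \<theta> = exp (of_real t * \<psi> \<theta>)" if "0 \<le> t" for t \<theta>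
    using \<psi>2(3)[OF that] by simp
  have "AE \<omega> in M. cadlag (\<lambda>t. L1 t \<omega>) \<and> L1 0 \<omega> = 0 \<and> cadlag (\<lambda>t. L2 t \<omega>) \<and> L2 0 \<omega> = 0"
    using add1 add2 unfolding additive_process_def by auto
  then obtain N where N: "{\<omega>\<in>space M. \<not> (cadlag (\<lambda>t. L1 t \<omega>) \<and> L1 0 \<omega> = 0 \<and> cadlag (\<lambda>t. L2 t \<omega>) \<and> L2 0 \<omega> = 0)} \<subseteq> N"
    "N \<in> null_sets M" unfolding eventually_ae_filter by blast
  have Nm [measurable]: "N \<in> events" using N by auto
  have AEN: "AE \<omega> in M. \<omega> \<notin> N" using N(2) by (rule AE_not_in)
  have good: "cadlag (\<lambda>t. L1 t \<omega>)" "L1 0 \<omega> = 0" "cadlag (\<lambda>t. L2 t \<omega>)" "L2 0 \<omega> = 0"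
    if "\<omega> \<in> space M" "\<omega> \<notin> N" for \<omega>
    using N(1) that by auto
  define K where "K t \<omega> = (if \<omega> \<in> N then 0 else L t \<omega>)" for t \<omega>
  have K_eq: "(\<lambda>t. K t \<omega>) = (\<lambda>t. if 0 \<le> t then L1 t \<omega> else - Lim (at_left (- t)) (\<lambda>s. L2 s \<omega>))"
    if "\<omega> \<in> space M" "\<omega> \<notin> N" for \<omega>
    using that by (simp add: K_def L fun_eq_iff)
  have AEK: "AE \<omega> in M. \<forall>t. K t \<omega> = L t \<omega>"
    using AEN by eventually_elim (simp add: K_def)
  have rcll: "rcll (\<lambda>t. K t \<omega>)" if "\<omega> \<in> space M" for \<omega>
  proof (cases "\<omega> \<in> N")
    case True
    then show ?thesis by (auto simp: K_def rcll_def)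
  next
    case False
    show ?thesis unfolding K_eq[OF that False]
      by (rule rcll_two_sided_path(1)[OF good[OF that False]])
  qed
  have cont: "AE \<omega> in M. isCont (\<lambda>s. K s \<omega>) t" for t
  proof -
    have "AE \<omega> in M. t > 0 \<longrightarrow> ((\<lambda>s. L1 s \<omega>) \<longlongrightarrow> L1 t \<omega>) (at_left t)"
      using additive_process_no_fixed_jump[OF add1, of t] by (cases "t > 0") auto
    moreover have "AE \<omega> in M. t < 0 \<longrightarrow> ((\<lambda>s. L2 s \<omega>) \<longlongrightarrow> L2 (- t) \<omega>) (at_left (- t))"
      using additive_process_no_fixed_jump[OF add2, of "- t"] by (cases "t < 0") auto
    ultimately show ?thesis using AEN AE_space
    proof eventually_elim
      case (elim \<omega>)
      show ?case unfolding K_eq[OF elim(4,3)]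
        by (rule rcll_two_sided_path(2)[OF good[OF elim(4,3)]]) (use elim in auto)
    qed
  qed
  have K_clamp: "AE \<omega> in M. K t \<omega> = L1 (max t 0) \<omega> - L2 (max (- t) 0) \<omega>" for t
  proof -
    have "AE \<omega> in M. t < 0 \<longrightarrow> ((\<lambda>s. L2 s \<omega>) \<longlongrightarrow> L2 (- t) \<omega>) (at_left (- t))"
      using additive_process_no_fixed_jump[OF add2, of "- t"] by (cases "t < 0") auto
    then show ?thesis using AEN AE_space
    proof eventually_elim
      case (elim \<omega>)
      note g = good[OF elim(3,2)]
      have "Lim (at_left (- t)) (\<lambda>s. L2 s \<omega>) = L2 (- t) \<omega>" if "t < 0"
        using elim(1) that by (intro tendsto_Lim) auto
      then show ?case using fun_cong[OF K_eq[OF elim(3,2)], of t] g by (auto simp: max_def)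
    qed
  qed
  have Kmeas: "K t \<in> borel_measurable M" for t
  proof (cases "0 \<le> t")
    case True
    have [measurable]: "L1 t \<in> borel_measurable M" using rv1[OF True] .
    have "(\<lambda>\<omega>. if \<omega> \<in> N then 0 else L1 t \<omega>) \<in> borel_measurable M" by measurable
    then show ?thesis
      by (rule measurable_cong[THEN iffD1, rotated]) (use True in \<open>simp add: K_def L\<close>)
  next
    case False
    define s where "s n = - t - (- t) / (real n + 2)" for n
    have s: "0 \<le> s n" "s n < - t" for n
    proof -
      have "s n = (- t) * ((real n + 1) / (real n + 2))" by (simp add: s_def field_simps)
      then show "0 \<le> s n" using False by (simp only:) (intro mult_nonneg_nonneg, auto)
      show "s n < - t" using False by (simp add: s_def divide_neg_pos)
    qed
    have slim: "filterlim s (at_left (- t)) sequentially"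
    proof -
      have "s \<longlonglongrightarrow> - t" unfolding s_def by real_asymp
      then show ?thesis
        using s by (auto simp: filterlim_at intro!: always_eventually order.strict_implies_not_eq)
    qed
    show ?thesis
    proof (rule borel_measurable_LIMSEQ_real)
      have [measurable]: "L2 (s n) \<in> borel_measurable M" for n using s by (intro rv2)
      show "(\<lambda>\<omega>. if \<omega> \<in> N then 0 else - L2 (s n) \<omega>) \<in> borel_measurable M" for n by measurable
      show "(\<lambda>n. if \<omega> \<in> N then 0 else - L2 (s n) \<omega>) \<longlonglongrightarrow> K t \<omega>" if w: "\<omega> \<in> space M" for \<omega>
      proof (cases "\<omega> \<in> N")
        case False': False
        obtain l where l: "((\<lambda>s. L2 s \<omega>) \<longlongrightarrow> l) (at_left (- t))"
          using good(3)[OF w False'] False unfolding cadlag_def by (metis neg_0_less_iff_less not_less)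
        then have "Lim (at_left (- t)) (\<lambda>s. L2 s \<omega>) = l" by (intro tendsto_Lim) auto
        then have "K t \<omega> = - l" using False False' w by (simp add: K_def L)
        then show ?thesis using filterlim_compose[OF l slim] False' by (auto intro!: tendsto_minus)
      qed (simp add: K_def)
    qed
  qed
  have indK: "indep_vars (\<lambda>_. borel) (\<lambda>i \<omega>. K (s (Suc i)) \<omega> - K (s i) \<omega>) {..<n}"
    if s: "\<forall>i<n. s i < s (Suc i)" for n :: nat and s
  proof -
    define U where "U i \<omega> = L1 (max (s (Suc i)) 0) \<omega> - L1 (max (s i) 0) \<omega>" for i \<omega>
    define V where "V i \<omega> = L2 (max (- s i) 0) \<omega> - L2 (max (- s (Suc i)) 0) \<omega>" for i \<omega>
    have "indep_vars (\<lambda>_. borel) (\<lambda>i \<omega>. U i \<omega> + V i \<omega>) {..<n}"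
    proof (rule indep_vars_add_of_indep_families)
      show "indep_vars (\<lambda>_. borel) U {..<n}"
        unfolding U_def using s by (intro additive_process_weak_increments[OF add1]) (auto simp: less_imp_le max.coboundedI1)
      define u where "u j = max (- s (n - j)) 0" for j
      have "u j \<le> u (Suc j)" if "j < n" for j
      proof -
        have "s (n - Suc j) < s (Suc (n - Suc j))" using s that by auto
        then show ?thesis using that by (auto simp: u_def Suc_diff_Suc)
      qed
      then have "indep_vars (\<lambda>_. borel) (\<lambda>i \<omega>. L2 (u (Suc i)) \<omega> - L2 (u i) \<omega>) {..<n}"
        by (intro additive_process_weak_increments[OF add2]) (auto simp: u_def)
      moreover have "inj_on (\<lambda>i. n - Suc i) {..<n}" "(\<lambda>i. n - Suc i) ` {..<n} \<subseteq> {..<n}"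
        by (auto simp: inj_on_def)
      ultimately have "indep_vars (\<lambda>_. borel) (\<lambda>i \<omega>. L2 (u (Suc (n - Suc i))) \<omega> - L2 (u (n - Suc i)) \<omega>) {..<n}"
        by (rule indep_vars_reindex[where f="\<lambda>i. n - Suc i"])
      then show "indep_vars (\<lambda>_. borel) V {..<n}"
        by (rule indep_vars_cong[THEN iffD1, rotated 3]) (auto simp: V_def u_def fun_eq_iff Suc_diff_Suc)
      let ?T = "\<Pi>\<^sub>M t\<in>{0..}. borel :: real measure"
      let ?u = "\<lambda>x :: real \<Rightarrow> real. \<lambda>i\<in>{..<n}. x (max (s (Suc i)) 0) - x (max (s i) 0)"
      let ?v = "\<lambda>x :: real \<Rightarrow> real. \<lambda>i\<in>{..<n}. x (max (- s i) 0) - x (max (- s (Suc i)) 0)"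
      have um: "?u \<in> ?T \<rightarrow>\<^sub>M PiM {..<n} (\<lambda>_. borel)" and vm: "?v \<in> ?T \<rightarrow>\<^sub>M PiM {..<n} (\<lambda>_. borel)"
        by (intro measurable_restrict borel_measurable_diff measurable_component_singleton; simp)+
      show "indep_var (PiM {..<n} (\<lambda>_. borel)) (\<lambda>\<omega>. \<lambda>i\<in>{..<n}. U i \<omega>) (PiM {..<n} (\<lambda>_. borel)) (\<lambda>\<omega>. \<lambda>i\<in>{..<n}. V i \<omega>)"
        using indep_var_compose[OF ind um vm] by (simp add: o_def U_def V_def)
    qed simp
    then show ?thesis
    proof (rule indep_vars_AE_limit[where X="\<lambda>_ i \<omega>. U i \<omega> + V i \<omega>"])
      fix i
      show "(\<lambda>\<omega>. K (s (Suc i)) \<omega> - K (s i) \<omega>) \<in> borel_measurable M"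
        using Kmeas by (intro borel_measurable_diff)
      show "AE \<omega> in M. (\<lambda>n. U i \<omega> + V i \<omega>) \<longlonglongrightarrow> K (s (Suc i)) \<omega> - K (s i) \<omega>"
        using K_clamp[of "s (Suc i)"] K_clamp[of "s i"]
      proof eventually_elim
        case (elim \<omega>)
        then have "K (s (Suc i)) \<omega> - K (s i) \<omega> = U i \<omega> + V i \<omega>" by (simp add: U_def V_def)
        then show ?case by simp
      qed
    qed
  qed
  have charK: "char (distr M borel (\<lambda>\<omega>. K t \<omega> - K s \<omega>)) \<theta> = exp (of_real (t - s) * \<psi> \<theta>)"
    if st: "s \<le> t" for s t \<theta>
  proof -
    define U where "U \<omega> = L1 (max t 0) \<omega> - L1 (max s 0) \<omega>" for \<omega>
    define V where "V \<omega> = L2 (max (- s) 0) \<omega> - L2 (max (- t) 0) \<omega>" for \<omega>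
    let ?T = "\<Pi>\<^sub>M t\<in>{0..}. borel :: real measure"
    let ?u = "\<lambda>x :: real \<Rightarrow> real. x (max t 0) - x (max s 0)"
    let ?v = "\<lambda>x :: real \<Rightarrow> real. x (max (- s) 0) - x (max (- t) 0)"
    have um: "?u \<in> ?T \<rightarrow>\<^sub>M borel" and vm: "?v \<in> ?T \<rightarrow>\<^sub>M borel"
      by (intro borel_measurable_diff measurable_component_singleton; simp)+
    have UV: "indep_var borel U borel V"
      using indep_var_compose[OF ind um vm] by (simp add: o_def U_def[abs_def] V_def[abs_def])
    have [measurable]: "U \<in> borel_measurable M" "V \<in> borel_measurable M"
      using UV indep_var_rv1 indep_var_rv2 by blast+
    have [measurable]: "K t \<in> borel_measurable M" "K s \<in> borel_measurable M" using Kmeas by auto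
    have "AE \<omega> in M. K t \<omega> - K s \<omega> = U \<omega> + V \<omega>"
      using K_clamp[of t] K_clamp[of s] by eventually_elim (simp add: U_def V_def)
    then have "distr M borel (\<lambda>\<omega>. K t \<omega> - K s \<omega>) = distr M borel (\<lambda>\<omega>. U \<omega> + V \<omega>)"
      by (intro distr_cong_AE) auto
    then have "char (distr M borel (\<lambda>\<omega>. K t \<omega> - K s \<omega>)) \<theta> =
        char (distr M borel U) \<theta> * char (distr M borel V) \<theta>"
      using char_distr_add[OF UV] by simp
    also have "distr M borel U = distr M borel (L1 (max t 0 - max s 0))"
      using stat1[of "max s 0" "max t 0 - max s 0"] st by (simp add: U_def[abs_def])
    also have "distr M borel V = distr M borel (L2 (max (- s) 0 - max (- t) 0))"
      using stat2[of "max (- t) 0" "max (- s) 0 - max (- t) 0"] st by (simp add: V_def[abs_def])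
    also have "char (distr M borel (L1 (max t 0 - max s 0))) \<theta> * char (distr M borel (L2 (max (- s) 0 - max (- t) 0))) \<theta>
       = exp (of_real (max t 0 - max s 0) * \<psi> \<theta> + of_real (max (- s) 0 - max (- t) 0) * \<psi> \<theta>)"
      using st by (subst \<psi>(3), simp, subst \<psi>2') (auto simp: exp_add)
    also have "of_real (max t 0 - max s 0) * \<psi> \<theta> + of_real (max (- s) 0 - max (- t) 0) * \<psi> \<theta>
       = of_real ((max t 0 - max s 0) + (max (- s) 0 - max (- t) 0)) * \<psi> \<theta>"
      by (simp only: of_real_add distrib_right)
    also have "(max t 0 - max s 0) + (max (- s) 0 - max (- t) 0) = t - s" by (auto simp: max_def)
    finally show ?thesis .
  qed
  have "bilateral_levy M K \<psi>"
    by unfold_locales (use Kmeas rcll indK charK \<psi> cont in auto)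
  then show ?thesis using AEK by blast
qed

section \<open>Exponential integrals against the time-changed process\<close>

lemma rcll_compose_strict_mono:
  assumes y: "rcll y" and h: "strict_mono h" "\<And>t. isCont h t"
  shows "rcll (\<lambda>t. y (h t :: real))"
proof -
  have lim: "(h \<longlongrightarrow> h t) (at t within B)" for t B
    using h(2)[of t] unfolding isCont_def by (rule tendsto_within_subset) simp
  have r: "filterlim h (at_right (h t)) (at_right t)" for t
  proof -
    have "eventually (\<lambda>s. h s \<in> {h t<..} \<and> h s \<noteq> h t) (at_right t)"
      unfolding eventually_at_filter using strict_monoD[OF h(1), of t] by (force intro: always_eventually)
    then show ?thesis unfolding filterlim_at using lim by blast
  qed
  have l: "filterlim h (at_left (h t)) (at_left t)" for t
  proof -
    have "eventually (\<lambda>s. h s \<in> {..<h t} \<and> h s \<noteq> h t) (at_left t)"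
      unfolding eventually_at_filter using strict_monoD[OF h(1), of _ t] by (force intro: always_eventually)
    then show ?thesis unfolding filterlim_at using lim by blast
  qed
  show ?thesis
    unfolding rcll_def continuous_within
  proof
    fix t
    obtain k where "(y \<longlongrightarrow> y (h t)) (at_right (h t))" "(y \<longlongrightarrow> k) (at_left (h t))"
      using y unfolding rcll_def continuous_within by blast
    then show "((\<lambda>t. y (h t)) \<longlongrightarrow> y (h t)) (at_right t) \<and> (\<exists>l. ((\<lambda>t. y (h t)) \<longlongrightarrow> l) (at_left t))"
      using filterlim_compose[OF _ r] filterlim_compose[OF _ l] by blast
  qed
qed

lemma (in prob_space) char_scale:
  assumes "X \<in> borel_measurable M"
  shows "char (distr M borel (\<lambda>\<omega>. c * X \<omega>)) \<theta> = char (distr M borel X) (\<theta> * c)"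
  using assms by (simp add: char_distr mult.assoc)

lemma (in prob_space) char_tendsto_of_AE:
  assumes [measurable]: "\<And>n. X n \<in> borel_measurable M" "Z \<in> borel_measurable M"
    and lim: "AE \<omega> in M. (\<lambda>n. X n \<omega>) \<longlonglongrightarrow> Z \<omega>"
  shows "(\<lambda>n. char (distr M borel (X n)) \<theta>) \<longlonglongrightarrow> char (distr M borel Z) \<theta>"
  unfolding char_distr[OF assms(1)] char_distr[OF assms(2)]
proof (rule integral_dominated_convergence[where w="\<lambda>_. 1"])
  show "AE \<omega> in M. (\<lambda>n. iexp (\<theta> * X n \<omega>)) \<longlonglongrightarrow> iexp (\<theta> * Z \<omega>)"
    using lim by eventually_elim (intro tendsto_intros)
qed auto

lemma (in prob_space) tendsto_measure_of_AE:
  assumes [measurable]: "\<And>n. X n \<in> borel_measurable M"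
    and lim: "AE \<omega> in M. (\<lambda>n. X n \<omega>) \<longlonglongrightarrow> (0 :: real)" and \<epsilon>: "\<epsilon> > 0"
  shows "(\<lambda>n. prob {\<omega>\<in>space M. \<bar>X n \<omega>\<bar> > \<epsilon>}) \<longlonglongrightarrow> 0"
proof -
  have "(\<lambda>n. \<integral>\<omega>. indicator {\<omega>\<in>space M. \<bar>X n \<omega>\<bar> > \<epsilon>} \<omega> \<partial>M) \<longlonglongrightarrow> (\<integral>\<omega>. (0 :: real) \<partial>M)"
  proof (rule integral_dominated_convergence[where w="\<lambda>_. 1"])
    show "AE \<omega> in M. (\<lambda>n. indicator {\<omega>\<in>space M. \<bar>X n \<omega>\<bar> > \<epsilon>} \<omega>) \<longlonglongrightarrow> (0 :: real)"
      using lim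
    proof eventually_elim
      case (elim \<omega>)
      then have "eventually (\<lambda>n. dist (X n \<omega>) 0 < \<epsilon>) sequentially" using \<epsilon> by (rule tendstoD)
      then have "eventually (\<lambda>n. indicator {\<omega>\<in>space M. \<bar>X n \<omega>\<bar> > \<epsilon>} \<omega> = (0 :: real)) sequentially"
        by eventually_elim (auto simp: indicator_def)
      then show ?case by (rule tendsto_eventually)
    qed
  qed auto
  then show ?thesis by simp
qed

locale exp_integral = bilateral_levy M L \<psi> for M :: "'w measure" and L \<psi> +
  fixes \<delta> \<kappa> :: real
  assumes \<delta>_nz: "\<delta> \<noteq> 0" and \<kappa>_pos: "\<kappa> > 0"
begin

text \<open>\<open>I\<close> is the random integral, \<open>S\<close> its Riemann--Stieltjes sums and \<open>\<Psi>\<close> its exponent. \<open>F\<close> is a primitive: it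
  separates the two end points of \<open>I\<close>, so that regularity in the upper one can be stated without
  fixing the lower one.\<close>

definition \<tau> :: "real \<Rightarrow> real" where "\<tau> t = (exp (\<delta> * t) - 1) / (exp \<delta> - 1)"
definition \<tau>' :: "real \<Rightarrow> real" where "\<tau>' t = \<delta> / (exp \<delta> - 1) * exp (\<delta> * t)"
definition A :: "real \<Rightarrow> real" where "A t = exp (t * \<kappa>)"
definition Y :: "real \<Rightarrow> 'w \<Rightarrow> real" where "Y = time_changed \<delta> L"
definition I :: "real \<Rightarrow> real \<Rightarrow> 'w \<Rightarrow> real" where "I a b \<omega> = random_integral A Y a b \<omega>"
definition F :: "real \<Rightarrow> 'w \<Rightarrow> real" where "F b \<omega> = (if 0 \<le> b then I 0 b \<omega> else - I b 0 \<omega>)"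
definition S :: "real \<Rightarrow> real \<Rightarrow> nat \<Rightarrow> 'w \<Rightarrow> real" where
  "S a b n \<omega> = (\<Sum>m<n. A (grid a b n m) * (Y (grid a b n (Suc m)) \<omega> - Y (grid a b n m) \<omega>))"
definition \<Psi> :: "real \<Rightarrow> real \<Rightarrow> real \<Rightarrow> complex" where
  "\<Psi> a b \<theta> = integral {a..b} (\<lambda>t. \<tau>' t *\<^sub>R \<psi> (\<theta> * A t))"

lemma Y_eq: "Y t \<omega> = L (\<tau> t) \<omega>"
  by (simp add: Y_def time_changed_def \<tau>_def)

lemma Y_meas [measurable]: "Y t \<in> borel_measurable M"
  unfolding Y_eq[abs_def] by measurable

lemma clock_rate_pos: "\<delta> / (exp \<delta> - 1) > 0"
proof (cases "\<delta> > 0")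
  case True then show ?thesis by simp
next
  case False
  then have "\<delta> < 0" using \<delta>_nz by simp
  then show ?thesis by (simp add: divide_neg_neg)
qed

lemma \<tau>_deriv: "(\<tau> has_real_derivative \<tau>' t) (at t)"
proof -
  have "((\<lambda>t. exp (\<delta> * t) - 1) has_real_derivative exp (\<delta> * t) * \<delta>) (at t)"
    by (auto intro!: derivative_eq_intros)
  from DERIV_cdivide[OF this, of "exp \<delta> - 1"] show ?thesis
    by (simp add: \<tau>_def[abs_def] \<tau>'_def mult.commute)
qed

lemma \<tau>'_pos: "\<tau>' t > 0"
  unfolding \<tau>'_def using clock_rate_pos by (intro mult_pos_pos) auto

lemma \<tau>_strict_mono: "strict_mono \<tau>"
proof (rule strict_monoI)
  fix s t :: real assume "s < t"
  then show "\<tau> s < \<tau> t"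
    by (rule DERIV_pos_imp_increasing) (use \<tau>_deriv \<tau>'_pos in blast)
qed

lemma \<tau>_cont: "isCont \<tau> t"
  using \<tau>_deriv by (rule DERIV_isCont)

lemma \<tau>'_cont: "continuous_on B \<tau>'"
  unfolding \<tau>'_def by (intro continuous_intros)

lemma \<tau>_shift: "\<tau> (t + c) - \<tau> (s + c) = exp (\<delta> * c) * (\<tau> t - \<tau> s)"
  unfolding \<tau>_def by (simp add: algebra_simps exp_add diff_divide_distrib)

lemma A_deriv: "(A has_real_derivative \<kappa> * A t) (at t)"
  unfolding A_def by (auto intro!: derivative_eq_intros)

lemma deriv_A: "deriv A t = \<kappa> * A t"
  using A_deriv by (rule DERIV_imp_deriv)

lemma A_cont: "continuous_on B A"
  unfolding A_def by (intro continuous_intros)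

lemma A_pos: "A t > 0"
  by (simp add: A_def)

lemma A_add: "A (s + t) = A s * A t"
  by (simp add: A_def exp_add algebra_simps)

lemma rcll_Y: "\<omega> \<in> space M \<Longrightarrow> rcll (\<lambda>t. Y t \<omega>)"
  unfolding Y_eq using rcll_compose_strict_mono[OF L_rcll \<tau>_strict_mono \<tau>_cont] by blast

lemma Y_cont: "AE \<omega> in M. isCont (\<lambda>s. Y s \<omega>) t"
  using L_cont[of "\<tau> t"] unfolding Y_eq
  by eventually_elim (rule isCont_o2[OF \<tau>_cont])

lemma integrand_integrable:
  assumes "\<omega> \<in> space M"
  shows "(\<lambda>t. deriv A t * Y t \<omega>) integrable_on {a..b}"
proof (cases "a < b")
  case True
  have "continuous_on {a..b} (\<lambda>t. \<kappa> * A t)" by (intro continuous_intros A_cont)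
  from right_tag_sums_tendsto_integral(1)[OF True rcll_Y[OF assms] A_deriv this]
  show ?thesis unfolding deriv_A .
next
  case False
  then show ?thesis using integrable_on_refl[of _ a] by (cases "a = b") auto
qed

lemma I_add:
  assumes "\<omega> \<in> space M" "a \<le> b" "b \<le> c"
  shows "I a b \<omega> + I b c \<omega> = I a c \<omega>"
  unfolding I_def random_integral_def
  using Henstock_Kurzweil_Integration.integral_combine[OF assms(2,3) integrand_integrable[OF assms(1)]]
  by simp

lemma I_same [simp]: "I a a \<omega> = 0"
  by (simp add: I_def random_integral_def)

lemma I_eq_F:
  assumes "\<omega> \<in> space M" "a \<le> b"
  shows "I a b \<omega> = F b \<omega> - F a \<omega>"
  using I_add[OF assms(1), of a b 0] I_add[OF assms(1), of 0 a b] I_add[OF assms(1), of a 0 b] assms(2)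
  by (auto simp: F_def)

lemma S_tendsto_I:
  assumes "a < b" "\<omega> \<in> space M"
  shows "(\<lambda>n. S a b n \<omega>) \<longlonglongrightarrow> I a b \<omega>"
  unfolding S_def I_def random_integral_def deriv_A
  by (rule left_sums_tendsto_by_parts[OF assms(1) rcll_Y[OF assms(2)] A_deriv])
     (intro continuous_intros A_cont)

lemma S_meas [measurable]: "S a b n \<in> borel_measurable M"
  unfolding S_def by measurable

lemma I_meas:
  assumes "a \<le> b"
  shows "I a b \<in> borel_measurable M"
proof (cases "a = b")
  case True
  have "I b b = (\<lambda>_. 0)" by (simp add: fun_eq_iff)
  then show ?thesis using True by simp
next
  case False
  then show ?thesis using assms borel_measurable_LIMSEQ_real[OF S_tendsto_I S_meas, of a b] by simp
qed

lemma F_meas: "F b \<in> borel_measurable M"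
  unfolding F_def using I_meas[of 0 b] I_meas[of b 0] by (cases "0 \<le> b") auto

lemma \<psi>_comp_cont: "continuous_on B f \<Longrightarrow> continuous_on B (\<lambda>x. \<psi> (f x))"
  by (rule continuous_on_compose2[OF \<psi>_cont]) auto

lemma exponent_integrand_cont: "continuous_on B (\<lambda>t. \<tau>' t *\<^sub>R \<psi> (\<theta> * A t))"
  by (intro continuous_intros \<tau>'_cont \<psi>_comp_cont A_cont)

lemma \<Psi>_same [simp]: "\<Psi> a a \<theta> = 0"
  by (simp add: \<Psi>_def)

lemma \<Psi>_0 [simp]: "\<Psi> a b 0 = 0"
  by (simp add: \<Psi>_def \<psi>_0)

lemma \<Psi>_add: "a \<le> b \<Longrightarrow> b \<le> c \<Longrightarrow> \<Psi> a b \<theta> + \<Psi> b c \<theta> = \<Psi> a c \<theta>"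
  unfolding \<Psi>_def
  by (intro Henstock_Kurzweil_Integration.integral_combine integrable_continuous_real exponent_integrand_cont)

lemma \<Psi>_cont: "continuous_on UNIV (\<Psi> a b)"
proof -
  have "continuous_on (UNIV \<times> cbox a b) (\<lambda>(\<theta>, t). \<tau>' t *\<^sub>R \<psi> (\<theta> * A t))"
    unfolding case_prod_beta
    by (intro continuous_intros \<psi>_comp_cont continuous_on_compose2[OF \<tau>'_cont[of UNIV]] continuous_on_compose2[OF A_cont[of UNIV]]) auto
  from integral_continuous_on_param[OF this] show ?thesis unfolding \<Psi>_def[abs_def] by simp
qed

definition \<Psi>\<^sub>S :: "real \<Rightarrow> real \<Rightarrow> nat \<Rightarrow> real \<Rightarrow> complex" where
  "\<Psi>\<^sub>S a b n \<theta> = (\<Sum>m<n. (\<tau> (grid a b n (Suc m)) - \<tau> (grid a b n m)) *\<^sub>R \<psi> (\<theta> * A (grid a b n m)))"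

lemma \<Psi>\<^sub>S_tendsto: "a < b \<Longrightarrow> (\<lambda>n. \<Psi>\<^sub>S a b n \<theta>) \<longlonglongrightarrow> \<Psi> a b \<theta>"
  unfolding \<Psi>\<^sub>S_def \<Psi>_def
  by (intro left_tag_sums_tendsto_integral \<tau>_deriv \<tau>'_cont \<psi>_comp_cont continuous_intros A_cont)

lemma grid_shift: "grid (a + c) (b + c) n m = grid a b n m + c"
  by (simp add: grid_def)

text \<open>The clock and the integrand both scale under translation, and this is visible already on the
  Riemann sums.\<close>

lemma \<Psi>_shift:
  assumes "a \<le> b"
  shows "\<Psi> (a + c) (b + c) \<theta> = of_real (exp (\<delta> * c)) * \<Psi> a b (A c * \<theta>)"
proof (cases "a = b")
  case False
  then have ab: "a < b" using assms by simp
  have "\<Psi>\<^sub>S (a + c) (b + c) n \<theta> = of_real (exp (\<delta> * c)) * \<Psi>\<^sub>S a b n (A c * \<theta>)" for n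
    unfolding \<Psi>\<^sub>S_def grid_shift \<tau>_shift sum_distrib_left
    by (intro sum.cong) (auto simp: A_add scaleR_conv_of_real mult_ac)
  then have "(\<lambda>n. \<Psi>\<^sub>S (a + c) (b + c) n \<theta>) \<longlonglongrightarrow> of_real (exp (\<delta> * c)) * \<Psi> a b (A c * \<theta>)"
    using \<Psi>\<^sub>S_tendsto[OF ab] by (auto intro!: tendsto_intros)
  then show ?thesis using \<Psi>\<^sub>S_tendsto[of "a + c" "b + c" \<theta>] ab LIMSEQ_unique by auto
qed simp

lemma S_indep_terms:
  assumes "a < b" "n > 0"
  shows "indep_vars (\<lambda>_. borel) (\<lambda>m \<omega>. A (grid a b n m) * (Y (grid a b n (Suc m)) \<omega> - Y (grid a b n m) \<omega>)) {..<n}"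
proof -
  have "indep_vars (\<lambda>_. borel) (\<lambda>m \<omega>. L (\<tau> (grid a b n (Suc m))) \<omega> - L (\<tau> (grid a b n m)) \<omega>) {..<n}"
    by (rule L_indep) (simp add: strict_monoD[OF \<tau>_strict_mono] grid_less_Suc[OF assms])
  then have "indep_vars (\<lambda>_. borel) (\<lambda>m \<omega>. (\<lambda>x. A (grid a b n m) * x) (L (\<tau> (grid a b n (Suc m))) \<omega> - L (\<tau> (grid a b n m)) \<omega>)) {..<n}"
    by (rule indep_vars_compose2) auto
  then show ?thesis by (simp add: Y_eq)
qed

lemma char_S:
  assumes "a < b" "n > 0"
  shows "char (distr M borel (S a b n)) \<theta> = exp (\<Psi>\<^sub>S a b n \<theta>)"
proof -
  have "char (distr M borel (S a b n)) \<theta> =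
      (\<Prod>m<n. char (distr M borel (\<lambda>\<omega>. A (grid a b n m) * (Y (grid a b n (Suc m)) \<omega> - Y (grid a b n m) \<omega>))) \<theta>)"
    unfolding S_def[abs_def] by (rule char_distr_sum[OF S_indep_terms[OF assms]])
  also have "\<dots> = (\<Prod>m<n. exp ((\<tau> (grid a b n (Suc m)) - \<tau> (grid a b n m)) *\<^sub>R \<psi> (\<theta> * A (grid a b n m))))"
  proof (rule prod.cong[OF refl])
    fix m
    have "\<tau> (grid a b n m) \<le> \<tau> (grid a b n (Suc m))"
      using strict_monoD[OF \<tau>_strict_mono grid_less_Suc[OF assms]] by (rule less_imp_le)
    then show "char (distr M borel (\<lambda>\<omega>. A (grid a b n m) * (Y (grid a b n (Suc m)) \<omega> - Y (grid a b n m) \<omega>))) \<theta>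
        = exp ((\<tau> (grid a b n (Suc m)) - \<tau> (grid a b n m)) *\<^sub>R \<psi> (\<theta> * A (grid a b n m)))"
      unfolding Y_eq by (subst char_scale) (simp_all add: L_char scaleR_conv_of_real del: of_real_diff)
  qed
  also have "\<dots> = exp (\<Psi>\<^sub>S a b n \<theta>)" unfolding \<Psi>\<^sub>S_def by (simp add: exp_sum)
  finally show ?thesis .
qed

lemma char_I:
  assumes "a \<le> b"
  shows "char (distr M borel (I a b)) \<theta> = exp (\<Psi> a b \<theta>)"
proof (cases "a = b")
  case True
  have "I a a = (\<lambda>_. 0)" by (simp add: fun_eq_iff)
  then show ?thesis using True char_const_zero[OF prob_space_axioms] by simp
next
  case False
  then have ab: "a < b" using assms by simp
  have 1: "(\<lambda>n. char (distr M borel (S a b n)) \<theta>) \<longlonglongrightarrow> char (distr M borel (I a b)) \<theta>"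
    using S_tendsto_I[OF ab] by (intro char_tendsto_of_AE S_meas I_meas assms) auto
  have 2: "(\<lambda>n. exp (\<Psi>\<^sub>S a b n \<theta>)) \<longlonglongrightarrow> exp (\<Psi> a b \<theta>)"
    by (intro tendsto_exp \<Psi>\<^sub>S_tendsto ab)
  have "\<forall>\<^sub>F n in sequentially. exp (\<Psi>\<^sub>S a b n \<theta>) = char (distr M borel (S a b n)) \<theta>"
    using eventually_gt_at_top[of 0] by eventually_elim (simp add: char_S[OF ab])
  from Lim_transform_eventually[OF 2 this] 1 show ?thesis by (rule LIMSEQ_unique[symmetric])
qed

text \<open>The grids of consecutive intervals concatenate to one partition, whose increments are
  independent; division with remainder by \<open>n\<close> recovers interval and position.\<close>

lemma I_indep:
  assumes u: "\<And>j. j < N \<Longrightarrow> u j < u (Suc j)"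
  shows "indep_vars (\<lambda>_. borel) (\<lambda>j. I (u j) (u (Suc j))) {..<N::nat}"
proof (rule indep_vars_AE_limit[where X="\<lambda>n j. S (u j) (u (Suc j)) (Suc n)"])
  fix k
  define n where "n = Suc k"
  have n: "n > 0" by (simp add: n_def)
  define v where "v i = grid (u (i div n)) (u (Suc (i div n))) n (i mod n)" for i
  have v_cell: "v (j * n + m) = grid (u j) (u (Suc j)) n m" if "m < n" for j m
    using that by (simp add: v_def)
  have v_cell': "v (j * n + Suc m) = grid (u j) (u (Suc j)) n (Suc m)" if "m < n" for j m
  proof (cases "Suc m < n")
    case True
    then show ?thesis by (rule v_cell)
  next
    case False
    then have m: "Suc m = n" using that by simp
    have "v (j * n + n) = grid (u (Suc j)) (u (Suc (Suc j))) n 0"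
      using v_cell[of 0 "Suc j"] n by (simp add: add.commute)
    then show ?thesis using m n by simp
  qed
  have "v i < v (Suc i)" if i: "i < N * n" for i
  proof -
    have j: "i div n < N" using i n by (simp add: less_mult_imp_div_less)
    have "v i = grid (u (i div n)) (u (Suc (i div n))) n (i mod n)" by (simp add: v_def)
    moreover have "v (Suc i) = grid (u (i div n)) (u (Suc (i div n))) n (Suc (i mod n))"
      using v_cell'[of "i mod n" "i div n"] n by simp
    ultimately show ?thesis using grid_less_Suc[OF u[OF j] n] by simp
  qed
  then have "indep_vars (\<lambda>_. borel) (\<lambda>i \<omega>. L (\<tau> (v (Suc i))) \<omega> - L (\<tau> (v i)) \<omega>) {..<N * n}"
    by (intro L_indep[of "N * n" "\<lambda>i. \<tau> (v i)"]) (simp add: strict_monoD[OF \<tau>_strict_mono])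
  then have "indep_vars (\<lambda>j. PiM {j * n..<Suc j * n} (\<lambda>_. borel))
      (\<lambda>j \<omega>. restrict (\<lambda>i. L (\<tau> (v (Suc i))) \<omega> - L (\<tau> (v i)) \<omega>) {j * n..<Suc j * n}) {..<N}"
  proof (rule indep_vars_restrict)
    show "{j * n..<Suc j * n} \<subseteq> {..<N * n}" if "j \<in> {..<N}" for j
    proof -
      have "Suc j * n \<le> N * n" using that by (intro mult_right_mono) auto
      then show ?thesis by auto
    qed
    show "disjoint_family_on (\<lambda>j. {j * n..<Suc j * n}) {..<N}"
    proof (unfold disjoint_family_on_def, intro ballI impI)
      fix i j :: nat assume "i \<noteq> j"
      have "x div n = k" if "x \<in> {k * n..<Suc k * n}" for x k
        using that by (intro div_nat_eqI) (auto simp: mult.commute)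
      then show "{i * n..<Suc i * n} \<inter> {j * n..<Suc j * n} = {}" using \<open>i \<noteq> j\<close> by blast
    qed
  qed
  then have "indep_vars (\<lambda>_. borel) (\<lambda>j \<omega>. (\<lambda>x. \<Sum>i\<in>{j * n..<Suc j * n}. A (v i) * x i)
      (restrict (\<lambda>i. L (\<tau> (v (Suc i))) \<omega> - L (\<tau> (v i)) \<omega>) {j * n..<Suc j * n})) {..<N}"
    by (rule indep_vars_compose2)
       (intro borel_measurable_sum borel_measurable_times borel_measurable_const measurable_component_singleton)
  moreover have "(\<Sum>i\<in>{j * n..<Suc j * n}. A (v i) * restrict (\<lambda>i. L (\<tau> (v (Suc i))) \<omega> - L (\<tau> (v i)) \<omega>) {j * n..<Suc j * n} i)
      = S (u j) (u (Suc j)) n \<omega>" for j \<omega>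
  proof -
    have "(\<Sum>i\<in>{j * n..<Suc j * n}. A (v i) * restrict (\<lambda>i. L (\<tau> (v (Suc i))) \<omega> - L (\<tau> (v i)) \<omega>) {j * n..<Suc j * n} i)
      = (\<Sum>i\<in>{0 + j * n..<n + j * n}. A (v i) * (L (\<tau> (v (Suc i))) \<omega> - L (\<tau> (v i)) \<omega>))"
      by (intro sum.cong) auto
    also have "\<dots> = (\<Sum>m\<in>{0..<n}. A (v (m + j * n)) * (L (\<tau> (v (Suc (m + j * n)))) \<omega> - L (\<tau> (v (m + j * n))) \<omega>))"
      by (rule sum.shift_bounds_nat_ivl)
    also have "\<dots> = S (u j) (u (Suc j)) n \<omega>"
      unfolding S_def lessThan_atLeast0
    proof (rule sum.cong[OF refl])
      fix m assume "m \<in> {0..<n}"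
      then have m: "m < n" by simp
      show "A (v (m + j * n)) * (L (\<tau> (v (Suc (m + j * n)))) \<omega> - L (\<tau> (v (m + j * n))) \<omega>) =
        A (grid (u j) (u (Suc j)) n m) * (Y (grid (u j) (u (Suc j)) n (Suc m)) \<omega> - Y (grid (u j) (u (Suc j)) n m) \<omega>)"
        using v_cell[OF m, of j] v_cell'[OF m, of j] by (simp add: Y_eq add.commute)
    qed
    finally show ?thesis .
  qed
  ultimately show "indep_vars (\<lambda>_. borel) (\<lambda>j. S (u j) (u (Suc j)) (Suc k)) {..<N}"
    unfolding n_def by (simp add: fun_eq_iff)
next
  fix j assume "j \<in> {..<N}"
  then have j: "u j < u (Suc j)" using u by simp
  show "I (u j) (u (Suc j)) \<in> borel_measurable M" using j by (intro I_meas) simp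
  have "(\<lambda>n. S (u j) (u (Suc j)) (Suc n) \<omega>) \<longlonglongrightarrow> I (u j) (u (Suc j)) \<omega>" if "\<omega> \<in> space M" for \<omega>
    using S_tendsto_I[OF j that] by (rule filterlim_sequentially_Suc[THEN iffD2])
  then show "AE \<omega> in M. (\<lambda>n. S (u j) (u (Suc j)) (Suc n) \<omega>) \<longlonglongrightarrow> I (u j) (u (Suc j)) \<omega>" by simp
qed

text \<open>Locally \<open>F\<close> differs from \<open>A * Y\<close> by a continuous function, so it has the one-sided limits and the
  continuity points of \<open>Y\<close>.\<close>

lemma F_local_form:
  assumes w: "\<omega> \<in> space M"
  shows "\<exists>c G. isCont G t \<and> eventually (\<lambda>b. F b \<omega> = c + A b * Y b \<omega> - G b) (nhds t)"
proof -
  define a where "a = t - 1"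
  define G where "G b = integral {a..b} (\<lambda>s. deriv A s * Y s \<omega>)" for b
  have "continuous_on {a..t + 1} G"
    unfolding G_def by (intro indefinite_integral_continuous_1 integrand_integrable w)
  then have "isCont G t" by (rule continuous_on_interior) (auto simp: a_def)
  moreover have "eventually (\<lambda>b. F b \<omega> = (F a \<omega> - A a * Y a \<omega>) + A b * Y b \<omega> - G b) (nhds t)"
    using eventually_nhds_in_open[of "{a<..}" t]
  proof (simp add: a_def, elim eventually_mono, goal_cases)
    case (1 b)
    then show ?case using I_eq_F[OF w, of a b] by (simp add: I_def random_integral_def G_def a_def)
  qed
  ultimately show ?thesis by blast
qed

lemma A_isCont: "isCont A t"
  using A_deriv by (rule DERIV_isCont)

lemma rcll_F:
  assumes w: "\<omega> \<in> space M"
  shows "rcll (\<lambda>b. F b \<omega>)"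
  unfolding rcll_def continuous_within
proof
  fix t
  obtain c G where G: "isCont G t" and ev: "eventually (\<lambda>b. F b \<omega> = c + A b * Y b \<omega> - G b) (nhds t)"
    using F_local_form[OF w] by blast
  have Gl: "(G \<longlongrightarrow> G t) (at t within B)" "(A \<longlongrightarrow> A t) (at t within B)" for B
    using G A_isCont unfolding isCont_def by (auto intro: tendsto_within_subset[where S=UNIV])
  have evt: "eventually (\<lambda>b. c + A b * Y b \<omega> - G b = F b \<omega>) (at t within B)" for B
    using ev unfolding eventually_at_filter by eventually_elim simp
  have Ft: "F t \<omega> = c + A t * Y t \<omega> - G t" using ev by (rule eventually_nhds_x_imp_x)
  obtain l where r: "((\<lambda>s. Y s \<omega>) \<longlongrightarrow> Y t \<omega>) (at_right t)" and l: "((\<lambda>s. Y s \<omega>) \<longlongrightarrow> l) (at_left t)"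
    using rcll_Y[OF w] unfolding rcll_def continuous_within by blast
  have "((\<lambda>b. c + A b * Y b \<omega> - G b) \<longlongrightarrow> F t \<omega>) (at_right t)"
    unfolding Ft by (intro tendsto_intros Gl r)
  then have 1: "((\<lambda>b. F b \<omega>) \<longlongrightarrow> F t \<omega>) (at_right t)" using evt by (rule Lim_transform_eventually)
  have "((\<lambda>b. c + A b * Y b \<omega> - G b) \<longlongrightarrow> c + A t * l - G t) (at_left t)"
    by (intro tendsto_intros Gl l)
  then have 2: "((\<lambda>b. F b \<omega>) \<longlongrightarrow> c + A t * l - G t) (at_left t)" using evt by (rule Lim_transform_eventually)
  show "((\<lambda>b. F b \<omega>) \<longlongrightarrow> F t \<omega>) (at_right t) \<and> (\<exists>l. ((\<lambda>b. F b \<omega>) \<longlongrightarrow> l) (at_left t))"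
    using 1 2 by blast
qed

lemma F_isCont: "AE \<omega> in M. isCont (\<lambda>b. F b \<omega>) t"
  using Y_cont[of t] AE_space
proof eventually_elim
  case (elim \<omega>)
  obtain c G where G: "isCont G t" and ev: "eventually (\<lambda>b. F b \<omega> = c + A b * Y b \<omega> - G b) (nhds t)"
    using F_local_form[OF elim(2)] by blast
  have "isCont (\<lambda>b. c + A b * Y b \<omega> - G b) t"
    by (intro continuous_intros G A_isCont elim(1))
  then show ?case using isCont_cong[OF ev] by simp
qed

end

section \<open>Convergence of the integrals at minus infinity\<close>

lemma Cauchy_at_bot_imp_limit:
  fixes f :: "real \<Rightarrow> real"
  assumes "\<And>e. e > 0 \<Longrightarrow> \<exists>c. \<forall>a\<le>c. \<bar>f a - f c\<bar> \<le> e"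
  shows "\<exists>l. (f \<longlongrightarrow> l) at_bot"
proof -
  have 2: "\<exists>c. \<forall>a\<le>c. \<forall>b\<le>c. \<bar>f a - f b\<bar> < e" if e: "e > 0" for e
  proof -
    obtain c where c: "\<forall>a\<le>c. \<bar>f a - f c\<bar> \<le> e/3" using assms[of "e/3"] e by auto
    have "\<bar>f a - f b\<bar> < e" if "a \<le> c" "b \<le> c" for a b
      using c[rule_format, OF that(1)] c[rule_format, OF that(2)] e by linarith
    then show ?thesis by blast
  qed
  have seq: "\<exists>n0. \<forall>n\<ge>n0. - real n \<le> c" for c
  proof -
    obtain n0 :: nat where "- c \<le> real n0" using real_arch_simple by blast
    then show ?thesis by (intro exI[of _ n0]) auto
  qed
  have "Cauchy (\<lambda>n. f (- real n))"
  proof (rule metric_CauchyI)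
    fix e :: real assume "e > 0"
    then obtain c where c: "\<forall>a\<le>c. \<forall>b\<le>c. \<bar>f a - f b\<bar> < e" using 2 by blast
    obtain n0 where "\<forall>n\<ge>n0. - real n \<le> c" using seq by blast
    then show "\<exists>n0. \<forall>m\<ge>n0. \<forall>n\<ge>n0. dist (f (- real m)) (f (- real n)) < e"
      using c by (intro exI[of _ n0]) (auto simp: dist_real_def)
  qed
  then obtain l where l: "(\<lambda>n. f (- real n)) \<longlonglongrightarrow> l"
    using real_Cauchy_convergent convergent_def by blast
  have "(f \<longlongrightarrow> l) at_bot"
  proof (rule tendstoI)
    fix e :: real assume e: "e > 0"
    obtain c where c: "\<forall>a\<le>c. \<forall>b\<le>c. \<bar>f a - f b\<bar> < e/2" using 2[of "e/2"] e by auto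
    obtain n0 where n0: "\<forall>n\<ge>n0. - real n \<le> c" using seq by blast
    obtain n1 where n1: "\<forall>n\<ge>n1. \<bar>f (- real n) - l\<bar> < e/2"
      using LIMSEQ_D[OF l, of "e/2"] e by auto
    define n where "n = max n0 n1"
    have "\<bar>f a - l\<bar> < e" if "a \<le> c" for a
    proof -
      have "- real n \<le> c" using n0 by (auto simp: n_def)
      then have "\<bar>f a - f (- real n)\<bar> < e/2" using c that by blast
      moreover have "\<bar>f (- real n) - l\<bar> < e/2" using n1 by (auto simp: n_def)
      ultimately show ?thesis by linarith
    qed
    then show "\<forall>\<^sub>F a in at_bot. dist (f a) l < e"
      unfolding eventually_at_bot_linorder dist_real_def by blast
  qed
  then show ?thesis by blast
qed

lemma dyadic_point_between:
  fixes a b s e :: real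
  assumes ab: "a < b" and s: "a \<le> s" "s < e" "e \<le> b"
  shows "\<exists>N j. j \<le> 2 ^ N \<and> s < grid b a (2 ^ N) j \<and> grid b a (2 ^ N) j < e"
proof -
  obtain N :: nat where N: "(b - a) / (e - s) < 2 ^ N"
    using real_arch_pow[of 2 "(b - a) / (e - s)"] by auto
  define x where "x = (b - s) / (b - a) * 2 ^ N"
  have x0: "x > 0" using ab s by (simp add: x_def)
  have x1: "x \<le> 2 ^ N" using ab s by (simp add: x_def field_simps)
  define j where "j = nat (\<lceil>x\<rceil> - 1)"
  have j: "real j = real_of_int (\<lceil>x\<rceil> - 1)" using x0 unfolding j_def by (simp add: ceiling_le_zero not_le)
  have jx: "real j < x" "x - 1 \<le> real j" unfolding j by linarith+
  have g: "grid b a (2 ^ N) j = b - (b - a) / 2 ^ N * real j" by (simp add: grid_def field_simps)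
  have p: "(b - a) / 2 ^ N > 0" using ab by simp
  have xs: "(b - a) / 2 ^ N * x = b - s" using ab by (simp add: x_def)
  have "(b - a) / 2 ^ N * real j < b - s" using mult_strict_left_mono[OF jx(1) p] xs by simp
  then have 1: "s < grid b a (2 ^ N) j" unfolding g by linarith
  have "(b - a) / 2 ^ N * (x - 1) \<le> (b - a) / 2 ^ N * real j" using p by (intro mult_left_mono[OF jx(2)]) simp
  then have "b - s - (b - a) / 2 ^ N \<le> (b - a) / 2 ^ N * real j" using xs by (simp add: right_diff_distrib)
  moreover have "(b - a) / 2 ^ N < e - s" using N s by (simp add: field_simps)
  ultimately have 2: "grid b a (2 ^ N) j < e" unfolding g by linarith
  have "real j \<le> 2 ^ N" using jx x1 by linarith
  then have "j \<le> 2 ^ N" by (metis of_nat_le_iff of_nat_numeral of_nat_power)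
  with 1 2 show ?thesis by blast
qed

context exp_integral
begin

text \<open>The clock maps the negative half-line into a bounded interval, on which the path is bounded; every
  term of the integration by parts is then controlled by \<open>A c\<close>, which tends to 0.\<close>

lemma pathwise_limit_of_bounded_clock:
  assumes \<delta>: "\<delta> > 0" and w: "\<omega> \<in> space M"
  shows "\<exists>l. ((\<lambda>a. I a 0 \<omega>) \<longlongrightarrow> l) at_bot"
proof (rule Cauchy_at_bot_imp_limit)
  fix e :: real assume e: "e > 0"
  obtain B where B: "\<forall>t\<in>{- 1 / (exp \<delta> - 1)..0}. \<bar>L t \<omega>\<bar> \<le> B"
    using rcll_locally_bounded[OF L_rcll[OF w]] by blast
  have YB: "\<bar>Y t \<omega>\<bar> \<le> B" if "t \<le> 0" for t
  proof -
    have "exp \<delta> - 1 > 0" using \<delta> by simp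
    moreover have "exp (\<delta> * t) \<le> 1" using \<delta> that by (simp add: mult_nonneg_nonpos)
    ultimately have "\<tau> t \<in> {- 1 / (exp \<delta> - 1)..0}"
      unfolding \<tau>_def atLeastAtMost_iff by (intro conjI divide_right_mono divide_nonpos_pos) auto
    then show ?thesis using B by (simp add: Y_eq)
  qed
  have B0: "B \<ge> 0" using YB[of 0] by auto
  have "((\<lambda>c. 3 * B * A c) \<longlongrightarrow> 3 * B * 0) at_bot"
    unfolding A_def using \<kappa>_pos
    by (intro tendsto_intros filterlim_compose[OF exp_at_bot]
        filterlim_tendsto_pos_mult_at_bot[OF tendsto_const, of \<kappa>, simplified mult.commute[of \<kappa>]])
       (auto intro: filterlim_ident)
  then have "eventually (\<lambda>c. 3 * B * A c < e) at_bot" using e by (intro order_tendstoD) auto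
  then have "eventually (\<lambda>c. 3 * B * A c < e \<and> c \<le> 0) at_bot"
    using eventually_le_at_bot[of 0] by eventually_elim simp
  then obtain c where c: "3 * B * A c < e" "c \<le> 0"
    using eventually_happens'[OF trivial_limit_at_bot_linorder] by fast
  have "\<bar>I a 0 \<omega> - I c 0 \<omega>\<bar> \<le> e" if a: "a \<le> c" for a
  proof -
    have "I a 0 \<omega> - I c 0 \<omega> = I a c \<omega>" using I_add[OF w a c(2)] by simp
    also have "\<dots> = A c * Y c \<omega> - A a * Y a \<omega> - integral {a..c} (\<lambda>t. deriv A t * Y t \<omega>)"
      by (simp add: I_def random_integral_def)
    finally have eq: "I a 0 \<omega> - I c 0 \<omega> = A c * Y c \<omega> - A a * Y a \<omega> - integral {a..c} (\<lambda>t. deriv A t * Y t \<omega>)" .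
    have Ac: "A a \<le> A c" using a \<kappa>_pos by (simp add: A_def)
    have 1: "\<bar>A c * Y c \<omega>\<bar> \<le> A c * B"
      unfolding abs_mult using YB[OF c(2)] A_pos[of c] by (simp add: mult_left_mono)
    have "\<bar>A a * Y a \<omega>\<bar> \<le> A a * B"
      unfolding abs_mult using YB[of a] a c A_pos[of a] by (simp add: mult_left_mono)
    then have 2: "\<bar>A a * Y a \<omega>\<bar> \<le> A a * B" .
    have hA: "((\<lambda>t. \<kappa> * A t) has_integral A c - A a) {a..c}"
      using A_deriv a by (intro fundamental_theorem_of_calculus)
        (auto simp: has_real_derivative_iff_has_vector_derivative[symmetric] intro: has_field_derivative_at_within)
    have "norm (integral {a..c} (\<lambda>t. deriv A t * Y t \<omega>)) \<le> integral {a..c} (\<lambda>t. B * (\<kappa> * A t))"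
    proof (rule integral_norm_bound_integral[OF integrand_integrable[OF w]])
      show "(\<lambda>t. B * (\<kappa> * A t)) integrable_on {a..c}"
        by (rule has_integral_integrable[OF has_integral_mult_right[OF hA]])
      fix t assume "t \<in> {a..c}"
      then have "\<bar>Y t \<omega>\<bar> \<le> B" using c by (intro YB) auto
      then show "norm (deriv A t * Y t \<omega>) \<le> B * (\<kappa> * A t)"
        using \<kappa>_pos A_pos[of t] unfolding deriv_A by (simp add: abs_mult mult.commute mult_left_mono)
    qed
    also have "integral {a..c} (\<lambda>t. B * (\<kappa> * A t)) = B * (A c - A a)"
      by (rule integral_unique[OF has_integral_mult_right[OF hA]])
    finally have 3: "\<bar>integral {a..c} (\<lambda>t. deriv A t * Y t \<omega>)\<bar> \<le> B * (A c - A a)" by simp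
    have "\<bar>I a 0 \<omega> - I c 0 \<omega>\<bar> \<le> A c * B + A a * B + B * (A c - A a)"
      unfolding eq using 1 2 3 by linarith
    also have "\<dots> = 2 * B * A c" by (simp add: algebra_simps)
    also have "\<dots> \<le> 3 * B * A c" using B0 A_pos[of c] by (simp add: mult_right_mono)
    finally show ?thesis using c by linarith
  qed
  then show "\<exists>c. \<forall>a\<le>c. \<bar>I a 0 \<omega> - I c 0 \<omega>\<bar> \<le> e" by blast
qed

text \<open>Along dyadic points of \<open>[a, b]\<close>, taken backwards from \<open>b\<close>, the integrals \<open>I s b\<close> are partial
  sums of independent terms; right-continuity carries the maximal inequality to all \<open>s\<close>.\<close>

lemma maximal_inequality:
  assumes ab: "a < b" and l: "0 \<le> l"
    and p: "\<And>s. s \<in> {a..b} \<Longrightarrow> prob {\<omega>\<in>space M. \<bar>I s b \<omega>\<bar> > l} \<le> p"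
  shows "\<exists>E\<in>events. prob E \<le> 3 * p \<and> {\<omega>\<in>space M. \<exists>s\<in>{a..b}. \<bar>I s b \<omega>\<bar> > 3 * l} \<subseteq> E"
proof -
  define E where "E N = {\<omega>\<in>space M. \<exists>j\<le>2 ^ N. \<bar>I (grid b a (2 ^ N) j) b \<omega>\<bar> > 3 * l}" for N :: nat
  have gdec: "grid b a (2 ^ N) (Suc j) < grid b a (2 ^ N) j" for N j
    using ab by (simp add: grid_def divide_strict_right_mono)
  have gin: "grid b a (2 ^ N) j \<in> {a..b}" if "j \<le> 2 ^ N" for N j
  proof -
    have "real j \<le> 2 ^ N" using that by (metis of_nat_le_iff of_nat_numeral of_nat_power)
    then have "real j / 2 ^ N \<le> 1" by (simp add: divide_le_eq_1)
    then have 1: "(b - a) * (real j / 2 ^ N) \<le> (b - a) * 1" using ab by (intro mult_left_mono) auto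
    have 2: "0 \<le> (b - a) * (real j / 2 ^ N)" using ab by simp
    have 3: "grid b a (2 ^ N) j = b - (b - a) * (real j / 2 ^ N)"
      by (simp add: grid_def left_diff_distrib diff_divide_distrib)
    show ?thesis unfolding 3 using 1 2 by simp
  qed
  have Im: "I (grid b a (2 ^ N) j) b \<in> borel_measurable M" if "j \<le> 2 ^ N" for N j
    using gin[OF that] by (intro I_meas) auto
  have Em: "E N \<in> events" for N
  proof -
    have "E N = (\<Union>j\<in>{..2 ^ N}. {\<omega>\<in>space M. \<bar>I (grid b a (2 ^ N) j) b \<omega>\<bar> > 3 * l})"
      by (auto simp: E_def)
    also have "\<dots> \<in> events"
      using Im by (intro sets.finite_UN) (auto intro!: borel_measurable_less borel_measurable_abs)
    finally show ?thesis .
  qed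
  have EP: "prob (E N) \<le> 3 * p" for N
  proof -
    define n :: nat where "n = 2 ^ N"
    define D where "D i \<omega> = I (grid b a n (Suc i)) (grid b a n i) \<omega>" for i \<omega>
    have sum: "(\<Sum>i<j. D i \<omega>) = I (grid b a n j) b \<omega>" if "\<omega> \<in> space M" for j \<omega>
    proof (induction j)
      case 0 then show ?case by simp
    next
      case (Suc j)
      have "grid b a n j \<le> b" using ab by (simp add: grid_def mult_nonpos_nonneg divide_nonpos_nonneg)
      then show ?case using Suc I_add[OF that, of "grid b a n (Suc j)" "grid b a n j" b] gdec[of N j]
        by (simp add: D_def n_def)
    qed
    have "indep_vars (\<lambda>_. borel) (\<lambda>j. I (grid b a n (n - j)) (grid b a n (n - Suc j))) {..<n}"
    proof (rule I_indep)
      fix j assume "j < n"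
      then have "n - j = Suc (n - Suc j)" by simp
      then show "grid b a n (n - j) < grid b a n (n - Suc j)" using gdec unfolding n_def by simp
    qed
    moreover have "inj_on (\<lambda>i. n - Suc i) {..<n}" "(\<lambda>i. n - Suc i) ` {..<n} \<subseteq> {..<n}"
      by (auto simp: inj_on_def)
    ultimately have "indep_vars (\<lambda>_. borel)
        (\<lambda>j. I (grid b a n (n - (n - Suc j))) (grid b a n (n - Suc (n - Suc j)))) {..<n}"
      by (rule indep_vars_reindex[where f="\<lambda>i. n - Suc i"])
    then have ind: "indep_vars (\<lambda>_. borel) D {..<n}"
      by (rule indep_vars_cong[THEN iffD1, rotated 3]) (auto simp: D_def fun_eq_iff)
    have "prob {\<omega>\<in>space M. \<exists>j\<le>n. \<bar>\<Sum>i<j. D i \<omega>\<bar> > 3 * l} \<le> 3 * p"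
    proof (rule etemadi_inequality[OF ind])
      fix j assume "j \<le> n"
      then have "grid b a n j \<in> {a..b}" unfolding n_def by (rule gin)
      moreover have "{\<omega>\<in>space M. \<bar>\<Sum>i<j. D i \<omega>\<bar> > l} = {\<omega>\<in>space M. \<bar>I (grid b a n j) b \<omega>\<bar> > l}"
        using sum by auto
      ultimately show "prob {\<omega>\<in>space M. \<bar>\<Sum>i<j. D i \<omega>\<bar> > l} \<le> p" using p by simp
    qed
    also have "{\<omega>\<in>space M. \<exists>j\<le>n. \<bar>\<Sum>i<j. D i \<omega>\<bar> > 3 * l} = E N"
      using sum by (auto simp: E_def n_def)
    finally show ?thesis .
  qed
  have inc: "incseq E"
  proof (rule incseq_SucI, rule subsetI)
    fix N \<omega> assume "\<omega> \<in> E N"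
    then obtain j where j: "\<omega> \<in> space M" "j \<le> 2 ^ N" "\<bar>I (grid b a (2 ^ N) j) b \<omega>\<bar> > 3 * l"
      by (auto simp: E_def)
    have "grid b a (2 ^ Suc N) (2 * j) = grid b a (2 ^ N) j" by (simp add: grid_def)
    then show "\<omega> \<in> E (Suc N)"
      using j unfolding E_def by (intro CollectI conjI exI[of _ "2 * j"]) auto
  qed
  have "(\<lambda>N. prob (E N)) \<longlonglongrightarrow> prob (\<Union>N. E N)"
    using Em inc by (intro finite_Lim_measure_incseq) auto
  then have "prob (\<Union>N. E N) \<le> 3 * p"
    using EP by (intro LIMSEQ_le_const2) auto
  moreover have "{\<omega>\<in>space M. \<exists>s\<in>{a..b}. \<bar>I s b \<omega>\<bar> > 3 * l} \<subseteq> (\<Union>N. E N)"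
  proof safe
    fix \<omega> s assume w: "\<omega> \<in> space M" and s: "s \<in> {a..b}" "\<bar>I s b \<omega>\<bar> > 3 * l"
    have "s \<noteq> b" using s l by auto
    then have sb: "s < b" using s by auto
    have "((\<lambda>v. F v \<omega>) \<longlongrightarrow> F s \<omega>) (at_right s)"
      using rcll_F[OF w] unfolding rcll_def continuous_within by blast
    then have "((\<lambda>v. \<bar>F b \<omega> - F v \<omega>\<bar>) \<longlongrightarrow> \<bar>F b \<omega> - F s \<omega>\<bar>) (at_right s)"
      by (intro tendsto_intros)
    moreover have "\<bar>F b \<omega> - F s \<omega>\<bar> > 3 * l" using s I_eq_F[OF w] by auto
    ultimately have "eventually (\<lambda>v. \<bar>F b \<omega> - F v \<omega>\<bar> > 3 * l) (at_right s)"
      by (rule order_tendstoD)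
    then obtain d where d: "d > s" "\<And>v. s < v \<Longrightarrow> v < d \<Longrightarrow> \<bar>F b \<omega> - F v \<omega>\<bar> > 3 * l"
      unfolding eventually_at_right_field by auto
    obtain N j where Nj: "j \<le> 2 ^ N" "s < grid b a (2 ^ N) j" "grid b a (2 ^ N) j < min d b"
      using dyadic_point_between[OF ab, of s "min d b"] s d sb by auto
    then have "\<bar>I (grid b a (2 ^ N) j) b \<omega>\<bar> > 3 * l"
      using d(2)[of "grid b a (2 ^ N) j"] I_eq_F[OF w, of "grid b a (2 ^ N) j" b] by auto
    then show "\<omega> \<in> (\<Union>N. E N)" using Nj w by (auto simp: E_def)
  qed
  moreover have "(\<Union>N. E N) \<in> events" using Em by auto
  ultimately show ?thesis by blast
qed

text \<open>Translating by \<open>c\<close> with \<open>exp (\<delta> * c) = n\<close> turns the integral into a scaled sum of \<open>n\<close>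
  independent copies, so a union bound applies.\<close>

lemma translated_tail_bound:
  assumes s: "s \<le> 0" and c: "exp (\<delta> * c) = real n" and n: "n > 0"
  shows "prob {\<omega>\<in>space M. \<bar>I (s + c) c \<omega>\<bar> > l} \<le> real n * prob {\<omega>\<in>space M. \<bar>I s 0 \<omega>\<bar> > l / (real n * A c)}"
proof -
  have sc: "s + c \<le> c" using s by simp
  note [measurable] = I_meas[OF sc] I_meas[OF s]
  have "char (distr M borel (I (s + c) c)) \<theta> = char (distr M borel (\<lambda>\<omega>. A c * I s 0 \<omega>)) \<theta> ^ n" for \<theta>
    using \<Psi>_shift[OF s, of c \<theta>] s c by (simp add: char_I sc char_scale exp_of_nat_mult mult.commute)
  then have "measure (distr M borel (I (s + c) c)) {x. \<bar>x\<bar> > l} \<le>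
      real n * measure (distr M borel (\<lambda>\<omega>. A c * I s 0 \<omega>)) {x. \<bar>x\<bar> > l / real n}"
    by (intro char_power_tail_bound real_distribution_law n) auto
  also have "measure (distr M borel (I (s + c) c)) {x. \<bar>x\<bar> > l} = prob {\<omega>\<in>space M. \<bar>I (s + c) c \<omega>\<bar> > l}"
    by (subst measure_distr) (auto intro!: arg_cong[where f=prob])
  also have "measure (distr M borel (\<lambda>\<omega>. A c * I s 0 \<omega>)) {x. \<bar>x\<bar> > l / real n}
      = prob {\<omega>\<in>space M. \<bar>I s 0 \<omega>\<bar> > l / (real n * A c)}"
    using A_pos[of c] n
    by (subst measure_distr) (auto intro!: arg_cong[where f=prob] simp: abs_mult field_simps)
  finally show ?thesis .
qed

lemma markov_tail_bound:
  assumes s: "s \<le> 0" and \<gamma>: "\<gamma> > 0" and x: "x > 0" and C0: "C \<ge> 0"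
    and C: "(\<integral>\<^sup>+\<omega>. ennreal (\<bar>I s 0 \<omega>\<bar> powr \<gamma>) \<partial>M) \<le> ennreal C"
  shows "prob {\<omega>\<in>space M. \<bar>I s 0 \<omega>\<bar> > x} \<le> C * x powr (- \<gamma>)"
proof -
  note [measurable] = I_meas[OF s]
  let ?E = "{\<omega>\<in>space M. \<bar>I s 0 \<omega>\<bar> > x}"
  have E: "?E \<in> events" by measurable
  have "ennreal (x powr \<gamma>) * emeasure M ?E = (\<integral>\<^sup>+\<omega>. ennreal (x powr \<gamma>) * indicator ?E \<omega> \<partial>M)"
    using E by (simp add: nn_integral_cmult_indicator)
  also have "\<dots> \<le> (\<integral>\<^sup>+\<omega>. ennreal (\<bar>I s 0 \<omega>\<bar> powr \<gamma>) \<partial>M)"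
    using x \<gamma> by (intro nn_integral_mono) (auto simp: indicator_def intro!: ennreal_leI powr_mono2)
  also have "\<dots> \<le> ennreal C" by (rule C)
  finally have "ennreal (x powr \<gamma> * prob ?E) \<le> ennreal C"
    by (simp add: emeasure_eq_measure ennreal_mult)
  then have "x powr \<gamma> * prob ?E \<le> C" using C0 by simp
  then have "prob ?E \<le> C / x powr \<gamma>" using x by (simp add: field_simps)
  then show ?thesis by (simp add: powr_minus divide_inverse)
qed

text \<open>With \<open>exp (\<delta> * s k) = 2 ^ k\<close>, the integrals over \<open>{u..s k}\<close> for \<open>u\<close> in the \<open>k\<close>-th block exceed \<open>q ^ k\<close>
  with probability at most \<open>C * r ^ k\<close>. Both ratios are below 1: the levels are summable, so the
  integrals form a Cauchy family once no later block exceeds its level.\<close>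

lemma AE_limit_of_block_moments:
  assumes \<delta>: "\<delta> < 0" and \<gamma>: "\<gamma> * (\<kappa> + \<delta>) > - \<delta>" and \<kappa>\<delta>: "\<kappa> + \<delta> > 0"
    and fin: "(SUP s\<in>{1/\<delta> * ln 2..0}. \<integral>\<^sup>+\<omega>. ennreal (\<bar>I s 0 \<omega>\<bar> powr \<gamma>) \<partial>M) < \<infinity>"
  shows "AE \<omega> in M. \<exists>l. ((\<lambda>a. I a 0 \<omega>) \<longlongrightarrow> l) at_bot"
proof -
  have \<gamma>0: "\<gamma> > 0"
  proof -
    have "\<gamma> * (\<kappa> + \<delta>) > 0" using \<gamma> \<delta> by linarith
    then show ?thesis using \<kappa>\<delta> by (simp add: zero_less_mult_iff)
  qed
  define s where "s k = real k * ln 2 / \<delta>" for k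
  have s_Suc: "s (Suc k) = s 1 + s k" for k by (simp add: s_def add_divide_distrib distrib_right)
  have s1: "s 1 < 0" using \<delta> by (simp add: s_def divide_pos_neg)
  have s0: "s 0 = 0" by (simp add: s_def)
  have s_le: "s k \<le> 0" for k using \<delta> by (simp add: s_def divide_nonneg_neg)
  have s_dec: "s (Suc k) < s k" for k using s1 s_Suc[of k] by simp
  have mono: "s (K + m) \<le> s K" for K m
    using s_le[of m] by (simp add: s_def add_divide_distrib distrib_right)
  have exp_s: "exp (\<delta> * s k) = real (2 ^ k)" for k
  proof -
    have "\<delta> * s k = real k * ln 2" using \<delta> by (simp add: s_def)
    then show ?thesis by (simp add: exp_of_nat_mult)
  qed
  obtain C where C0: "C \<ge> 0" and C: "\<And>u. u \<in> {s 1..0} \<Longrightarrow> (\<integral>\<^sup>+\<omega>. ennreal (\<bar>I u 0 \<omega>\<bar> powr \<gamma>) \<partial>M) \<le> ennreal C"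
  proof -
    let ?S = "SUP s\<in>{1/\<delta> * ln 2..0}. \<integral>\<^sup>+\<omega>. ennreal (\<bar>I s 0 \<omega>\<bar> powr \<gamma>) \<partial>M"
    have "(\<integral>\<^sup>+\<omega>. ennreal (\<bar>I u 0 \<omega>\<bar> powr \<gamma>) \<partial>M) \<le> ennreal (enn2real ?S)" if "u \<in> {s 1..0}" for u
    proof -
      have "(\<integral>\<^sup>+\<omega>. ennreal (\<bar>I u 0 \<omega>\<bar> powr \<gamma>) \<partial>M) \<le> ?S"
        using that by (intro SUP_upper) (auto simp: s_def)
      also have "?S = ennreal (enn2real ?S)" using fin by (simp add: less_top)
      finally show ?thesis .
    qed
    then show ?thesis using that[of "enn2real ?S"] by simp
  qed
  \<comment> \<open>\<open>h\<close> is chosen so that \<open>2 ^ k * A (s k) = exp (- (k * h))\<close>: a level \<open>x\<close> for a block integral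
    becomes the level \<open>x * exp (k * h)\<close> for one copy.\<close>
  define h where "h = - ln 2 * (\<kappa> + \<delta>) / \<delta>"
  have \<gamma>h: "\<gamma> * h > ln 2"
  proof -
    have "\<gamma> * (\<kappa> + \<delta>) / (- \<delta>) > 1" using \<gamma> \<delta> by (simp add: field_simps)
    then have "ln 2 * (\<gamma> * (\<kappa> + \<delta>) / (- \<delta>)) > ln 2 * 1" by (intro mult_strict_left_mono) auto
    moreover have "\<gamma> * h = ln 2 * (\<gamma> * (\<kappa> + \<delta>) / (- \<delta>))" by (simp add: h_def mult_ac)
    ultimately show ?thesis by simp
  qed
  \<comment> \<open>Any \<open>\<eta>\<close> strictly between 0 and \<open>h - ln 2 / \<gamma>\<close> would do; the upper bound gives \<open>r < 1\<close>, the lower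
    one \<open>q < 1\<close>.\<close>
  define \<eta> where "\<eta> = (h - ln 2 / \<gamma>) / 2"
  have \<eta>: "\<eta> > 0" using \<gamma>h \<gamma>0 by (simp add: \<eta>_def field_simps)
  have "\<gamma> * (h - \<eta>) = (\<gamma> * h + ln 2) / 2" using \<gamma>0 by (simp add: \<eta>_def field_simps)
  then have \<gamma>\<eta>: "\<gamma> * (h - \<eta>) > ln 2" using \<gamma>h by simp
  have As: "1 / (real (2 ^ k) * A (s k)) = exp (real k * h)" for k
  proof -
    have "real (2 ^ k) * A (s k) = exp (\<delta> * s k + s k * \<kappa>)" unfolding exp_s[symmetric] A_def by (simp add: exp_add)
    also have "\<delta> * s k + s k * \<kappa> = - (real k * h)"
      using \<delta> by (simp add: s_def h_def field_simps)
    finally have "real (2 ^ k) * A (s k) = exp (- (real k * h))" .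
    then show ?thesis by (simp only:) (simp add: exp_minus inverse_eq_divide)
  qed
  define r where "r = exp (ln 2 - \<gamma> * (h - \<eta>))"
  have r: "0 < r" "r < 1" using \<gamma>\<eta> by (auto simp: r_def)
  define q where "q = exp (- \<eta>)"
  have q: "0 < q" "q < 1" using \<eta> by (auto simp: q_def)
  have block: "\<exists>E\<in>events. prob E \<le> 3 * (C * r ^ k) \<and>
      {\<omega>\<in>space M. \<exists>u\<in>{s (Suc k)..s k}. \<bar>I u (s k) \<omega>\<bar> > 3 * q ^ k} \<subseteq> E" for k
  proof (rule maximal_inequality[OF s_dec])
    fix u assume u: "u \<in> {s (Suc k)..s k}"
    define v where "v = u - s k"
    have v: "v \<in> {s 1..0}" "u = v + s k" using u s_Suc[of k] by (auto simp: v_def)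
    have "prob {\<omega>\<in>space M. \<bar>I (v + s k) (s k) \<omega>\<bar> > q ^ k} \<le>
        real (2 ^ k) * prob {\<omega>\<in>space M. \<bar>I v 0 \<omega>\<bar> > q ^ k / (real (2 ^ k) * A (s k))}"
      using v by (intro translated_tail_bound exp_s) auto
    also have "q ^ k / (real (2 ^ k) * A (s k)) = exp (real k * (h - \<eta>))"
    proof -
      have "q ^ k / (real (2 ^ k) * A (s k)) = q ^ k * (1 / (real (2 ^ k) * A (s k)))" by simp
      also have "\<dots> = exp (- (real k * \<eta>)) * exp (real k * h)"
      proof -
        have "q ^ k = exp (real k * (- \<eta>))" unfolding q_def by (rule exp_of_nat_mult[symmetric])
        then show ?thesis unfolding As by simp
      qed
      also have "\<dots> = exp (real k * (h - \<eta>))" by (simp add: exp_add[symmetric] algebra_simps)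
      finally show ?thesis .
    qed
    also have "real (2 ^ k) * prob {\<omega>\<in>space M. \<bar>I v 0 \<omega>\<bar> > exp (real k * (h - \<eta>))} \<le>
        real (2 ^ k) * (C * exp (real k * (h - \<eta>)) powr (- \<gamma>))"
      using v by (intro mult_left_mono markov_tail_bound[OF _ \<gamma>0 _ C0 C[OF v(1)]]) auto
    also have "\<dots> = C * r ^ k"
    proof -
      have "r ^ k = exp (real k * (ln 2 - \<gamma> * (h - \<eta>)))"
        unfolding r_def by (rule exp_of_nat_mult[symmetric])
      also have "real k * (ln 2 - \<gamma> * (h - \<eta>)) = \<delta> * s k + (- \<gamma>) * (real k * (h - \<eta>))"
        using \<delta> by (simp add: s_def algebra_simps)
      also have "exp \<dots> = real (2 ^ k) * exp (real k * (h - \<eta>)) powr (- \<gamma>)"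
        unfolding exp_add exp_s powr_def by simp
      finally show ?thesis by simp
    qed
    finally show "prob {\<omega>\<in>space M. \<bar>I u (s k) \<omega>\<bar> > q ^ k} \<le> C * r ^ k" using v by simp
  qed (use q in auto)
  let ?X = "\<lambda>k. {\<omega>\<in>space M. \<exists>u\<in>{s (Suc k)..s k}. \<bar>I u (s k) \<omega>\<bar> > 3 * q ^ k}"
  have "\<forall>k. \<exists>E. E \<in> events \<and> prob E \<le> 3 * (C * r ^ k) \<and> ?X k \<subseteq> E"
    using block by blast
  from choice[OF this] obtain E where E: "\<And>k. E k \<in> events" "\<And>k. prob (E k) \<le> 3 * (C * r ^ k)"
    "\<And>k. ?X k \<subseteq> E k" by blast
  have "AE \<omega> in M. eventually (\<lambda>k. \<omega> \<in> space M - E k) sequentially"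
  proof (rule borel_cantelli_AE1)
    have "summable (\<lambda>k. 3 * (C * r ^ k))" using r by (intro summable_mult summable_geometric) simp
    then show "summable (\<lambda>k. prob (E k))"
      by (rule summable_comparison_test'[where N=0]) (simp add: E(2))
    show "emeasure M (E k) < \<infinity>" for k by (simp add: less_top[symmetric])
  qed (rule E(1))
  then show ?thesis using AE_space
  proof eventually_elim
    case (elim \<omega>)
    then obtain K0 where K0: "\<And>k. k \<ge> K0 \<Longrightarrow> \<omega> \<notin> E k"
      unfolding eventually_sequentially by blast
    have small: "\<bar>I u (s k) \<omega>\<bar> \<le> 3 * q ^ k" if "k \<ge> K0" "u \<in> {s (Suc k)..s k}" for k u
    proof (rule ccontr)
      assume "\<not> \<bar>I u (s k) \<omega>\<bar> \<le> 3 * q ^ k"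
      then have "\<omega> \<in> ?X k" using that(2) elim(2) by (intro CollectI conjI bexI[of _ u]) auto
      then show False using E(3)[of k] K0[OF that(1)] by blast
    qed
    have sum: "\<forall>a\<in>{s (K + m)..s K}. \<bar>I a (s K) \<omega>\<bar> \<le> 3 * (\<Sum>i<m. q ^ (K + i))" if "K \<ge> K0" for K m
    proof (induction m)
      case 0
      then show ?case by simp
    next
      case (Suc m)
      show ?case
      proof
        fix a assume a0: "a \<in> {s (K + Suc m)..s K}"
        have q0: "0 \<le> q ^ (K + m)" using q by simp
        show "\<bar>I a (s K) \<omega>\<bar> \<le> 3 * (\<Sum>i<Suc m. q ^ (K + i))"
        proof (cases "a \<ge> s (K + m)")
          case True
          then have "\<bar>I a (s K) \<omega>\<bar> \<le> 3 * (\<Sum>i<m. q ^ (K + i))" using Suc.IH a0 by simp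
          also have "\<dots> \<le> 3 * (\<Sum>i<Suc m. q ^ (K + i))" using q0 by simp
          finally show ?thesis .
        next
          case False
          then have a: "a \<in> {s (Suc (K + m))..s (K + m)}" using a0 by simp
          have e: "I a (s K) \<omega> = I a (s (K + m)) \<omega> + I (s (K + m)) (s K) \<omega>"
            by (rule I_add[symmetric]) (use a mono[of K m] elim(2) in simp_all)
          have 1: "\<bar>I a (s (K + m)) \<omega>\<bar> \<le> 3 * q ^ (K + m)" by (rule small[OF _ a]) (use that in simp)
          have 2: "\<bar>I (s (K + m)) (s K) \<omega>\<bar> \<le> 3 * (\<Sum>i<m. q ^ (K + i))"
            using Suc.IH mono[of K m] by simp
          show ?thesis unfolding e sum.lessThan_Suc distrib_left
            using abs_triangle_ineq[of "I a (s (K + m)) \<omega>" "I (s (K + m)) (s K) \<omega>"] add_mono[OF 1 2]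
            by (simp only: add.commute order_trans)
        qed
      qed
    qed
    show ?case
    proof (rule Cauchy_at_bot_imp_limit)
      fix e :: real assume e: "e > 0"
      have "(\<lambda>K. 3 * (q ^ K / (1 - q))) \<longlonglongrightarrow> 3 * (0 / (1 - q))"
        using q by (intro tendsto_intros LIMSEQ_realpow_zero) auto
      then have "eventually (\<lambda>K. 3 * (q ^ K / (1 - q)) < e) sequentially"
        using e by (intro order_tendstoD) auto
      then have "eventually (\<lambda>K. 3 * (q ^ K / (1 - q)) < e \<and> K \<ge> K0) sequentially"
        using eventually_ge_at_top[of K0] by eventually_elim simp
      then obtain K where K: "3 * (q ^ K / (1 - q)) < e" "K \<ge> K0"
        using eventually_happens'[OF sequentially_bot] by fast
      have "\<bar>I a 0 \<omega> - I (s K) 0 \<omega>\<bar> \<le> e" if a: "a \<le> s K" for a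
      proof -
        have "ln 2 / - \<delta> > 0" using \<delta> by (intro divide_pos_pos) auto
        then obtain m :: nat where m: "- a < real m * (ln 2 / - \<delta>)"
          using reals_Archimedean3 by blast
        have "s (K + m) = s K + s m" by (simp add: s_def add_divide_distrib distrib_right)
        moreover have "s m \<le> a" using m by (simp add: s_def)
        ultimately have "s (K + m) \<le> a" using s_le[of K] by linarith
        then have "\<bar>I a (s K) \<omega>\<bar> \<le> 3 * (\<Sum>i<m. q ^ (K + i))" using sum[OF K(2), of m] a by simp
        also have "(\<Sum>i<m. q ^ (K + i)) \<le> q ^ K / (1 - q)"
        proof -
          have "(\<Sum>i<m. q ^ (K + i)) = q ^ K * (\<Sum>i<m. q ^ i)" by (simp add: power_add sum_distrib_left)
          also have "(\<Sum>i<m. q ^ i) = (1 - q ^ m) / (1 - q)" using q by (simp add: sum_gp_strict)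
          also have "\<dots> \<le> 1 / (1 - q)" using q by (intro divide_right_mono) auto
          finally show ?thesis using q by (simp add: mult_left_mono)
        qed
        finally have "\<bar>I a (s K) \<omega>\<bar> \<le> e" using K by simp
        moreover have "I a 0 \<omega> - I (s K) 0 \<omega> = I a (s K) \<omega>"
          using I_add[OF elim(2) a s_le[of K]] by simp
        ultimately show ?thesis by simp
      qed
      then show "\<exists>c. \<forall>a\<le>c. \<bar>I a 0 \<omega> - I c 0 \<omega>\<bar> \<le> e" by blast
    qed
  qed
qed

lemma measurable_limit_exists:
  assumes "AE \<omega> in M. \<exists>l. ((\<lambda>a. I a 0 \<omega>) \<longlongrightarrow> l) at_bot"
  shows "\<exists>J N. J \<in> borel_measurable M \<and> N \<in> null_sets M \<and>
    (\<forall>\<omega>\<in>space M - N. ((\<lambda>a. I a 0 \<omega>) \<longlongrightarrow> J \<omega>) at_bot)"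
proof -
  obtain N where N: "{\<omega>\<in>space M. \<not> (\<exists>l. ((\<lambda>a. I a 0 \<omega>) \<longlongrightarrow> l) at_bot)} \<subseteq> N" "N \<in> null_sets M"
    using assms unfolding eventually_ae_filter by blast
  have Nm [measurable]: "N \<in> events" using N by auto
  define J where "J \<omega> = (if \<omega> \<in> N then 0 else Lim at_bot (\<lambda>a. I a 0 \<omega>))" for \<omega>
  have lim: "((\<lambda>a. I a 0 \<omega>) \<longlongrightarrow> J \<omega>) at_bot" if "\<omega> \<in> space M" "\<omega> \<notin> N" for \<omega>
  proof -
    have "\<exists>l. ((\<lambda>a. I a 0 \<omega>) \<longlongrightarrow> l) at_bot" using N(1) that by auto
    then obtain l where l: "((\<lambda>a. I a 0 \<omega>) \<longlongrightarrow> l) at_bot" by blast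
    then have "J \<omega> = l" unfolding J_def using that(2) by (simp add: tendsto_Lim)
    then show ?thesis using l by simp
  qed
  have "J \<in> borel_measurable M"
  proof (rule borel_measurable_LIMSEQ_real)
    have [measurable]: "I (- real n) 0 \<in> borel_measurable M" for n by (intro I_meas) simp
    show "(\<lambda>\<omega>. if \<omega> \<in> N then 0 else I (- real n) 0 \<omega>) \<in> borel_measurable M" for n by measurable
    have bot: "filterlim (\<lambda>n. - real n) at_bot sequentially"
      by (simp add: filterlim_uminus_at_bot filterlim_real_sequentially)
    show "(\<lambda>n. if \<omega> \<in> N then 0 else I (- real n) 0 \<omega>) \<longlonglongrightarrow> J \<omega>" if "\<omega> \<in> space M" for \<omega>
      using filterlim_compose[OF lim bot] that by (cases "\<omega> \<in> N") (auto simp: J_def)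
  qed
  then show ?thesis using N(2) lim by blast
qed

end

section \<open>The limit process and its exponent\<close>

locale exp_integral_limit = exp_integral M L \<psi> \<delta> \<kappa> for M :: "'w measure" and L \<psi> \<delta> \<kappa> +
  fixes J :: "'w \<Rightarrow> real" and N :: "'w set"
  assumes J_meas [measurable]: "J \<in> borel_measurable M" and N_null: "N \<in> null_sets M"
    and J_lim: "\<And>\<omega>. \<omega> \<in> space M \<Longrightarrow> \<omega> \<notin> N \<Longrightarrow> ((\<lambda>a. I a 0 \<omega>) \<longlongrightarrow> J \<omega>) at_bot"
begin

definition Z :: "real \<Rightarrow> 'w \<Rightarrow> real" where
  "Z t \<omega> = (if t > 0 \<and> \<omega> \<notin> N then J \<omega> + F (ln t) \<omega> else 0)"

lemma N_sets [measurable]: "N \<in> events"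
  using N_null by auto

lemma AE_N: "AE \<omega> in M. \<omega> \<in> space M \<and> \<omega> \<notin> N"
  using AE_not_in[OF N_null] AE_space by eventually_elim simp

lemma Z_meas [measurable]: "Z t \<in> borel_measurable M"
proof -
  note [measurable] = F_meas
  show ?thesis unfolding Z_def[abs_def] by measurable
qed

lemma Z_0: "Z 0 \<omega> = 0"
  by (simp add: Z_def)

lemma Z_lim:
  assumes w: "\<omega> \<in> space M" "\<omega> \<notin> N" and t: "t > 0"
  shows "((\<lambda>a. I a (ln t) \<omega>) \<longlongrightarrow> Z t \<omega>) at_bot"
proof -
  have "((\<lambda>a. I a 0 \<omega> + F (ln t) \<omega>) \<longlongrightarrow> J \<omega> + F (ln t) \<omega>) at_bot"
    by (intro tendsto_intros J_lim w)
  moreover have "eventually (\<lambda>a. I a 0 \<omega> + F (ln t) \<omega> = I a (ln t) \<omega>) at_bot"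
    using eventually_le_at_bot[of "min 0 (ln t)"]
  proof eventually_elim
    case (elim a)
    then have a: "a \<le> 0" "a \<le> ln t" by auto
    have "F 0 \<omega> = 0" by (simp add: F_def)
    then show ?case using I_eq_F[OF w(1) a(1)] I_eq_F[OF w(1) a(2)] by simp
  qed
  ultimately have "((\<lambda>a. I a (ln t) \<omega>) \<longlongrightarrow> J \<omega> + F (ln t) \<omega>) at_bot"
    by (rule Lim_transform_eventually)
  then show ?thesis using w t by (simp add: Z_def)
qed

lemma Z_increment:
  assumes w: "\<omega> \<in> space M" "\<omega> \<notin> N" and st: "0 < s" "s \<le> t"
  shows "Z t \<omega> - Z s \<omega> = I (ln s) (ln t) \<omega>"
  using I_eq_F[OF w(1), of "ln s" "ln t"] w st by (simp add: Z_def)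

lemma Z_tendsto_at_0:
  assumes w: "\<omega> \<in> space M" "\<omega> \<notin> N"
  shows "((\<lambda>t. Z t \<omega>) \<longlongrightarrow> 0) (at_right 0)"
proof -
  have "((\<lambda>t. J \<omega> - I (ln t) 0 \<omega>) \<longlongrightarrow> J \<omega> - J \<omega>) (at_right 0)"
    by (intro tendsto_diff tendsto_const filterlim_compose[OF J_lim[OF w] ln_at_0])
  moreover have "eventually (\<lambda>t. J \<omega> - I (ln t) 0 \<omega> = Z t \<omega>) (at_right 0)"
    unfolding eventually_at_right_field
  proof (intro exI[of _ 1] conjI allI impI)
    fix t :: real assume t: "0 < t" "t < 1"
    have "F (ln t) \<omega> = - I (ln t) 0 \<omega>" using t by (simp add: F_def)
    then show "J \<omega> - I (ln t) 0 \<omega> = Z t \<omega>" using t w by (simp add: Z_def)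
  qed simp
  ultimately have "((\<lambda>t. Z t \<omega>) \<longlongrightarrow> J \<omega> - J \<omega>) (at_right 0)" by (rule Lim_transform_eventually)
  then show ?thesis by simp
qed

lemma filterlim_ln_at_right: "t > 0 \<Longrightarrow> filterlim ln (at_right (ln t)) (at_right (t::real))"
  unfolding filterlim_at
  by (auto intro!: tendsto_intros simp: eventually_at_filter intro: always_eventually)

lemma filterlim_ln_at_left: "t > 0 \<Longrightarrow> filterlim ln (at_left (ln t)) (at_left (t::real))"
  unfolding filterlim_at
proof
  assume t: "t > 0"
  show "(ln \<longlongrightarrow> ln t) (at_left t)" using t by (intro tendsto_intros) auto
  show "eventually (\<lambda>x. ln x \<in> {..<ln t} \<and> ln x \<noteq> ln t) (at_left t)"
    unfolding eventually_at_left_field using t by (intro exI[of _ 0]) auto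
qed

lemma Z_cadlag:
  assumes w: "\<omega> \<in> space M" "\<omega> \<notin> N"
  shows "cadlag (\<lambda>t. Z t \<omega>)"
  unfolding cadlag_def continuous_within
proof (intro conjI allI impI)
  fix t :: real assume t: "t \<ge> 0"
  show "((\<lambda>t. Z t \<omega>) \<longlongrightarrow> Z t \<omega>) (at_right t)"
  proof (cases "t = 0")
    case True
    then show ?thesis using Z_tendsto_at_0[OF w] by (simp add: Z_0)
  next
    case False
    then have t: "t > 0" using t by simp
    have "((\<lambda>b. F b \<omega>) \<longlongrightarrow> F (ln t) \<omega>) (at_right (ln t))"
      using rcll_F[OF w(1)] unfolding rcll_def continuous_within by blast
    from filterlim_compose[OF this filterlim_ln_at_right[OF t]]
    have "((\<lambda>s. J \<omega> + F (ln s) \<omega>) \<longlongrightarrow> J \<omega> + F (ln t) \<omega>) (at_right t)" by (intro tendsto_intros)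
    moreover have "eventually (\<lambda>s. J \<omega> + F (ln s) \<omega> = Z s \<omega>) (at_right t)"
      unfolding eventually_at_right_field using t w by (intro exI[of _ "t + 1"]) (auto simp: Z_def)
    ultimately have "((\<lambda>s. Z s \<omega>) \<longlongrightarrow> J \<omega> + F (ln t) \<omega>) (at_right t)" by (rule Lim_transform_eventually)
    then show ?thesis using t w by (simp add: Z_def)
  qed
next
  fix t :: real assume t: "t > 0"
  obtain l where "((\<lambda>b. F b \<omega>) \<longlongrightarrow> l) (at_left (ln t))"
    using rcll_F[OF w(1)] unfolding rcll_def by blast
  from filterlim_compose[OF this filterlim_ln_at_left[OF t]]
  have "((\<lambda>s. J \<omega> + F (ln s) \<omega>) \<longlongrightarrow> J \<omega> + l) (at_left t)" by (intro tendsto_intros)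
  moreover have "eventually (\<lambda>s. J \<omega> + F (ln s) \<omega> = Z s \<omega>) (at_left t)"
    unfolding eventually_at_left_field using t w by (intro exI[of _ 0]) (auto simp: Z_def)
  ultimately have "((\<lambda>s. Z s \<omega>) \<longlongrightarrow> J \<omega> + l) (at_left t)" by (rule Lim_transform_eventually)
  then show "\<exists>l. ((\<lambda>s. Z s \<omega>) \<longlongrightarrow> l) (at_left t)" by blast
qed

lemma Z_AE_tendsto:
  assumes t: "t \<ge> 0"
  shows "AE \<omega> in M. ((\<lambda>s. Z s \<omega>) \<longlongrightarrow> Z t \<omega>) (at t within {0..})"
proof (cases "t = 0")
  case True
  show ?thesis using AE_N
  proof eventually_elim
    case (elim \<omega>)
    have "((\<lambda>s. Z s \<omega>) \<longlongrightarrow> 0) (at 0 within {0..})"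
      unfolding at_within_Ici_at_right using elim by (intro Z_tendsto_at_0) simp_all
    then show ?case unfolding True Z_0 .
  qed
next
  case False
  then have t: "t > 0" using t by simp
  show ?thesis using AE_N F_isCont[of "ln t"]
  proof eventually_elim
    case (elim \<omega>)
    have "isCont (\<lambda>s. F (ln s) \<omega>) t"
      using isCont_o2[where f=ln and g="\<lambda>b. F b \<omega>" and a=t, OF isCont_ln_pos[OF t] elim(2)] .
    then have "((\<lambda>s. F (ln s) \<omega>) \<longlongrightarrow> F (ln t) \<omega>) (at t within {0..})"
      unfolding isCont_def by (rule tendsto_within_subset) simp
    then have "((\<lambda>s. J \<omega> + F (ln s) \<omega>) \<longlongrightarrow> J \<omega> + F (ln t) \<omega>) (at t within {0..})"
      by (intro tendsto_add tendsto_const)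
    moreover have "eventually (\<lambda>s. J \<omega> + F (ln s) \<omega> = Z s \<omega>) (at t within {0..})"
      unfolding eventually_at using t elim(1) by (intro exI[of _ t]) (auto simp: Z_def dist_real_def)
    ultimately have "((\<lambda>s. Z s \<omega>) \<longlongrightarrow> J \<omega> + F (ln t) \<omega>) (at t within {0..})"
      by (rule Lim_transform_eventually)
    then show ?case using t elim(1) by (simp add: Z_def)
  qed
qed

lemma Z_stochastically_continuous: "stochastically_continuous M Z"
  unfolding stochastically_continuous_def
proof (intro allI impI)
  fix t \<epsilon> :: real assume t: "0 \<le> t" and \<epsilon>: "\<epsilon> > 0"
  show "((\<lambda>s. prob {\<omega>\<in>space M. \<bar>Z s \<omega> - Z t \<omega>\<bar> > \<epsilon>}) \<longlongrightarrow> 0) (at t within {0..})"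
    unfolding tendsto_at_iff_sequentially o_def
  proof (intro allI impI)
    fix s :: "nat \<Rightarrow> real" assume s: "\<forall>i. s i \<in> {0..} - {t}" "s \<longlonglongrightarrow> t"
    then have fl: "filterlim s (at t within {0..}) sequentially"
      unfolding filterlim_at by (intro conjI always_eventually allI) auto
    show "(\<lambda>n. prob {\<omega>\<in>space M. \<bar>Z (s n) \<omega> - Z t \<omega>\<bar> > \<epsilon>}) \<longlonglongrightarrow> 0"
    proof (rule tendsto_measure_of_AE[OF _ _ \<epsilon>])
      show "AE \<omega> in M. (\<lambda>n. Z (s n) \<omega> - Z t \<omega>) \<longlonglongrightarrow> 0"
        using Z_AE_tendsto[OF t]
      proof eventually_elim
        case (elim \<omega>)
        show ?case by (rule LIM_zero[OF filterlim_compose[OF elim fl]])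
      qed
    qed measurable
  qed
qed

text \<open>The variable \<open>Z (t 0)\<close> is the limit of integrals over intervals that end at \<open>ln (t 0)\<close> and extend further
  and further to the left; these precede the intervals of all later increments.\<close>

lemma Z_indep_positive:
  assumes t0: "0 < t 0" and t: "\<forall>i<n. t i < t (Suc i)"
  shows "indep_vars (\<lambda>_. borel) (\<lambda>i \<omega>. if i = 0 then Z (t 0) \<omega> else Z (t i) \<omega> - Z (t (i - 1)) \<omega>) {..n::nat}"
proof -
  have weak: "\<forall>i<n. t i \<le> t (Suc i)" using t by (simp add: less_imp_le)
  have tpos: "0 < t i" if "i \<le> n" for i
    using chain_start_le[OF weak that] t0 by linarith
  define u where "u k i = (case i of 0 \<Rightarrow> ln (t 0) - 1 - real k | Suc j \<Rightarrow> ln (t j))" for k i :: nat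
  show ?thesis
  proof (rule indep_vars_AE_limit[where X="\<lambda>k i. I (u k i) (u k (Suc i))"])
    fix k
    have "u k i < u k (Suc i)" if "i < Suc n" for i
    proof (cases i)
      case (Suc j)
      then show ?thesis using t tpos[of j] tpos[of "Suc j"] that by (auto simp: u_def)
    qed (simp add: u_def)
    from I_indep[where u="u k" and N="Suc n", OF this]
    show "indep_vars (\<lambda>_. borel) (\<lambda>i. I (u k i) (u k (Suc i))) {..n}"
      by (simp add: lessThan_Suc_atMost)
  next
    fix i assume i: "i \<in> {..n}"
    show "(\<lambda>\<omega>. if i = 0 then Z (t 0) \<omega> else Z (t i) \<omega> - Z (t (i - 1)) \<omega>) \<in> borel_measurable M"
      by measurable
    have bot: "filterlim (\<lambda>k. ln (t 0) - 1 - real k) at_bot sequentially"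
      by real_asymp
    show "AE \<omega> in M. (\<lambda>k. I (u k i) (u k (Suc i)) \<omega>) \<longlonglongrightarrow>
        (if i = 0 then Z (t 0) \<omega> else Z (t i) \<omega> - Z (t (i - 1)) \<omega>)"
      using AE_N
    proof eventually_elim
      case (elim \<omega>)
      show ?case
      proof (cases i)
        case 0
        then show ?thesis
          using filterlim_compose[OF Z_lim[OF conjunct1[OF elim] conjunct2[OF elim] t0] bot] by (simp add: u_def)
      next
        case (Suc j)
        then show ?thesis using Z_increment[of \<omega> "t j" "t i"] elim t tpos[of j] i
          by (simp add: u_def less_imp_le)
      qed
    qed
  qed
qed

text \<open>The time 0 has no logarithm; it is reached from positive times by right-continuity.\<close>

lemma Z_indep:
  assumes t0: "0 \<le> t 0" and t: "\<forall>i<n. t i < t (Suc i)"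
  shows "indep_vars (\<lambda>_. borel) (\<lambda>i \<omega>. if i = 0 then Z (t 0) \<omega> else Z (t i) \<omega> - Z (t (i - 1)) \<omega>) {..n::nat}"
proof (rule indep_vars_AE_limit[where
    X="\<lambda>k i \<omega>. if i = 0 then Z (t 0 + 1 / (real k + 1)) \<omega>
       else Z (t i + 1 / (real k + 1)) \<omega> - Z (t (i - 1) + 1 / (real k + 1)) \<omega>"])
  fix k
  show "indep_vars (\<lambda>_. borel) (\<lambda>i \<omega>. if i = 0 then Z (t 0 + 1 / (real k + 1)) \<omega>
       else Z (t i + 1 / (real k + 1)) \<omega> - Z (t (i - 1) + 1 / (real k + 1)) \<omega>) {..n}"
    using t0 t by (intro Z_indep_positive[where t="\<lambda>i. t i + 1 / (real k + 1)"]) (auto intro: add_nonneg_pos)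
next
  have weak: "\<forall>i<n. t i \<le> t (Suc i)" using t by (simp add: less_imp_le)
  have tge: "0 \<le> t i" if "i \<le> n" for i
    using chain_start_le[OF weak that] t0 by linarith
  fix i assume i: "i \<in> {..n}"
  show "(\<lambda>\<omega>. if i = 0 then Z (t 0) \<omega> else Z (t i) \<omega> - Z (t (i - 1)) \<omega>) \<in> borel_measurable M"
    by measurable
  show "AE \<omega> in M. (\<lambda>k. if i = 0 then Z (t 0 + 1 / (real k + 1)) \<omega>
       else Z (t i + 1 / (real k + 1)) \<omega> - Z (t (i - 1) + 1 / (real k + 1)) \<omega>)
     \<longlonglongrightarrow> (if i = 0 then Z (t 0) \<omega> else Z (t i) \<omega> - Z (t (i - 1)) \<omega>)"
    using AE_N
  proof eventually_elim
    case (elim \<omega>)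
    have lim: "(\<lambda>k. Z (t j + 1 / (real k + 1)) \<omega>) \<longlonglongrightarrow> Z (t j) \<omega>" if "j \<le> n" for j
    proof -
      have "((\<lambda>s. Z s \<omega>) \<longlongrightarrow> Z (t j) \<omega>) (at_right (t j))"
        using Z_cadlag[of \<omega>] elim tge[OF that] unfolding cadlag_def continuous_within by blast
      moreover have "filterlim (\<lambda>k. t j + 1 / (real k + 1)) (at_right (t j)) sequentially"
        by real_asymp
      ultimately show ?thesis by (rule filterlim_compose)
    qed
    show ?case using lim[of i] lim[of 0] lim[of "i - 1"] i by (auto intro!: tendsto_intros)
  qed
qed

lemma additive_Z: "additive_process M Z"
  unfolding additive_process_def
proof (intro conjI allI impI)
  show "AE \<omega> in M. cadlag (\<lambda>t. Z t \<omega>)" using AE_N by eventually_elim (simp add: Z_cadlag)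
  show "AE \<omega> in M. Z 0 \<omega> = 0" by (simp add: Z_0)
qed (use Z_indep Z_stochastically_continuous in auto)

text \<open>Convergence of the integrals makes \<open>exp (\<Psi> a a')\<close> uniformly close to 1 on bounded sets of
  \<open>\<theta>\<close>; as \<open>\<Psi> a a'\<close> is a continuous logarithm vanishing at 0, it is then itself small.\<close>

lemma exponent_tail_small:
  assumes e: "e > 0" and R: "R > 0"
  shows "\<exists>c\<le>0. \<forall>a a' \<theta>. a \<le> a' \<longrightarrow> a' \<le> c \<longrightarrow> \<bar>\<theta>\<bar> \<le> R \<longrightarrow> norm (\<Psi> a a' \<theta>) < e"
proof -
  have "isCont Ln 1" by (rule isCont_Ln') (auto simp: complex_nonpos_Reals_iff)
  then have "\<exists>d>0. \<forall>z. dist z 1 < d \<longrightarrow> dist (Ln z) (Ln 1) < e"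
    using e unfolding continuous_at_eps_delta by blast
  then obtain d where d: "d > 0" "\<And>z. dist z 1 < d \<Longrightarrow> norm (Ln z) < e"
    by auto
  define \<eta> where "\<eta> = min d 1"
  have \<eta>: "\<eta> > 0" using d by (simp add: \<eta>_def)
  define \<epsilon> where "\<epsilon> = \<eta> / (2 * R)"
  have \<epsilon>: "\<epsilon> > 0" using \<eta> R by (simp add: \<epsilon>_def)
  define P where "P a = prob {\<omega>\<in>space M. \<bar>I a 0 \<omega> - J \<omega>\<bar> > \<epsilon> / 2}" for a
  have "\<exists>c\<le>0. \<forall>a\<le>c. P a < \<eta> / 8"
  proof (rule ccontr)
    assume "\<not> ?thesis"
    then have "\<forall>n. \<exists>a. a \<le> - real n \<and> P a \<ge> \<eta> / 8" by (metis neg_le_0_iff_le not_less of_nat_0_le_iff)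
    then obtain a where a: "\<And>n. a n \<le> - real n" "\<And>n. P (a n) \<ge> \<eta> / 8" by metis
    have a0: "a n \<le> 0" for n using a(1)[of n] by simp
    have bot: "filterlim a at_bot sequentially"
      by (rule filterlim_at_bot_mono[of "\<lambda>n. - real n"])
         (use a(1) in \<open>auto simp: filterlim_uminus_at_bot filterlim_real_sequentially\<close>)
    have "(\<lambda>n. P (a n)) \<longlonglongrightarrow> 0"
      unfolding P_def
    proof (rule tendsto_measure_of_AE)
      show "(\<lambda>\<omega>. I (a n) 0 \<omega> - J \<omega>) \<in> borel_measurable M" for n
        using I_meas[OF a0[of n]] by measurable
      show "AE \<omega> in M. (\<lambda>n. I (a n) 0 \<omega> - J \<omega>) \<longlonglongrightarrow> 0"
        using AE_N
      proof eventually_elim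
        case (elim \<omega>)
        then show ?case by (intro LIM_zero filterlim_compose[OF J_lim bot]) auto
      qed
    qed (use \<epsilon> in simp)
    then have "\<eta> / 8 \<le> 0" by (rule LIMSEQ_le_const) (use a(2) in blast)
    then show False using \<eta> by simp
  qed
  then obtain c where c: "c \<le> 0" "\<And>a. a \<le> c \<Longrightarrow> P a < \<eta> / 8" by blast
  have near: "norm (exp (\<Psi> a a' \<theta>) - 1) < \<eta>" if a: "a \<le> a'" "a' \<le> c" and \<theta>: "\<bar>\<theta>\<bar> \<le> R" for a a' \<theta>
  proof -
    have a0: "a \<le> 0" "a' \<le> 0" using a c by auto
    note [measurable] = I_meas[OF a(1)] I_meas[OF a0(1)] I_meas[OF a0(2)]
    have "norm (exp (\<Psi> a a' \<theta>) - 1) =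
        norm (char (distr M borel (I a a')) \<theta> - char (distr M borel (\<lambda>_. 0)) \<theta>)"
      unfolding char_I[OF a(1)] char_const_zero[OF prob_space_axioms] ..
    also have "\<dots> \<le> R * \<epsilon> + 2 * prob {\<omega>\<in>space M. \<bar>I a a' \<omega> - 0\<bar> > \<epsilon>}"
      using \<theta> \<epsilon> by (intro char_diff_bound) auto
    also have "prob {\<omega>\<in>space M. \<bar>I a a' \<omega> - 0\<bar> > \<epsilon>} \<le> prob ({\<omega>\<in>space M. \<bar>I a 0 \<omega> - J \<omega>\<bar> > \<epsilon> / 2} \<union> {\<omega>\<in>space M. \<bar>I a' 0 \<omega> - J \<omega>\<bar> > \<epsilon> / 2})"
    proof (rule finite_measure_mono)
      show "{\<omega>\<in>space M. \<bar>I a a' \<omega> - 0\<bar> > \<epsilon>} \<subseteq> {\<omega>\<in>space M. \<bar>I a 0 \<omega> - J \<omega>\<bar> > \<epsilon> / 2} \<union> {\<omega>\<in>space M. \<bar>I a' 0 \<omega> - J \<omega>\<bar> > \<epsilon> / 2}"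
      proof
        fix \<omega> assume w: "\<omega> \<in> {\<omega>\<in>space M. \<bar>I a a' \<omega> - 0\<bar> > \<epsilon>}"
        then have "I a a' \<omega> = (I a 0 \<omega> - J \<omega>) - (I a' 0 \<omega> - J \<omega>)"
          using I_add[of \<omega> a a' 0] a a0 by simp
        then have "\<bar>I a 0 \<omega> - J \<omega>\<bar> > \<epsilon> / 2 \<or> \<bar>I a' 0 \<omega> - J \<omega>\<bar> > \<epsilon> / 2"
        proof -
          have "\<epsilon> < \<bar>I a a' \<omega>\<bar>" using w by simp
          then show ?thesis
            unfolding \<open>I a a' \<omega> = _\<close> using abs_triangle_ineq4[of "I a 0 \<omega> - J \<omega>" "I a' 0 \<omega> - J \<omega>"] by argo
        qed
        then show "\<omega> \<in> {\<omega>\<in>space M. \<bar>I a 0 \<omega> - J \<omega>\<bar> > \<epsilon> / 2} \<union> {\<omega>\<in>space M. \<bar>I a' 0 \<omega> - J \<omega>\<bar> > \<epsilon> / 2}"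
          using w by auto
      qed
      show "{\<omega>\<in>space M. \<bar>I a 0 \<omega> - J \<omega>\<bar> > \<epsilon> / 2} \<union> {\<omega>\<in>space M. \<bar>I a' 0 \<omega> - J \<omega>\<bar> > \<epsilon> / 2} \<in> events"
        by measurable
    qed
    also have "\<dots> \<le> P a + P a'"
      unfolding P_def by (rule measure_Un_le) measurable
    finally have "norm (exp (\<Psi> a a' \<theta>) - 1) \<le> R * \<epsilon> + 2 * (P a + P a')" by simp
    also have "\<dots> < R * \<epsilon> + 2 * (\<eta> / 8 + \<eta> / 8)" using c(2)[of a] c(2)[of a'] a by simp
    also have "\<dots> = \<eta>" using R by (simp add: \<epsilon>_def)
    finally show ?thesis .
  qed
  have "norm (\<Psi> a a' \<theta>) < e" if a: "a \<le> a'" "a' \<le> c" and \<theta>: "\<bar>\<theta>\<bar> \<le> R" for a a' \<theta>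
  proof -
    have "\<Psi> a a' (1 * \<theta>) = Ln (exp (\<Psi> a a' (1 * \<theta>)))"
    proof (rule log_of_path_near_one[where f="\<lambda>r. \<Psi> a a' (r * \<theta>)"])
      show "continuous_on {0..1} (\<lambda>r. \<Psi> a a' (r * \<theta>))"
        by (intro continuous_on_compose2[OF \<Psi>_cont] continuous_intros) auto
      show "\<Psi> a a' (0 * \<theta>) = 0" by simp
      fix r :: real assume r: "r \<in> {0..1}"
      have "\<bar>r * \<theta>\<bar> \<le> 1 * \<bar>\<theta>\<bar>" unfolding abs_mult using r by (intro mult_right_mono) auto
      then have "norm (exp (\<Psi> a a' (r * \<theta>)) - 1) < \<eta>" using \<theta> by (intro near a) auto
      then show "norm (exp (\<Psi> a a' (r * \<theta>)) - 1) < 1" by (simp add: \<eta>_def)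
    qed
    moreover have "norm (Ln (exp (\<Psi> a a' \<theta>))) < e"
      using near[OF a \<theta>] by (intro d(2)) (simp add: dist_norm \<eta>_def)
    ultimately show ?thesis by simp
  qed
  then show ?thesis using c(1) by blast
qed

text \<open>The exponent of \<open>J\<close>.\<close>

definition g :: "real \<Rightarrow> complex" where
  "g \<theta> = lim (\<lambda>n. \<Psi> (- real n) 0 \<theta>)"

lemma \<Psi>_uniform_tail:
  assumes e: "e > 0" and R: "R > 0"
  shows "\<exists>c. \<forall>a\<le>c. \<forall>\<theta>. \<bar>\<theta>\<bar> \<le> R \<longrightarrow> norm (\<Psi> a 0 \<theta> - g \<theta>) \<le> e"
proof -
  have diff: "\<Psi> a 0 \<theta> - \<Psi> a' 0 \<theta> = \<Psi> a a' \<theta>" if "a \<le> a'" "a' \<le> 0" for a a' \<theta>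
    using \<Psi>_add[OF that, of \<theta>] by (simp add: algebra_simps)
  have seq: "\<exists>n0. \<forall>n\<ge>n0. - real n \<le> c" for c
  proof -
    obtain n0 :: nat where "- c \<le> real n0" using real_arch_simple by blast
    then show ?thesis by (intro exI[of _ n0]) auto
  qed
  have lim: "(\<lambda>n. \<Psi> (- real n) 0 \<theta>) \<longlonglongrightarrow> g \<theta>" for \<theta>
  proof -
    have "Cauchy (\<lambda>n. \<Psi> (- real n) 0 \<theta>)"
    proof (rule metric_CauchyI)
      fix e :: real assume "e > 0"
      then obtain c where c: "c \<le> 0" "\<And>a a'. a \<le> a' \<Longrightarrow> a' \<le> c \<Longrightarrow> norm (\<Psi> a a' \<theta>) < e"
        using exponent_tail_small[of e "\<bar>\<theta>\<bar> + 1"] by (metis abs_ge_zero add_nonneg_pos less_add_one less_imp_le zero_less_one)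
      obtain n0 where n0: "\<And>n. n \<ge> n0 \<Longrightarrow> - real n \<le> c" using seq by blast
      have le: "dist (\<Psi> (- real m) 0 \<theta>) (\<Psi> (- real n) 0 \<theta>) < e" if "n0 \<le> n" "n \<le> m" for m n
        using c(2)[of "- real m" "- real n"] n0[OF that(1)] that(2) diff[of "- real m" "- real n" \<theta>]
        by (simp add: dist_norm)
      show "\<exists>n0. \<forall>m\<ge>n0. \<forall>n\<ge>n0. dist (\<Psi> (- real m) 0 \<theta>) (\<Psi> (- real n) 0 \<theta>) < e"
        using le by (intro exI[of _ n0]) (metis dist_commute linear)
    qed
    then show ?thesis unfolding g_def using Cauchy_convergent convergent_LIMSEQ_iff by blast
  qed
  obtain c where c: "c \<le> 0" "\<And>a a' \<theta>. a \<le> a' \<Longrightarrow> a' \<le> c \<Longrightarrow> \<bar>\<theta>\<bar> \<le> R \<Longrightarrow> norm (\<Psi> a a' \<theta>) < e"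
    using exponent_tail_small[OF e R] by blast
  have "norm (\<Psi> a 0 \<theta> - g \<theta>) \<le> e" if a: "a \<le> c" and \<theta>: "\<bar>\<theta>\<bar> \<le> R" for a \<theta>
  proof -
    have "(\<lambda>n. norm (\<Psi> a 0 \<theta> - \<Psi> (- real n) 0 \<theta>)) \<longlonglongrightarrow> norm (\<Psi> a 0 \<theta> - g \<theta>)"
      by (intro tendsto_intros lim)
    moreover obtain n0 where n0: "\<And>n. n \<ge> n0 \<Longrightarrow> - real n \<le> a" using seq by blast
    have "norm (\<Psi> a 0 \<theta> - \<Psi> (- real n) 0 \<theta>) \<le> e" if "n \<ge> n0" for n
      unfolding norm_minus_commute[of "\<Psi> a 0 \<theta>"]
      using diff[of "- real n" a \<theta>] n0[OF that] c(1) a less_imp_le[OF c(2)[OF n0[OF that] a \<theta>]]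
      by simp
    ultimately show ?thesis by (intro LIMSEQ_le_const2[where X="\<lambda>n. norm (\<Psi> a 0 \<theta> - \<Psi> (- real n) 0 \<theta>)"]) auto
  qed
  then show ?thesis by blast
qed

lemma \<Psi>_tendsto_g: "((\<lambda>a. \<Psi> a 0 \<theta>) \<longlongrightarrow> g \<theta>) at_bot"
proof (rule tendstoI)
  fix e :: real assume e: "e > 0"
  obtain c where "\<forall>a\<le>c. \<forall>\<theta>'. \<bar>\<theta>'\<bar> \<le> \<bar>\<theta>\<bar> + 1 \<longrightarrow> norm (\<Psi> a 0 \<theta>' - g \<theta>') \<le> e / 2"
    using \<Psi>_uniform_tail[OF half_gt_zero[OF e] add_nonneg_pos[OF abs_ge_zero[of \<theta>] zero_less_one]] by blast
  then have "dist (\<Psi> a 0 \<theta>) (g \<theta>) \<le> e / 2" if "a \<le> c" for a using that by (simp add: dist_norm)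
  then have "\<forall>a\<le>c. dist (\<Psi> a 0 \<theta>) (g \<theta>) < e" using e by fastforce
  then show "\<forall>\<^sub>F a in at_bot. dist (\<Psi> a 0 \<theta>) (g \<theta>) < e"
    unfolding eventually_at_bot_linorder by blast
qed

lemma g_cont: "continuous_on UNIV g"
proof (rule continuous_at_imp_continuous_on, rule ballI)
  fix \<theta>0 :: real
  define R where "R = \<bar>\<theta>0\<bar> + 1"
  have R: "R > 0" by (simp add: R_def add_nonneg_pos)
  have "continuous_on {- R..R} g"
  proof (rule uniform_limit_theorem)
    show "\<forall>\<^sub>F a in at_bot. continuous_on {- R..R} (\<Psi> a 0)"
      by (intro always_eventually allI continuous_on_subset[OF \<Psi>_cont]) auto
    show "uniform_limit {- R..R} (\<lambda>a. \<Psi> a 0) g at_bot"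
    proof (rule uniform_limitI)
      fix e :: real assume e: "e > 0"
      obtain c where "\<forall>a\<le>c. \<forall>\<theta>. \<bar>\<theta>\<bar> \<le> R \<longrightarrow> norm (\<Psi> a 0 \<theta> - g \<theta>) \<le> e / 2"
        using \<Psi>_uniform_tail[OF half_gt_zero[OF e] R] by blast
      then have "\<forall>a\<le>c. \<forall>\<theta>\<in>{- R..R}. dist (\<Psi> a 0 \<theta>) (g \<theta>) < e"
        using e by (force simp: dist_norm abs_le_iff)
      then show "\<forall>\<^sub>F a in at_bot. \<forall>\<theta>\<in>{- R..R}. dist (\<Psi> a 0 \<theta>) (g \<theta>) < e"
        unfolding eventually_at_bot_linorder by blast
    qed
  qed simp
  then show "isCont g \<theta>0"
    by (rule continuous_on_interior) (auto simp: R_def abs_less_iff)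
qed

text \<open>The exponent of \<open>Z t\<close>: that of \<open>J = Z 1\<close>, corrected by the integral between 0 and \<open>ln t\<close>.\<close>

definition G :: "real \<Rightarrow> real \<Rightarrow> complex" where
  "G t \<theta> = (if t > 0 then g \<theta> + (if 1 \<le> t then \<Psi> 0 (ln t) \<theta> else - \<Psi> (ln t) 0 \<theta>) else 0)"

lemma G_lim:
  assumes t: "t > 0"
  shows "((\<lambda>a. \<Psi> a (ln t) \<theta>) \<longlongrightarrow> G t \<theta>) at_bot"
proof -
  let ?Q = "if 1 \<le> t then \<Psi> 0 (ln t) \<theta> else - \<Psi> (ln t) 0 \<theta>"
  have "((\<lambda>a. \<Psi> a 0 \<theta> + ?Q) \<longlongrightarrow> g \<theta> + ?Q) at_bot" by (intro tendsto_intros \<Psi>_tendsto_g)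
  moreover have "eventually (\<lambda>a. \<Psi> a 0 \<theta> + ?Q = \<Psi> a (ln t) \<theta>) at_bot"
    using eventually_le_at_bot[of "min 0 (ln t)"]
  proof eventually_elim
    case (elim a)
    show ?case
    proof (cases "1 \<le> t")
      case True
      then show ?thesis using \<Psi>_add[of a 0 "ln t" \<theta>] elim by simp
    next
      case False
      then show ?thesis using \<Psi>_add[of a "ln t" 0 \<theta>] elim t by (simp add: algebra_simps)
    qed
  qed
  ultimately have "((\<lambda>a. \<Psi> a (ln t) \<theta>) \<longlongrightarrow> g \<theta> + ?Q) at_bot" by (rule Lim_transform_eventually)
  then show ?thesis using t by (simp add: G_def)
qed

lemma G_cont: "continuous_on UNIV (G t)"
  unfolding G_def[abs_def]
  by (cases "t > 0"; cases "1 \<le> t") (simp_all add: continuous_on_add continuous_on_diff g_cont \<Psi>_cont)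

lemma G_theta_0: "G t 0 = 0"
proof -
  have "g 0 = 0" unfolding g_def by (simp add: limI)
  then show ?thesis by (simp add: G_def)
qed

lemma G_time_0: "G 0 \<theta> = 0"
  by (simp add: G_def)

lemma char_Z_increment:
  assumes st: "0 \<le> s" "s \<le> t"
  shows "char (distr M borel (\<lambda>\<omega>. Z t \<omega> - Z s \<omega>)) \<theta> = exp (G t \<theta> - G s \<theta>)"
proof (cases "s = 0")
  case False
  then have s: "0 < s" "ln s \<le> ln t" using st by auto
  note [measurable] = I_meas[OF s(2)]
  have "AE \<omega> in M. Z t \<omega> - Z s \<omega> = I (ln s) (ln t) \<omega>"
    using AE_N by eventually_elim (use Z_increment s st in auto)
  then have "distr M borel (\<lambda>\<omega>. Z t \<omega> - Z s \<omega>) = distr M borel (I (ln s) (ln t))"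
    by (intro distr_cong_AE) auto
  moreover have "G t \<theta> - G s \<theta> = \<Psi> (ln s) (ln t) \<theta>"
  proof -
    have "((\<lambda>a. \<Psi> a (ln t) \<theta> - \<Psi> a (ln s) \<theta>) \<longlongrightarrow> G t \<theta> - G s \<theta>) at_bot"
      using s st by (intro tendsto_intros G_lim) auto
    moreover have "eventually (\<lambda>a. \<Psi> a (ln t) \<theta> - \<Psi> a (ln s) \<theta> = \<Psi> (ln s) (ln t) \<theta>) at_bot"
      using eventually_le_at_bot[of "ln s"]
      by eventually_elim (use \<Psi>_add[of _ "ln s" "ln t" \<theta>] s in \<open>simp add: algebra_simps\<close>)
    ultimately have "((\<lambda>_. \<Psi> (ln s) (ln t) \<theta>) \<longlongrightarrow> G t \<theta> - G s \<theta>) (at_bot :: real filter)"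
      by (rule Lim_transform_eventually)
    then show ?thesis by (simp add: tendsto_const_iff)
  qed
  ultimately show ?thesis using char_I[OF s(2)] by simp
next
  case True
  show ?thesis
  proof (cases "t = 0")
    case t0: True
    then show ?thesis using True char_const_zero[OF prob_space_axioms] by simp
  next
    case False
    then have t: "t > 0" using st by simp
    define a where "a n = min 0 (ln t) - real n" for n
    have a: "a n \<le> ln t" for n by (simp add: a_def)
    have bot: "filterlim a at_bot sequentially" unfolding a_def by real_asymp
    have 1: "(\<lambda>n. char (distr M borel (I (a n) (ln t))) \<theta>) \<longlonglongrightarrow> char (distr M borel (Z t)) \<theta>"
    proof (rule char_tendsto_of_AE)
      show "AE \<omega> in M. (\<lambda>n. I (a n) (ln t) \<omega>) \<longlonglongrightarrow> Z t \<omega>"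
        using AE_N
      proof eventually_elim
        case (elim \<omega>)
        show ?case by (rule filterlim_compose[OF Z_lim[OF conjunct1[OF elim] conjunct2[OF elim] t] bot])
      qed
    qed (use I_meas[OF a] in auto)
    have 2: "(\<lambda>n. exp (\<Psi> (a n) (ln t) \<theta>)) \<longlonglongrightarrow> exp (G t \<theta>)"
      by (intro tendsto_exp filterlim_compose[OF G_lim[OF t] bot])
    have "char (distr M borel (Z t)) \<theta> = exp (G t \<theta>)"
      using 1 2 unfolding char_I[OF a] by (rule LIMSEQ_unique)
    then show ?thesis using True by (simp add: Z_0 G_time_0)
  qed
qed

text \<open>The translation identity for \<open>\<Psi>\<close> with \<open>c = ln T\<close>, in the limit.\<close>

lemma G_scaling:
  assumes T: "T > 0" and t: "0 \<le> t"
  shows "G (T * t) \<theta> = of_real (T powr \<delta>) * G t (T powr \<kappa> * \<theta>)"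
proof (cases "t = 0")
  case True
  then show ?thesis by (simp add: G_time_0)
next
  case False
  then have t: "t > 0" using t by simp
  have Td: "exp (\<delta> * ln T) = T powr \<delta>" "A (ln T) = T powr \<kappa>"
    using T by (auto simp: powr_def A_def mult.commute)
  have sh: "filterlim (\<lambda>a. a - ln T) at_bot at_bot"
    using filterlim_at_bot_mono[of "\<lambda>a. a" ] by real_asymp
  have "((\<lambda>a. of_real (T powr \<delta>) * \<Psi> (a - ln T) (ln t) (T powr \<kappa> * \<theta>)) \<longlongrightarrow>
      of_real (T powr \<delta>) * G t (T powr \<kappa> * \<theta>)) at_bot"
    by (intro tendsto_intros filterlim_compose[OF G_lim[OF t] sh])
  moreover have "eventually (\<lambda>a. of_real (T powr \<delta>) * \<Psi> (a - ln T) (ln t) (T powr \<kappa> * \<theta>) = \<Psi> a (ln (T * t)) \<theta>) at_bot"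
    using eventually_le_at_bot[of "ln t + ln T"]
  proof eventually_elim
    case (elim a)
    then show ?case
      using \<Psi>_shift[of "a - ln T" "ln t" "ln T" \<theta>] T t by (simp add: Td ln_mult add.commute)
  qed
  ultimately have "((\<lambda>a. \<Psi> a (ln (T * t)) \<theta>) \<longlongrightarrow> of_real (T powr \<delta>) * G t (T powr \<kappa> * \<theta>)) at_bot"
    by (rule Lim_transform_eventually)
  moreover have "((\<lambda>a. \<Psi> a (ln (T * t)) \<theta>) \<longlongrightarrow> G (T * t) \<theta>) at_bot" using T t by (intro G_lim) simp
  ultimately show ?thesis using tendsto_unique[OF trivial_limit_at_bot_linorder] by blast
qed

end

section \<open>Dilative stability from a scaling exponent\<close>

lemma (in prob_space) additive_process_cong_AE:
  assumes Z: "additive_process M Z" and X: "\<And>t. 0 \<le> t \<Longrightarrow> X t \<in> borel_measurable M"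
    and eq: "AE \<omega> in M. \<forall>t\<ge>0. X t \<omega> = Z t \<omega>"
  shows "additive_process M X"
proof -
  have Zm: "Z t \<in> borel_measurable M" if "0 \<le> t" for t using Z that unfolding additive_process_def by blast
  have ind: "indep_vars (\<lambda>_. borel) (\<lambda>i \<omega>. if i = 0 then X (t 0) \<omega> else X (t i) \<omega> - X (t (i - 1)) \<omega>) {..n::nat}"
    if t: "0 \<le> t 0 \<and> (\<forall>i<n. t i < t (Suc i))" for n t
  proof -
    have weak: "\<forall>i<n. t i \<le> t (Suc i)" using t by (simp add: less_imp_le)
    have tge: "0 \<le> t i" if "i \<le> n" for i
      using chain_start_le[OF weak that] t by linarith
    show ?thesis
    proof (rule indep_vars_AE_limit[where X="\<lambda>_ i \<omega>. if i = 0 then Z (t 0) \<omega> else Z (t i) \<omega> - Z (t (i - 1)) \<omega>"])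
      show "indep_vars (\<lambda>_. borel) (\<lambda>i \<omega>. if i = 0 then Z (t 0) \<omega> else Z (t i) \<omega> - Z (t (i - 1)) \<omega>) {..n}"
        using Z t unfolding additive_process_def by blast
      fix i assume i: "i \<in> {..n}"
      have [measurable]: "X (t 0) \<in> borel_measurable M" "X (t i) \<in> borel_measurable M" "X (t (i - 1)) \<in> borel_measurable M"
        using i tge[of 0] tge[of i] tge[of "i - 1"] by (auto intro!: X)
      show "(\<lambda>\<omega>. if i = 0 then X (t 0) \<omega> else X (t i) \<omega> - X (t (i - 1)) \<omega>) \<in> borel_measurable M"
        by measurable
      show "AE \<omega> in M. (\<lambda>n. if i = 0 then Z (t 0) \<omega> else Z (t i) \<omega> - Z (t (i - 1)) \<omega>)
          \<longlonglongrightarrow> (if i = 0 then X (t 0) \<omega> else X (t i) \<omega> - X (t (i - 1)) \<omega>)"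
        using eq
      proof eventually_elim
        case (elim \<omega>)
        then have "X (t 0) \<omega> = Z (t 0) \<omega>" "X (t i) \<omega> = Z (t i) \<omega>" "X (t (i - 1)) \<omega> = Z (t (i - 1)) \<omega>"
          using i tge[of 0] tge[of i] tge[of "i - 1"] by auto
        then show ?case by simp
      qed
    qed
  qed
  have sc: "stochastically_continuous M X"
    unfolding stochastically_continuous_def
  proof (intro allI impI)
    fix t \<epsilon> :: real assume t: "0 \<le> t" and \<epsilon>: "\<epsilon> > 0"
    have lim: "((\<lambda>s. prob {\<omega>\<in>space M. \<bar>Z s \<omega> - Z t \<omega>\<bar> > \<epsilon>}) \<longlongrightarrow> 0) (at t within {0..})"
      using Z t \<epsilon> unfolding additive_process_def stochastically_continuous_def by blast
    have same: "prob {\<omega>\<in>space M. \<bar>Z s \<omega> - Z t \<omega>\<bar> > \<epsilon>} = prob {\<omega>\<in>space M. \<bar>X s \<omega> - X t \<omega>\<bar> > \<epsilon>}"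
      if s: "0 \<le> s" for s
    proof (rule measure_eq_AE)
      note [measurable] = X[OF s] X[OF t] Zm[OF s] Zm[OF t]
      show "AE \<omega> in M. \<omega> \<in> {\<omega>\<in>space M. \<bar>Z s \<omega> - Z t \<omega>\<bar> > \<epsilon>} \<longleftrightarrow> \<omega> \<in> {\<omega>\<in>space M. \<bar>X s \<omega> - X t \<omega>\<bar> > \<epsilon>}"
        using eq by eventually_elim (use s t in auto)
      show "{\<omega>\<in>space M. \<bar>Z s \<omega> - Z t \<omega>\<bar> > \<epsilon>} \<in> events" "{\<omega>\<in>space M. \<bar>X s \<omega> - X t \<omega>\<bar> > \<epsilon>} \<in> events"
        by measurable
    qed
    have "eventually (\<lambda>s. prob {\<omega>\<in>space M. \<bar>Z s \<omega> - Z t \<omega>\<bar> > \<epsilon>} = prob {\<omega>\<in>space M. \<bar>X s \<omega> - X t \<omega>\<bar> > \<epsilon>}) (at t within {0..})"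
      unfolding eventually_at_filter by (rule always_eventually) (simp add: same)
    with lim show "((\<lambda>s. prob {\<omega>\<in>space M. \<bar>X s \<omega> - X t \<omega>\<bar> > \<epsilon>}) \<longlongrightarrow> 0) (at t within {0..})"
      by (rule Lim_transform_eventually)
  qed
  have "AE \<omega> in M. cadlag (\<lambda>t. Z t \<omega>)" using Z unfolding additive_process_def by blast
  then have cad: "AE \<omega> in M. cadlag (\<lambda>t. X t \<omega>)"
    using eq
  proof eventually_elim
    case (elim \<omega>)
    show ?case unfolding cadlag_def continuous_within
    proof (intro conjI allI impI)
      fix t :: real assume t: "0 \<le> t"
      have "((\<lambda>s. Z s \<omega>) \<longlongrightarrow> Z t \<omega>) (at_right t)"
        using elim(1) t unfolding cadlag_def continuous_within by blast
      moreover have "eventually (\<lambda>s. Z s \<omega> = X s \<omega>) (at_right t)"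
        unfolding eventually_at_right_field using elim(2) t by (intro exI[of _ "t + 1"]) auto
      ultimately have "((\<lambda>s. X s \<omega>) \<longlongrightarrow> Z t \<omega>) (at_right t)" by (rule Lim_transform_eventually)
      then show "((\<lambda>s. X s \<omega>) \<longlongrightarrow> X t \<omega>) (at_right t)" using elim(2) t by simp
    next
      fix t :: real assume t: "0 < t"
      obtain l where "((\<lambda>s. Z s \<omega>) \<longlongrightarrow> l) (at_left t)" using elim(1) t unfolding cadlag_def by blast
      moreover have "eventually (\<lambda>s. Z s \<omega> = X s \<omega>) (at_left t)"
        unfolding eventually_at_left_field using elim(2) t by (intro exI[of _ 0]) auto
      ultimately have "((\<lambda>s. X s \<omega>) \<longlongrightarrow> l) (at_left t)" by (rule Lim_transform_eventually)
      then show "\<exists>l. ((\<lambda>s. X s \<omega>) \<longlongrightarrow> l) (at_left t)" by blast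
    qed
  qed
  have "AE \<omega> in M. Z 0 \<omega> = 0" using Z unfolding additive_process_def by blast
  then have "AE \<omega> in M. X 0 \<omega> = 0" using eq by eventually_elim simp
  then show ?thesis unfolding additive_process_def using X ind sc cad by blast
qed

text \<open>The \<open>n\<close>-th roots of the coordinates are realised jointly on one product space; the columns of
  that array give the root of the vector, its row sums the vector itself.\<close>

lemma (in prob_space) linear_image_convolution_root:
  fixes D :: "nat \<Rightarrow> 'a \<Rightarrow> real" and r :: "nat \<Rightarrow> nat"
  assumes m: "m > 0" and n: "n > 0" and ind: "indep_vars (\<lambda>_. borel) D {..<m}"
    and nu: "\<And>i. i < m \<Longrightarrow> real_distribution (\<nu> i)"
    and root: "\<And>i \<theta>. i < m \<Longrightarrow> char (distr M borel (D i)) \<theta> = char (\<nu> i) \<theta> ^ n"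
    and r: "\<And>j. j < k \<Longrightarrow> r j \<le> m"
  shows "\<exists>\<rho>. prob_space \<rho> \<and> sets \<rho> = sets (borel_Rn k) \<and>
    distr M (borel_Rn k) (\<lambda>\<omega>. \<lambda>j\<in>{..<k}. \<Sum>i<r j. D i \<omega>) =
    distr (\<Pi>\<^sub>M l\<in>{..<n}. \<rho>) (borel_Rn k) (\<lambda>x. \<lambda>j\<in>{..<k}. \<Sum>l<n. x l j)"
proof -
  let ?Bm = "PiM {..<m} (\<lambda>_. borel :: real measure)"
  define K where "K = {..<m} \<times> {..<n}"
  define Q where "Q = PiM K (\<lambda>(i, l). \<nu> i)"
  define \<Lambda> where "\<Lambda> d = (\<lambda>j\<in>{..<k}. \<Sum>i<r j. d i :: real)" for d :: "nat \<Rightarrow> real"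
  have nup: "prob_space (\<nu> i)" and nus: "sets (\<nu> i) = sets borel" if "i < m" for i
    using nu[OF that] unfolding real_distribution_def real_distribution_axioms_def by auto
  have \<Lambda>m: "\<Lambda> \<in> ?Bm \<rightarrow>\<^sub>M borel_Rn k"
    unfolding \<Lambda>_def
    by (intro measurable_restrict borel_measurable_sum measurable_component_singleton)
       (use r in force)
  interpret Q: prob_space Q
    unfolding Q_def by (rule prob_space_PiM) (auto simp: K_def nup)
  have iv: "Q.indep_vars (\<lambda>_. borel) (\<lambda>p x. x p) K"
    unfolding Q_def by (rule indep_vars_PiM_coordinates) (auto simp: K_def nup nus)
  have Qm: "(\<lambda>x. x p) \<in> borel_measurable Q" if "p \<in> K" for p
    using iv that unfolding Q.indep_vars_def by auto
  have law: "distr Q borel (\<lambda>x. x (i, l)) = \<nu> i" if "i < m" "l < n" for i l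
  proof -
    have K: "(i, l) \<in> K" using that by (simp add: K_def)
    have "distr Q borel (\<lambda>x. x (i, l)) = distr Q (\<nu> i) (\<lambda>x. x (i, l))"
      by (rule distr_cong) (auto simp: nus that)
    also have "\<dots> = \<nu> i"
      using distr_PiM_component[of K "\<lambda>(i, l). \<nu> i" "(i, l)"] K unfolding Q_def by (auto simp: K_def nup)
    finally show ?thesis .
  qed
  define \<rho> where "\<rho> = distr (PiM {..<m} \<nu>) (borel_Rn k) \<Lambda>"
  have Pm_sets: "sets (PiM {..<m} \<nu>) = sets ?Bm" by (intro sets_PiM_cong) (auto simp: nus)
  have \<Lambda>m': "\<Lambda> \<in> PiM {..<m} \<nu> \<rightarrow>\<^sub>M borel_Rn k"
    using \<Lambda>m by (simp add: measurable_cong_sets[OF Pm_sets refl])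
  have \<rho>p: "prob_space \<rho>"
    unfolding \<rho>_def using \<Lambda>m' nup by (intro prob_space.prob_space_distr prob_space_PiM) auto
  \<comment> \<open>Column \<open>l\<close> of the array has the law of the independent roots.\<close>
  have colm: "(\<lambda>x. \<lambda>i\<in>{..<m}. x (i, l)) \<in> Q \<rightarrow>\<^sub>M ?Bm" if "l < n" for l
    using that by (intro measurable_restrict Qm) (auto simp: K_def)
  have col: "distr Q ?Bm (\<lambda>x. \<lambda>i\<in>{..<m}. x (i, l)) = PiM {..<m} \<nu>" if l: "l < n" for l
  proof -
    have "Q.indep_vars (\<lambda>_. borel) (\<lambda>i x. x (i, l)) {..<m}"
      using Q.indep_vars_reindex[OF iv, of "\<lambda>i. (i, l)" "{..<m}"] l by (auto simp: K_def inj_on_def)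
    moreover have "{..<m} \<noteq> {}" using m by auto
    ultimately have "distr Q ?Bm (\<lambda>x. \<lambda>i\<in>{..<m}. x (i, l)) = PiM {..<m} (\<lambda>i. distr Q borel (\<lambda>x. x (i, l)))"
      using Q.indep_vars_iff_distr_eq_PiM'[where M'="\<lambda>_. borel" and X="\<lambda>i x. x (i, l)" and I="{..<m}"] Qm l
      by (auto simp: K_def)
    also have "\<dots> = PiM {..<m} \<nu>" by (intro PiM_cong) (auto simp: law l)
    finally show ?thesis .
  qed
  define W where "W l x = \<Lambda> (\<lambda>i\<in>{..<m}. x (i, l))" for l :: nat and x :: "nat \<times> nat \<Rightarrow> real"
  have Wm: "W l \<in> Q \<rightarrow>\<^sub>M borel_Rn k" if "l < n" for l
    unfolding W_def[abs_def] using measurable_compose[OF colm[OF that] \<Lambda>m] .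
  have Wlaw: "distr Q (borel_Rn k) (W l) = \<rho>" if "l < n" for l
  proof -
    have "distr Q (borel_Rn k) (W l) = distr (distr Q ?Bm (\<lambda>x. \<lambda>i\<in>{..<m}. x (i, l))) (borel_Rn k) \<Lambda>"
      unfolding distr_distr[OF \<Lambda>m colm[OF that]] by (simp add: W_def[abs_def] o_def)
    then show ?thesis unfolding col[OF that] \<rho>_def .
  qed
  have W_ind: "Q.indep_vars (\<lambda>_. borel_Rn k) W {..<n}"
  proof -
    have 1: "Q.indep_vars (\<lambda>l. PiM ({..<m} \<times> {l}) (\<lambda>_. borel)) (\<lambda>l x. restrict (\<lambda>p. x p) ({..<m} \<times> {l})) {..<n}"
      by (intro Q.indep_vars_restrict[OF iv]) (auto simp: K_def disjoint_family_on_def)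
    have "Q.indep_vars (\<lambda>_. borel_Rn k)
        (\<lambda>l x. (\<lambda>y. \<Lambda> (\<lambda>i\<in>{..<m}. y (i, l))) (restrict (\<lambda>p. x p) ({..<m} \<times> {l}))) {..<n}"
      by (rule Q.indep_vars_compose2[OF 1])
         (intro measurable_compose[OF _ \<Lambda>m] measurable_restrict measurable_component_singleton, auto)
    then show ?thesis
    proof (rule Q.indep_vars_cong[THEN iffD1, rotated 3])
      fix l
      have "(\<lambda>i\<in>{..<m}. restrict (\<lambda>p. x p) ({..<m} \<times> {l}) (i, l)) = (\<lambda>i\<in>{..<m}. x (i, l))" for x :: "nat \<times> nat \<Rightarrow> real"
        by (rule restrict_ext) auto
      then show "(\<lambda>x. (\<lambda>y. \<Lambda> (\<lambda>i\<in>{..<m}. y (i, l))) (restrict (\<lambda>p. x p) ({..<m} \<times> {l}))) = W l"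
        by (simp add: W_def[abs_def])
    qed auto
  qed
  have nn: "{..<n} \<noteq> {}" using n by auto
  have Wjoint: "distr Q (PiM {..<n} (\<lambda>_. borel_Rn k)) (\<lambda>x. \<lambda>l\<in>{..<n}. W l x) = PiM {..<n} (\<lambda>_. \<rho>)"
  proof -
    have "distr Q (PiM {..<n} (\<lambda>_. borel_Rn k)) (\<lambda>x. \<lambda>l\<in>{..<n}. W l x) = PiM {..<n} (\<lambda>l. distr Q (borel_Rn k) (W l))"
      using Q.indep_vars_iff_distr_eq_PiM'[OF nn, where M'="\<lambda>_. borel_Rn k" and X=W] Wm W_ind by auto
    also have "\<dots> = PiM {..<n} (\<lambda>_. \<rho>)" by (intro PiM_cong) (auto simp: Wlaw)
    finally show ?thesis .
  qed
  \<comment> \<open>The row sums of the array have the joint law of \<open>D\<close>.\<close>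
  define R where "R i x = (\<Sum>l<n. x (i, l))" for i :: nat and x :: "nat \<times> nat \<Rightarrow> real"
  have Rm: "R i \<in> borel_measurable Q" if "i < m" for i
    unfolding R_def[abs_def] using that by (intro borel_measurable_sum Qm) (auto simp: K_def)
  have R_ind: "Q.indep_vars (\<lambda>_. borel) R {..<m}"
  proof -
    have 1: "Q.indep_vars (\<lambda>i. PiM ({i} \<times> {..<n}) (\<lambda>_. borel)) (\<lambda>i x. restrict (\<lambda>p. x p) ({i} \<times> {..<n})) {..<m}"
      by (intro Q.indep_vars_restrict[OF iv]) (auto simp: K_def disjoint_family_on_def)
    have "Q.indep_vars (\<lambda>_. borel) (\<lambda>i x. (\<lambda>y. \<Sum>l<n. y (i, l)) (restrict (\<lambda>p. x p) ({i} \<times> {..<n}))) {..<m}"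
      by (rule Q.indep_vars_compose2[OF 1]) (intro borel_measurable_sum measurable_component_singleton, auto)
    then show ?thesis
      by (rule Q.indep_vars_cong[THEN iffD1, rotated 3]) (auto simp: R_def fun_eq_iff)
  qed
  have Dm: "D i \<in> borel_measurable M" if "i < m" for i
    using ind that unfolding indep_vars_def by auto
  have Rlaw: "distr Q borel (R i) = distr M borel (D i)" if i: "i < m" for i
  proof (rule Levy_uniqueness)
    show "real_distribution (distr Q borel (R i))" by (rule Q.real_distribution_law[OF Rm[OF i]])
    show "real_distribution (distr M borel (D i))" by (rule real_distribution_law[OF Dm[OF i]])
    have "Q.indep_vars (\<lambda>_. borel) (\<lambda>l x. x (i, l)) {..<n}"
      using Q.indep_vars_reindex[OF iv, of "\<lambda>l. (i, l)" "{..<n}"] i by (auto simp: K_def inj_on_def)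
    from Q.char_distr_sum[OF this] show "char (distr Q borel (R i)) = char (distr M borel (D i))"
      by (auto simp: R_def[abs_def] fun_eq_iff root[OF i] law[OF i])
  qed
  have mm: "{..<m} \<noteq> {}" using m by auto
  have "distr Q ?Bm (\<lambda>x. \<lambda>i\<in>{..<m}. R i x) = PiM {..<m} (\<lambda>i. distr Q borel (R i))"
    using Q.indep_vars_iff_distr_eq_PiM'[OF mm, where M'="\<lambda>_. borel" and X=R] Rm R_ind by auto
  also have "\<dots> = PiM {..<m} (\<lambda>i. distr M borel (D i))" by (intro PiM_cong) (auto simp: Rlaw)
  also have "\<dots> = distr M ?Bm (\<lambda>\<omega>. \<lambda>i\<in>{..<m}. D i \<omega>)"
    using indep_vars_iff_distr_eq_PiM'[OF mm, where M'="\<lambda>_. borel" and X=D] Dm ind by auto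
  finally have RD: "distr Q ?Bm (\<lambda>x. \<lambda>i\<in>{..<m}. R i x) = distr M ?Bm (\<lambda>\<omega>. \<lambda>i\<in>{..<m}. D i \<omega>)" .
  have Rjm: "(\<lambda>x. \<lambda>i\<in>{..<m}. R i x) \<in> Q \<rightarrow>\<^sub>M ?Bm" by (intro measurable_restrict Rm) auto
  have Djm: "(\<lambda>\<omega>. \<lambda>i\<in>{..<m}. D i \<omega>) \<in> M \<rightarrow>\<^sub>M ?Bm" by (intro measurable_restrict Dm) auto
  have \<Lambda>_restrict: "\<Lambda> (\<lambda>i\<in>{..<m}. d i) = (\<lambda>j\<in>{..<k}. \<Sum>i<r j. d i)" for d
    unfolding \<Lambda>_def
  proof (rule restrict_ext)
    fix j assume "j \<in> {..<k}"
    then have "r j \<le> m" using r by simp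
    then show "(\<Sum>i<r j. restrict d {..<m} i) = (\<Sum>i<r j. d i)" by (intro sum.cong) auto
  qed
  have "distr M (borel_Rn k) (\<lambda>\<omega>. \<lambda>j\<in>{..<k}. \<Sum>i<r j. D i \<omega>) = distr (distr M ?Bm (\<lambda>\<omega>. \<lambda>i\<in>{..<m}. D i \<omega>)) (borel_Rn k) \<Lambda>"
    unfolding distr_distr[OF \<Lambda>m Djm] by (simp add: o_def \<Lambda>_restrict)
  also have "\<dots> = distr Q (borel_Rn k) (\<lambda>x. \<lambda>j\<in>{..<k}. \<Sum>i<r j. R i x)"
    unfolding RD[symmetric] distr_distr[OF \<Lambda>m Rjm] by (simp add: o_def \<Lambda>_restrict)
  also have "\<dots> = distr Q (borel_Rn k) (\<lambda>x. \<lambda>j\<in>{..<k}. \<Sum>l<n. (\<lambda>l\<in>{..<n}. W l x) l j)"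
  proof (rule distr_cong)
    fix x
    show "(\<lambda>j\<in>{..<k}. \<Sum>i<r j. R i x) = (\<lambda>j\<in>{..<k}. \<Sum>l<n. (\<lambda>l\<in>{..<n}. W l x) l j)"
      unfolding W_def \<Lambda>_restrict R_def by (rule restrict_ext) (simp add: sum.swap[of _ "{..<n}"])
  qed auto
  also have "\<dots> = distr (PiM {..<n} (\<lambda>_. \<rho>)) (borel_Rn k) (\<lambda>y. \<lambda>j\<in>{..<k}. \<Sum>l<n. y l j)"
  proof -
    have sm: "(\<lambda>y. \<lambda>j\<in>{..<k}. \<Sum>l<n. y l j :: real) \<in> PiM {..<n} (\<lambda>_. borel_Rn k) \<rightarrow>\<^sub>M borel_Rn k"
    proof (intro measurable_restrict borel_measurable_sum)
      fix j l assume j: "j \<in> {..<k}" and l: "l \<in> {..<n}"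
      have a: "(\<lambda>y. y l) \<in> PiM {..<n} (\<lambda>_. borel_Rn k) \<rightarrow>\<^sub>M borel_Rn k"
        using l by (rule measurable_component_singleton)
      have b: "(\<lambda>z. z j) \<in> borel_Rn k \<rightarrow>\<^sub>M (borel :: real measure)"
        using j by (rule measurable_component_singleton)
      show "(\<lambda>y. y l j) \<in> borel_measurable (PiM {..<n} (\<lambda>_. borel_Rn k))"
        using measurable_compose[where f="\<lambda>y. y l" and g="\<lambda>z. z j", OF a b] .
    qed
    have Wjm: "(\<lambda>x. \<lambda>l\<in>{..<n}. W l x) \<in> Q \<rightarrow>\<^sub>M PiM {..<n} (\<lambda>_. borel_Rn k)"
      by (intro measurable_restrict Wm) auto
    show ?thesis unfolding Wjoint[symmetric] distr_distr[OF sm Wjm] by (simp add: o_def)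
  qed
  finally show ?thesis using \<rho>p by (intro exI[of _ \<rho>]) (auto simp: \<rho>_def)
qed

text \<open>Finitely many times, in any order and with repetitions, lie on an increasing chain that starts at 0.
  The time 1 is thrown in so that the chain has at least one step.\<close>

lemma times_on_increasing_chain:
  fixes t :: "nat \<Rightarrow> real"
  assumes "\<forall>j<k. 0 \<le> t j"
  shows "\<exists>m u r. m > 0 \<and> u 0 = 0 \<and> (\<forall>i<m. u i < u (Suc i)) \<and> (\<forall>j<k. r j \<le> m \<and> t j = u (r j :: nat))"
proof -
  define B where "B = insert 0 (insert 1 (t ` {..<k}))"
  define us where "us = sorted_list_of_set B"
  have B: "finite B" by (simp add: B_def)
  have set: "set us = B" and sorted: "sorted_wrt (<) us"
    using B by (auto simp: us_def)
  have len: "length us \<ge> 2"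
  proof -
    have "card {0, 1 :: real} \<le> card B" using B by (intro card_mono) (auto simp: B_def)
    then show ?thesis using B by (simp add: us_def)
  qed
  define m where "m = length us - 1"
  have less: "us ! i < us ! j" if "i < j" "j < length us" for i j
    using sorted that by (simp add: sorted_wrt_iff_nth_less)
  have us0: "us ! 0 = 0"
  proof -
    have "0 \<in> set us" unfolding set B_def by simp
    then obtain i where i: "i < length us" "us ! i = 0" unfolding in_set_conv_nth by blast
    have "us ! 0 \<in> B" unfolding set[symmetric] using len by (intro nth_mem) linarith
    then have "0 \<le> us ! 0" using assms by (auto simp: B_def)
    moreover have "us ! 0 \<le> us ! i" using less[of 0 i] i(1) by (cases "i = 0") auto
    ultimately show ?thesis using i(2) by simp
  qed
  have "\<exists>p. j < k \<longrightarrow> p \<le> m \<and> t j = us ! p" for j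
  proof (cases "j < k")
    case True
    then have "t j \<in> set us" unfolding set B_def by simp
    then obtain p where "p < length us" "us ! p = t j" unfolding in_set_conv_nth by blast
    then have "p \<le> m \<and> t j = us ! p" by (simp add: m_def)
    then show ?thesis by blast
  qed simp
  then obtain r where r: "\<And>j. j < k \<longrightarrow> r j \<le> m \<and> t j = us ! r j" using choice[of "\<lambda>j p. j < k \<longrightarrow> p \<le> m \<and> t j = us ! p"] by blast
  have "m > 0" using len by (simp add: m_def)
  moreover have "\<forall>i<m. us ! i < us ! Suc i" using less by (simp add: m_def)
  ultimately show ?thesis using us0 r by (intro exI[of _ m] exI[of _ "\<lambda>i. us ! i"] exI[of _ r]) blast
qed

text \<open>Infinite divisibility and dilative stability of an additive process depend only on the scaling of
  the exponents of its increments.\<close>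

locale scaling_exponent = prob_space M for M :: "'w measure" +
  fixes X :: "real \<Rightarrow> 'w \<Rightarrow> real" and G :: "real \<Rightarrow> real \<Rightarrow> complex" and \<delta> \<kappa> :: real
  assumes additive: "additive_process M X"
    and G_cont: "\<And>t. continuous_on UNIV (G t)" and G_theta_0: "\<And>t. G t 0 = 0"
    and G_char: "\<And>s t \<theta>. 0 \<le> s \<Longrightarrow> s \<le> t \<Longrightarrow>
      char (distr M borel (\<lambda>\<omega>. X t \<omega> - X s \<omega>)) \<theta> = exp (G t \<theta> - G s \<theta>)"
    and G_scaling: "\<And>T t \<theta>. T > 0 \<Longrightarrow> 0 \<le> t \<Longrightarrow> G (T * t) \<theta> = of_real (T powr \<delta>) * G t (T powr \<kappa> * \<theta>)"
    and \<delta>_nz: "\<delta> \<noteq> 0"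
begin

lemma X_meas: "0 \<le> t \<Longrightarrow> X t \<in> borel_measurable M"
  using additive unfolding additive_process_def by blast

lemma chain_nonneg:
  fixes u :: "nat \<Rightarrow> real"
  assumes "u 0 = 0" "\<forall>i<m. u i < u (Suc i)" "i \<le> m"
  shows "0 \<le> u i"
  using chain_start_le[of m u i] assms by (simp add: less_imp_le)

lemma chain_increments_indep:
  assumes "u 0 = 0" "\<forall>i<m. u i < u (Suc i)"
  shows "indep_vars (\<lambda>_. borel) (\<lambda>i \<omega>. X (u (Suc i)) \<omega> - X (u i) \<omega>) {..<m::nat}"
  using assms by (intro additive_process_weak_increments[OF additive]) auto

lemma X_eq_sum_increments:
  "AE \<omega> in M. \<forall>u p. u 0 = 0 \<longrightarrow> X (u p) \<omega> = (\<Sum>i<p. X (u (Suc i)) \<omega> - X (u i) \<omega>)"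
proof -
  have "AE \<omega> in M. X 0 \<omega> = 0" using additive unfolding additive_process_def by blast
  then show ?thesis
  proof eventually_elim
    case (elim \<omega>)
    show ?case
    proof (intro allI impI)
      fix u :: "nat \<Rightarrow> real" and p assume "u 0 = 0"
      then show "X (u p) \<omega> = (\<Sum>i<p. X (u (Suc i)) \<omega> - X (u i) \<omega>)"
        using elim by (simp add: sum_lessThan_telescope[where f="\<lambda>i. X (u i) \<omega>"])
    qed
  qed
qed

lemma infinitely_divisible_X: "infinitely_divisible_process M X"
  unfolding infinitely_divisible_process_def infinitely_divisible_Rn_def
proof (intro conjI allI impI)
  fix k and t :: "nat \<Rightarrow> real" and n :: nat
  assume tge: "\<forall>j<k. 0 \<le> t j" and n1: "1 \<le> n"
  then have n: "n > 0" by simp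
  obtain m u r where m: "m > 0" and u: "u 0 = 0" "\<forall>i<m. u i < u (Suc i)"
    and r: "\<forall>j<k. r j \<le> m \<and> t j = u (r j :: nat)"
    using times_on_increasing_chain[OF tge] by blast
  define D where "D i \<omega> = X (u (Suc i)) \<omega> - X (u i) \<omega>" for i \<omega>
  \<comment> \<open>Running the process at the speed \<open>T\<close> with \<open>T powr \<delta> = 1 / n\<close> divides the exponent by \<open>n\<close>.\<close>
  define T where "T = (1 / real n) powr (1 / \<delta>)"
  have T: "T > 0" "T powr \<delta> = 1 / real n" using n \<delta>_nz by (auto simp: T_def powr_powr)
  define \<nu> where "\<nu> i = distr M borel (\<lambda>\<omega>. T powr (- \<kappa>) * (X (T * u (Suc i)) \<omega> - X (T * u i) \<omega>))" for i
  have uge: "0 \<le> u i" if "i \<le> m" for i using chain_nonneg[OF u that] .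
  have diffm: "(\<lambda>\<omega>. X (T * u (Suc i)) \<omega> - X (T * u i) \<omega>) \<in> borel_measurable M" if "i < m" for i
    using uge[of i] uge[of "Suc i"] that T by (intro borel_measurable_diff X_meas) auto
  have \<nu>: "real_distribution (\<nu> i)" if "i < m" for i
    unfolding \<nu>_def using diffm[OF that] by (intro real_distribution_law borel_measurable_times) auto
  have root: "char (distr M borel (D i)) \<theta> = char (\<nu> i) \<theta> ^ n" if i: "i < m" for i \<theta>
  proof -
    have ui: "0 \<le> u i" "0 \<le> u (Suc i)" "u i \<le> u (Suc i)" using uge[of i] uge[of "Suc i"] i by (auto intro: less_imp_le[OF u(2)[rule_format]])
    have sc: "G (T * v) (\<theta> * T powr (- \<kappa>)) = G v \<theta> / of_nat n" if "0 \<le> v" for v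
    proof -
      have "T powr \<kappa> * T powr (- \<kappa>) = T powr (\<kappa> + (- \<kappa>))" by (rule powr_add[symmetric])
      also have "\<dots> = 1" using T(1) by simp
      finally have one: "T powr \<kappa> * T powr (- \<kappa>) = 1" .
      have e: "T powr \<kappa> * (\<theta> * T powr (- \<kappa>)) = \<theta>"
        unfolding mult.left_commute[of "T powr \<kappa>" \<theta>] one by (rule mult_1_right)
      have "of_real (1 / real n) * G v \<theta> = G v \<theta> / of_nat n" by simp
      with G_scaling[OF T(1) that, of "\<theta> * T powr (- \<kappa>)"] show ?thesis
        unfolding T(2) e by (rule trans)
    qed
    have "char (\<nu> i) \<theta> = exp (G (T * u (Suc i)) (\<theta> * T powr (- \<kappa>)) - G (T * u i) (\<theta> * T powr (- \<kappa>)))"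
      unfolding \<nu>_def char_scale[OF diffm[OF i]] by (rule G_char) (use ui T(1) in simp_all)
    also have "\<dots> = exp ((G (u (Suc i)) \<theta> - G (u i) \<theta>) / of_nat n)"
      unfolding sc[OF ui(1)] sc[OF ui(2)] diff_divide_distrib ..
    finally have "char (\<nu> i) \<theta> ^ n = exp (of_nat n * ((G (u (Suc i)) \<theta> - G (u i) \<theta>) / of_nat n))"
      unfolding exp_of_nat_mult by (rule arg_cong[where f="\<lambda>z. z ^ n"])
    also have "of_nat n * ((G (u (Suc i)) \<theta> - G (u i) \<theta>) / of_nat n) = G (u (Suc i)) \<theta> - G (u i) \<theta>"
      using n by simp
    finally show ?thesis unfolding D_def[abs_def] G_char[OF ui(1,3)] by (rule sym)
  qed
  have "distr M (borel_Rn k) (\<lambda>\<omega>. \<lambda>j\<in>{..<k}. X (t j) \<omega>) = distr M (borel_Rn k) (\<lambda>\<omega>. \<lambda>j\<in>{..<k}. \<Sum>i<r j. D i \<omega>)"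
  proof (rule distr_cong_AE)
    show "AE \<omega> in M. (\<lambda>j\<in>{..<k}. X (t j) \<omega>) = (\<lambda>j\<in>{..<k}. \<Sum>i<r j. D i \<omega>)"
      using X_eq_sum_increments
    proof eventually_elim
      case (elim \<omega>)
      show ?case
      proof (rule restrict_ext)
        fix j assume "j \<in> {..<k}"
        then have "t j = u (r j)" using r by simp
        then show "X (t j) \<omega> = (\<Sum>i<r j. D i \<omega>)" using elim[THEN spec[of _ u], THEN spec[of _ "r j"], THEN mp, OF u(1)] unfolding D_def by (simp only:)
      qed
    qed
    show "(\<lambda>\<omega>. \<lambda>j\<in>{..<k}. X (t j) \<omega>) \<in> M \<rightarrow>\<^sub>M borel_Rn k"
      using tge by (intro measurable_restrict X_meas) auto
    show "(\<lambda>\<omega>. \<lambda>j\<in>{..<k}. \<Sum>i<r j. D i \<omega>) \<in> M \<rightarrow>\<^sub>M borel_Rn k"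
    proof (intro measurable_restrict borel_measurable_sum)
      fix j i assume "j \<in> {..<k}" "i \<in> {..<r j}"
      then have "Suc i \<le> m" using r by (metis Suc_le_eq le_trans lessThan_iff)
      then show "D i \<in> borel_measurable M"
        unfolding D_def[abs_def] using uge[of i] uge[of "Suc i"] by (intro borel_measurable_diff X_meas) auto
    qed
  qed auto
  moreover have "indep_vars (\<lambda>_. borel) D {..<m}"
    unfolding D_def[abs_def] by (rule chain_increments_indep[OF u])
  from linear_image_convolution_root[OF m n this \<nu> root, of k r]
  have "\<exists>\<rho>. prob_space \<rho> \<and> sets \<rho> = sets (borel_Rn k) \<and>
    distr M (borel_Rn k) (\<lambda>\<omega>. \<lambda>j\<in>{..<k}. \<Sum>i<r j. D i \<omega>) =
    distr (\<Pi>\<^sub>M l\<in>{..<n}. \<rho>) (borel_Rn k) (\<lambda>x. \<lambda>j\<in>{..<k}. \<Sum>l<n. x l j)" using r by blast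
  ultimately show "\<exists>\<nu>. prob_space \<nu> \<and> sets \<nu> = sets (borel_Rn k) \<and>
      distr M (borel_Rn k) (\<lambda>\<omega>. \<lambda>j\<in>{..<k}. X (t j) \<omega>) =
      distr (\<Pi>\<^sub>M i\<in>{..<n}. \<nu>) (borel_Rn k) (\<lambda>x. \<lambda>j\<in>{..<k}. \<Sum>i<n. x i j)"
    by (simp only:)
qed (rule X_meas)

text \<open>The exponent of the values at the times \<open>u (r j)\<close>: the increment between \<open>u i\<close> and \<open>u (Suc i)\<close>
  contributes to the \<open>j\<close>-th of them exactly when \<open>i < r j\<close>.\<close>

definition chain_exponent :: "nat \<Rightarrow> (nat \<Rightarrow> real) \<Rightarrow> nat \<Rightarrow> (nat \<Rightarrow> nat) \<Rightarrow> (nat \<Rightarrow> real) \<Rightarrow> complex" where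
  "chain_exponent m u k r \<theta> =
    (\<Sum>i<m. G (u (Suc i)) (\<Sum>j | j < k \<and> i < r j. \<theta> j) - G (u i) (\<Sum>j | j < k \<and> i < r j. \<theta> j))"

lemma chain_exponent_cont: "continuous_on B (chain_exponent m u k r)"
proof -
  have s: "continuous_on B (\<lambda>\<theta> :: nat \<Rightarrow> real. \<Sum>j | j < k \<and> i < r j. \<theta> j)" for i
    by (rule continuous_on_sum) (rule continuous_on_subset[OF continuous_on_product_coordinates subset_UNIV])
  have c: "continuous_on B (\<lambda>\<theta>. G v (\<Sum>j | j < k \<and> i < r j. \<theta> j))" for v i
    by (rule continuous_on_compose2[OF G_cont s]) simp
  show ?thesis unfolding chain_exponent_def[abs_def]
    by (rule continuous_on_sum) (rule continuous_on_diff[OF c c])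
qed

lemma joint_char:
  assumes u: "u 0 = 0" "\<forall>i<m. u i < u (Suc i)" and r: "\<forall>j<k. r j \<le> m \<and> t j = u (r j :: nat)"
  shows "(CLINT \<omega>|M. exp (\<i> * complex_of_real (\<Sum>j<k. \<theta> j * X (t j) \<omega>))) = exp (chain_exponent m u k r \<theta>)"
proof -
  define c where "c i = (\<Sum>j | j < k \<and> i < r j. \<theta> j)" for i
  define D where "D i \<omega> = c i * (X (u (Suc i)) \<omega> - X (u i) \<omega>)" for i \<omega>
  have uge: "0 \<le> u i" if "i \<le> m" for i using chain_nonneg[OF u that] .
  have dm: "(\<lambda>\<omega>. X (u (Suc i)) \<omega> - X (u i) \<omega>) \<in> borel_measurable M" if "i < m" for i
    using uge[of i] uge[of "Suc i"] that by (intro borel_measurable_diff X_meas) auto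
  have ind: "indep_vars (\<lambda>_. borel) D {..<m}"
    using indep_vars_compose2[OF chain_increments_indep[OF u], of "\<lambda>i x. c i * x" "\<lambda>_. borel"]
    by (simp add: D_def[abs_def])
  have Dm: "D i \<in> borel_measurable M" if "i < m" for i
    using ind that unfolding indep_vars_def by auto
  have tge: "0 \<le> t j" if "j < k" for j using r uge that by auto
  have "AE \<omega> in M. (\<Sum>j<k. \<theta> j * X (t j) \<omega>) = (\<Sum>i<m. D i \<omega>)"
    using X_eq_sum_increments
  proof eventually_elim
    case (elim \<omega>)
    let ?d = "\<lambda>i. X (u (Suc i)) \<omega> - X (u i) \<omega>"
    have "(\<Sum>j<k. \<theta> j * X (t j) \<omega>) = (\<Sum>j<k. \<Sum>i<m. if i < r j then \<theta> j * ?d i else 0)"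
    proof (rule sum.cong[OF refl])
      fix j assume "j \<in> {..<k}"
      then have j: "r j \<le> m" "t j = u (r j)" using r by auto
      have "X (t j) \<omega> = (\<Sum>i<r j. ?d i)" unfolding j(2) by (rule elim[THEN spec[of _ u], THEN spec[of _ "r j"], THEN mp, OF u(1)])
      then have "\<theta> j * X (t j) \<omega> = (\<Sum>i<r j. \<theta> j * ?d i)" by (simp only: sum_distrib_left)
      also have "\<dots> = (\<Sum>i<m. if i < r j then \<theta> j * ?d i else 0)"
        using j(1) by (intro sum.mono_neutral_cong_left) auto
      finally show "\<theta> j * X (t j) \<omega> = (\<Sum>i<m. if i < r j then \<theta> j * ?d i else 0)" .
    qed
    also have "\<dots> = (\<Sum>i<m. \<Sum>j<k. if i < r j then \<theta> j * ?d i else 0)" by (rule sum.swap)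
    also have "\<dots> = (\<Sum>i<m. D i \<omega>)"
    proof (rule sum.cong[OF refl])
      fix i
      have "(\<Sum>j<k. if i < r j then \<theta> j * ?d i else 0) = (\<Sum>j | j < k \<and> i < r j. \<theta> j * ?d i)"
        by (rule sum.mono_neutral_cong_right) auto
      then show "(\<Sum>j<k. if i < r j then \<theta> j * ?d i else 0) = D i \<omega>"
        unfolding D_def c_def by (simp only: sum_distrib_right)
    qed
    finally show ?case .
  qed
  then have "AE \<omega> in M. exp (\<i> * complex_of_real (\<Sum>j<k. \<theta> j * X (t j) \<omega>)) = exp (\<i> * complex_of_real (\<Sum>i<m. D i \<omega>))"
    by eventually_elim (simp only:)
  then have "(CLINT \<omega>|M. exp (\<i> * complex_of_real (\<Sum>j<k. \<theta> j * X (t j) \<omega>))) = (CLINT \<omega>|M. exp (\<i> * complex_of_real (\<Sum>i<m. D i \<omega>)))"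
  proof (rule integral_cong_AE[rotated 2])
    have [measurable]: "(\<lambda>\<omega>. \<Sum>j<k. \<theta> j * X (t j) \<omega>) \<in> borel_measurable M"
      using tge by (intro borel_measurable_sum borel_measurable_times X_meas) auto
    have [measurable]: "(\<lambda>\<omega>. \<Sum>i<m. D i \<omega>) \<in> borel_measurable M"
      using Dm by (intro borel_measurable_sum) auto
    show "(\<lambda>\<omega>. exp (\<i> * complex_of_real (\<Sum>j<k. \<theta> j * X (t j) \<omega>))) \<in> borel_measurable M"
      "(\<lambda>\<omega>. exp (\<i> * complex_of_real (\<Sum>i<m. D i \<omega>))) \<in> borel_measurable M" by measurable
  qed
  also have "\<dots> = char (distr M borel (\<lambda>\<omega>. \<Sum>i<m. D i \<omega>)) 1"
    using Dm by (subst char_distr) (auto intro!: borel_measurable_sum)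
  also have "\<dots> = (\<Prod>i<m. char (distr M borel (D i)) 1)" by (rule char_distr_sum[OF ind])
  also have "\<dots> = (\<Prod>i<m. exp (G (u (Suc i)) (c i) - G (u i) (c i)))"
  proof (rule prod.cong[OF refl])
    fix i assume "i \<in> {..<m}"
    then have i: "i < m" by simp
    show "char (distr M borel (D i)) 1 = exp (G (u (Suc i)) (c i) - G (u i) (c i))"
      unfolding D_def[abs_def] using uge[of i] i u(2)
      by (subst char_scale[OF dm[OF i]]) (simp add: G_char less_imp_le)
  qed
  also have "\<dots> = exp (chain_exponent m u k r \<theta>)"
    unfolding chain_exponent_def c_def by (simp add: exp_sum)
  finally show ?thesis .
qed

text \<open>A continuous logarithm of the characteristic function is unique, as one sees along rays from the
  origin.\<close>

lemma levy_exponent_eq_chain_exponent: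
  assumes u: "u 0 = 0" "\<forall>i<m. u i < u (Suc i)" and r: "\<forall>j<k. r j \<le> m \<and> t j = u (r j :: nat)"
    and \<theta>: "\<theta> \<in> Rn k"
  shows "levy_exponent M X k t \<theta> = chain_exponent m u k r \<theta>"
proof -
  let ?E = "restrict (chain_exponent m u k r) (Rn k)"
  have restrict_zero: "(\<Sum>j | j < k \<and> i < r j. (\<lambda>j\<in>{..<k}. 0 :: real) j) = 0" for i
    by (intro sum.neutral) auto
  have zero: "chain_exponent m u k r (\<lambda>j\<in>{..<k}. 0) = 0"
    unfolding chain_exponent_def restrict_zero by (simp add: G_theta_0)
  have "levy_exponent M X k t = ?E"
    unfolding levy_exponent_def
  proof (rule the_equality)
    have "continuous_on (Rn k) ?E"
      by (rule continuous_on_eq[OF chain_exponent_cont]) (simp only: restrict_apply if_True)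
    then show "?E \<in> extensional (Rn k) \<and> continuous_on (Rn k) ?E \<and> ?E (\<lambda>j\<in>{..<k}. 0) = 0 \<and>
        (\<forall>\<theta>\<in>Rn k. (CLINT \<omega>|M. exp (\<i> * complex_of_real (\<Sum>j<k. \<theta> j * X (t j) \<omega>))) = exp (?E \<theta>))"
    proof (intro conjI ballI)
      have "(\<lambda>j\<in>{..<k}. 0 :: real) \<in> Rn k" by simp
      then show "?E (\<lambda>j\<in>{..<k}. 0) = 0" by (simp only: restrict_apply if_True zero)
    next
      fix \<theta> assume "\<theta> \<in> Rn k"
      then show "(CLINT \<omega>|M. exp (\<i> * complex_of_real (\<Sum>j<k. \<theta> j * X (t j) \<omega>))) = exp (?E \<theta>)"
        by (simp only: restrict_apply if_True joint_char[OF u r])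
    qed (rule restrict_extensional)
  next
    fix \<psi> assume \<psi>: "\<psi> \<in> extensional (Rn k) \<and> continuous_on (Rn k) \<psi> \<and> \<psi> (\<lambda>j\<in>{..<k}. 0) = 0 \<and>
        (\<forall>\<theta>\<in>Rn k. (CLINT \<omega>|M. exp (\<i> * complex_of_real (\<Sum>j<k. \<theta> j * X (t j) \<omega>))) = exp (\<psi> \<theta>))"
    have \<psi>_ext: "\<psi> \<in> extensional (Rn k)" and \<psi>_cont: "continuous_on (Rn k) \<psi>"
      and \<psi>_zero: "\<psi> (\<lambda>j\<in>{..<k}. 0) = 0"
      using \<psi> by blast+
    have \<psi>_exp: "(CLINT \<omega>|M. exp (\<i> * complex_of_real (\<Sum>j<k. \<theta> j * X (t j) \<omega>))) = exp (\<psi> \<theta>)"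
      if "\<theta> \<in> Rn k" for \<theta> using \<psi> that by blast
    show "\<psi> = ?E"
    proof (rule extensionalityI[OF \<psi>_ext restrict_extensional])
      fix \<theta> assume \<theta>: "\<theta> \<in> Rn k"
      define ray where "ray x = (\<lambda>j\<in>{..<k}. x * \<theta> j)" for x :: real
      have rayc: "continuous_on {0..1} ray"
      proof (rule continuous_on_coordinatewise_then_product)
        show "continuous_on {0..1} (\<lambda>x. ray x j)" for j
          by (cases "j < k") (auto simp: ray_def intro!: continuous_intros)
      qed
      have rayR: "ray x \<in> Rn k" for x by (simp add: ray_def)
      have ray1: "ray 1 = \<theta>" unfolding ray_def mult_1_left by (rule PiE_restrict[OF \<theta>])
      have ray0: "ray 0 = (\<lambda>j\<in>{..<k}. 0)" by (simp add: ray_def)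
      have "\<psi> (ray 1) = chain_exponent m u k r (ray 1)"
      proof (rule continuous_log_unique[where f="\<lambda>x. \<psi> (ray x)" and g="\<lambda>x. chain_exponent m u k r (ray x)"])
        show "continuous_on {0..1} (\<lambda>x. \<psi> (ray x))"
          by (rule continuous_on_compose2[OF \<psi>_cont rayc]) (use rayR in blast)
        show "continuous_on {0..1} (\<lambda>x. chain_exponent m u k r (ray x))"
          by (rule continuous_on_compose2[OF chain_exponent_cont[of UNIV] rayc]) simp
        show "exp (\<psi> (ray x)) = exp (chain_exponent m u k r (ray x))" for x
          unfolding \<psi>_exp[OF rayR, symmetric] by (rule joint_char[OF u r])
        show "\<psi> (ray 0) = chain_exponent m u k r (ray 0)" unfolding ray0 \<psi>_zero zero ..
      qed
      then show "\<psi> \<theta> = ?E \<theta>" unfolding ray1 using \<theta> by (simp only: restrict_apply if_True)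
    qed
  qed
  then show ?thesis using \<theta> by simp
qed

lemma dilatively_stable_X:
  assumes \<kappa>: "\<kappa> = \<alpha> - \<delta> / 2"
  shows "dilatively_stable M \<alpha> \<delta> X"
  unfolding dilatively_stable_def
proof (intro conjI allI impI ballI)
  show "infinitely_divisible_process M X" by (rule infinitely_divisible_X)
  fix T :: real and k and t :: "nat \<Rightarrow> real" and \<theta>
  assume T: "T > 0" and tge: "\<forall>j<k. 0 \<le> t j" and \<theta>: "\<theta> \<in> Rn k"
  obtain m u r where u: "u 0 = 0" "\<forall>i<m. u i < u (Suc i)" and r: "\<forall>j<k. r j \<le> m \<and> t j = u (r j :: nat)"
    using times_on_increasing_chain[OF tge] by blast
  define \<theta>' where "\<theta>' = (\<lambda>j\<in>{..<k}. T powr \<kappa> * \<theta> j)"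
  have \<theta>': "\<theta>' \<in> Rn k" by (simp add: \<theta>'_def)
  have c': "(\<Sum>j | j < k \<and> i < r j. \<theta>' j) = T powr \<kappa> * (\<Sum>j | j < k \<and> i < r j. \<theta> j)" for i
    unfolding sum_distrib_left by (rule sum.cong) (auto simp: \<theta>'_def)
  have "levy_exponent M X k (\<lambda>j. T * t j) \<theta> = chain_exponent m (\<lambda>i. T * u i) k r \<theta>"
    using u r T by (intro levy_exponent_eq_chain_exponent \<theta>) auto
  also have "\<dots> = of_real (T powr \<delta>) * chain_exponent m u k r \<theta>'"
    unfolding chain_exponent_def c' sum_distrib_left[of "complex_of_real (T powr \<delta>)"]
  proof (rule sum.cong[OF refl])
    fix i assume "i \<in> {..<m}"
    then have "0 \<le> u i" "0 \<le> u (Suc i)" using chain_nonneg[OF u, of i] chain_nonneg[OF u, of "Suc i"] by auto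
    then show "G (T * u (Suc i)) (\<Sum>j | j < k \<and> i < r j. \<theta> j) - G (T * u i) (\<Sum>j | j < k \<and> i < r j. \<theta> j) =
      of_real (T powr \<delta>) * (G (u (Suc i)) (T powr \<kappa> * (\<Sum>j | j < k \<and> i < r j. \<theta> j)) - G (u i) (T powr \<kappa> * (\<Sum>j | j < k \<and> i < r j. \<theta> j)))"
      by (simp only: G_scaling[OF T] right_diff_distrib)
  qed
  also have "chain_exponent m u k r \<theta>' = levy_exponent M X k t \<theta>'"
    by (rule levy_exponent_eq_chain_exponent[OF u r \<theta>', symmetric])
  finally show "levy_exponent M X k (\<lambda>j. T * t j) \<theta> =
      of_real (T powr \<delta>) * levy_exponent M X k t (\<lambda>j\<in>{..<k}. T powr (\<alpha> - \<delta> / 2) * \<theta> j)"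
    unfolding \<theta>'_def \<kappa> .
qed

end

section \<open>Additivity and dilative stability of the integral process\<close>

text \<open>Limits are unique, so every version agrees with \<open>Z\<close> at all times simultaneously, off one null set, and
  inherits additivity and the increment exponents from it.\<close>

lemma (in exp_integral) log_integral_process_stable:
  assumes path: "AE \<omega> in M. \<forall>t. L t \<omega> = L0 t \<omega>"
    and conv: "AE \<omega> in M. \<exists>l. ((\<lambda>a. I a 0 \<omega>) \<longlongrightarrow> l) at_bot"
    and \<kappa>: "\<kappa> = \<alpha> - \<delta> / 2"
  shows "(\<exists>X. is_log_integral_process M A (time_changed \<delta> L0) X) \<and>
    (\<forall>X. is_log_integral_process M A (time_changed \<delta> L0) X \<longrightarrow>
      additive_process M X \<and> dilatively_stable M \<alpha> \<delta> X)"
proof -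
  have same: "AE \<omega> in M. \<forall>a b. random_integral A (time_changed \<delta> L0) a b \<omega> = I a b \<omega>"
    using path by eventually_elim (simp add: I_def Y_def random_integral_def time_changed_def)
  obtain J N where JN: "J \<in> borel_measurable M" "N \<in> null_sets M"
    "\<forall>\<omega>\<in>space M - N. ((\<lambda>a. I a 0 \<omega>) \<longlongrightarrow> J \<omega>) at_bot"
    using measurable_limit_exists[OF conv] by blast
  interpret lim: exp_integral_limit M L \<psi> \<delta> \<kappa> J N
    by unfold_locales (use JN in auto)
  have Z: "is_log_integral_process M A (time_changed \<delta> L0) lim.Z"
    unfolding is_log_integral_process_def
  proof (intro conjI allI impI ballI)
    show "AE \<omega> in M. \<forall>t>0. ((\<lambda>a. random_integral A (time_changed \<delta> L0) a (ln t) \<omega>) \<longlongrightarrow> lim.Z t \<omega>) at_bot"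
      using same lim.AE_N
    proof eventually_elim
      case (elim \<omega>)
      show ?case unfolding elim(1)[rule_format] using lim.Z_lim elim(2) by blast
    qed
  qed (auto simp: lim.Z_0)
  have "additive_process M X \<and> dilatively_stable M \<alpha> \<delta> X"
    if X: "is_log_integral_process M A (time_changed \<delta> L0) X" for X
  proof -
    have Xm: "X t \<in> borel_measurable M" if "0 \<le> t" for t
      using X that unfolding is_log_integral_process_def by blast
    have XL: "AE \<omega> in M. \<forall>t>0. ((\<lambda>a. random_integral A (time_changed \<delta> L0) a (ln t) \<omega>) \<longlongrightarrow> X t \<omega>) at_bot"
      and X0: "\<And>\<omega>. \<omega> \<in> space M \<Longrightarrow> X 0 \<omega> = 0"
      using X unfolding is_log_integral_process_def by auto
    have XZ: "AE \<omega> in M. \<forall>t\<ge>0. X t \<omega> = lim.Z t \<omega>"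
      using XL same lim.AE_N
    proof eventually_elim
      case (elim \<omega>)
      show ?case
      proof (intro allI impI)
        fix t :: real assume "0 \<le> t"
        show "X t \<omega> = lim.Z t \<omega>"
        proof (cases "t = 0")
          case True
          then show ?thesis using X0 elim(3) by (simp add: lim.Z_0)
        next
          case False
          then have t: "0 < t" using \<open>0 \<le> t\<close> by simp
          have "((\<lambda>a. I a (ln t) \<omega>) \<longlongrightarrow> X t \<omega>) at_bot"
            using elim(1)[rule_format, OF t] unfolding elim(2)[rule_format] .
          moreover have "((\<lambda>a. I a (ln t) \<omega>) \<longlongrightarrow> lim.Z t \<omega>) at_bot"
            using elim(3) t by (intro lim.Z_lim) auto
          ultimately show ?thesis by (rule tendsto_unique[OF trivial_limit_at_bot_linorder])
        qed
      qed
    qed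
    have addX: "additive_process M X"
      by (rule additive_process_cong_AE[OF lim.additive_Z Xm XZ])
    interpret sc: scaling_exponent M X lim.G \<delta> \<kappa>
    proof unfold_locales
      fix s t \<theta> :: real assume st: "0 \<le> s" "s \<le> t"
      have "0 \<le> t" using st by simp
      note [measurable] = Xm[OF st(1)] Xm[OF this]
      have "distr M borel (\<lambda>\<omega>. X t \<omega> - X s \<omega>) = distr M borel (\<lambda>\<omega>. lim.Z t \<omega> - lim.Z s \<omega>)"
        by (intro distr_cong_AE) (use XZ st in \<open>auto elim!: eventually_mono\<close>)
      then show "char (distr M borel (\<lambda>\<omega>. X t \<omega> - X s \<omega>)) \<theta> = exp (lim.G t \<theta> - lim.G s \<theta>)"
        using lim.char_Z_increment[OF st] by simp
    qed (use addX lim.G_cont lim.G_theta_0 lim.G_scaling \<delta>_nz in auto)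
    show ?thesis using addX sc.dilatively_stable_X[OF \<kappa>] by blast
  qed
  then show ?thesis using Z by blast
qed

theorem theorem2p10:
  fixes M :: "'w measure" and \<mu> :: "real measure"
    and L Y :: "real \<Rightarrow> 'w \<Rightarrow> real" and A :: "real \<Rightarrow> real" and \<alpha> \<delta> :: real
  defines "Y \<equiv> time_changed \<delta> L"
    and "A \<equiv> (\<lambda>u. exp (u * (\<alpha> - \<delta>/2)))"
  assumes "prob_space M"
    and "two_sided_levy_process M \<mu> L"
    and "(\<delta> > 0 \<and> \<alpha> > \<delta>/2) \<or>
         (\<delta> < 0 \<and> \<alpha> > - \<delta>/2 \<and>
          (\<exists>\<gamma> > - \<delta> / (\<alpha> + \<delta>/2).
             (SUP s\<in>{1/\<delta> * ln 2..0}. \<integral>\<^sup>+\<omega>. ennreal (\<bar>random_integral A Y s 0 \<omega>\<bar> powr \<gamma>) \<partial>M) < \<infinity>))"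
  shows "(\<exists>X. is_log_integral_process M A Y X) \<and>
         (\<forall>X. is_log_integral_process M A Y X \<longrightarrow>
            additive_process M X \<and> dilatively_stable M \<alpha> \<delta> X)"
proof -
  obtain L' \<psi> where bil: "bilateral_levy M L' \<psi>" and path: "AE \<omega> in M. \<forall>t. L' t \<omega> = L t \<omega>"
    using prob_space.two_sided_levy_imp_bilateral[OF assms(3,4)] by blast
  define \<kappa> where "\<kappa> = \<alpha> - \<delta>/2"
  have \<delta>\<kappa>: "\<delta> \<noteq> 0" "\<kappa> > 0" using assms(5) by (auto simp: \<kappa>_def)
  interpret bilateral_levy M L' \<psi> by (rule bil)
  interpret E: exp_integral M L' \<psi> \<delta> \<kappa> by unfold_locales (rule \<delta>\<kappa>)+
  have A: "E.A = A" by (rule ext, unfold E.A_def, unfold A_def \<kappa>_def) (rule refl)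
  have same: "AE \<omega> in M. \<forall>a b. random_integral A Y a b \<omega> = E.I a b \<omega>"
    using path by eventually_elim (simp add: E.I_def A E.Y_def Y_def random_integral_def time_changed_def)
  have "AE \<omega> in M. \<exists>l. ((\<lambda>a. E.I a 0 \<omega>) \<longlongrightarrow> l) at_bot"
    using assms(5)
  proof
    assume "\<delta> > 0 \<and> \<alpha> > \<delta>/2"
    then show ?thesis using E.pathwise_limit_of_bounded_clock by (intro AE_I2) blast
  next
    assume b: "\<delta> < 0 \<and> \<alpha> > - \<delta>/2 \<and> (\<exists>\<gamma> > - \<delta> / (\<alpha> + \<delta>/2).
      (SUP s\<in>{1/\<delta> * ln 2..0}. \<integral>\<^sup>+\<omega>. ennreal (\<bar>random_integral A Y s 0 \<omega>\<bar> powr \<gamma>) \<partial>M) < \<infinity>)"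
    then obtain \<gamma> where \<gamma>: "\<gamma> > - \<delta> / (\<alpha> + \<delta>/2)"
      and fin: "(SUP s\<in>{1/\<delta> * ln 2..0}. \<integral>\<^sup>+\<omega>. ennreal (\<bar>random_integral A Y s 0 \<omega>\<bar> powr \<gamma>) \<partial>M) < \<infinity>" by blast
    have sum: "\<kappa> + \<delta> = \<alpha> + \<delta>/2" by (simp add: \<kappa>_def)
    have pos: "\<kappa> + \<delta> > 0" using b unfolding sum by simp
    have \<gamma>': "\<gamma> * (\<kappa> + \<delta>) > - \<delta>" 
      using \<gamma> unfolding sum[symmetric] by (rule iffD1[OF pos_divide_less_eq[OF pos]])
    have "(\<integral>\<^sup>+\<omega>. ennreal (\<bar>random_integral A Y s 0 \<omega>\<bar> powr \<gamma>) \<partial>M) = (\<integral>\<^sup>+\<omega>. ennreal (\<bar>E.I s 0 \<omega>\<bar> powr \<gamma>) \<partial>M)" for s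
    proof (rule nn_integral_cong_AE)
      show "AE \<omega> in M. ennreal (\<bar>random_integral A Y s 0 \<omega>\<bar> powr \<gamma>) = ennreal (\<bar>E.I s 0 \<omega>\<bar> powr \<gamma>)"
        using same by eventually_elim simp
    qed
    with fin have "(SUP s\<in>{1/\<delta> * ln 2..0}. \<integral>\<^sup>+\<omega>. ennreal (\<bar>E.I s 0 \<omega>\<bar> powr \<gamma>) \<partial>M) < \<infinity>" by simp
    then show ?thesis using E.AE_limit_of_block_moments[OF _ \<gamma>' pos] b by blast
  qed
  from E.log_integral_process_stable[OF path this \<kappa>_def] show ?thesis
    unfolding A Y_def .
qed

end
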